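(* Let a hypersurface germ $(V,0)\subset(\mathbb{C}^{n+1},0)$, $n\ge1$, be given by an equation $f=0$ with $f=f_d+f_{d+1}+\cdots$, where $f_j$ denotes the homogeneous part of $f$ of degree $j$, $d\geq 1$ and $f_d\neq0$. Suppose that the tangent cone $\{f_d=0\}$ is reduced. Then the arc filtration on the ring $\mathcal{O}_{V,0}$ coincides with the filtration by powers of the maximal ideal, i.e. $F_i=\mathfrak{m}^i$ for all $i\ge0$, where $\mathfrak{m}$ is the maximal ideal of $\mathcal{O}_{V,0}$. Therefore $$P_{V,0}(t)=\frac{1-t^d}{(1-t)^{n+1}}.$$
   Context: For a germ $(V,0)$ of a complex analytic variety, $\mathcal{O}_{V,0}$ is the ring of germs of holomorphic functions on $(V,0)$. For the hypersurface germ $\{f=0\}$, $\mathcal{O}_{V,0}=\mathcal{O}_{\mathbb{C}^{n+1},0}/(f)$. An arc on $(V,0)$ is a germ of a complex analytic mapping $\phi:(\mathbb{C},0)\to(V,0)$. For $g\in\mathcal{O}_{V,0}$, $v_\phi(g)\in\mathbb{Z}_{\ge0}\cup\{+\infty\}$ is the order of vanishing at the origin of $g\circ\phi$ ($+\infty$ if $g\circ\phi\equiv0$), and $v(g)=\min_\phi v_\phi(g)$ over all arcs $\phi$ on $(V,0)$. The arc filtration is given by the ideals $F_i=\{g\in\mathcal{O}_{V,0}: v(g)\ge i\}$, $i\ge0$, and its Poincaré series is $P_{V,0}(t)=\sum_{i\ge0}\dim_{\mathbb{C}}(F_i/F_{i+1})\,t^i$. The tangent cone of $(V,0)$ is given by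 the equation $f_d=0$; it is reduced if the polynomial $f_d$ has no multiple irreducible factors. *)

theory Defs
  imports
    "HOL-Complex_Analysis.Complex_Analysis"
    "HOL-Computational_Algebra.Computational_Algebra"
    "HOL-Library.Poly_Mapping"
    "HOL-Library.Extended_Nat"
    "HOL-Algebra.Algebra"
begin

text \<open>
  Affine space is \<^typ>\<open>complex^'n\<close>.  The derivative in the library is the real Frechet
  derivative, so complex linearity is required separately.
\<close>

definition holo_at_0 :: "(complex^'n::finite \<Rightarrow> complex) \<Rightarrow> bool" where
  "holo_at_0 g \<longleftrightarrow>
     (\<exists>U. open U \<and> 0 \<in> U \<and>
       (\<forall>z\<in>U. \<exists>D. (g has_derivative D) (at z) \<and> (\<forall>c v. D (c *s v) = c * D v)))"

text \<open>
  A germ is represented by total functions; their values outside a neighbourhood of the origin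
  are irrelevant.  The ring of germs is the ring of functions holomorphic near \<open>0\<close> modulo those
  vanishing near \<open>0\<close>.
\<close>

definition holo_fun_ring :: "(complex^'n::finite \<Rightarrow> complex) ring" where
  "holo_fun_ring =
     \<lparr> carrier = {g. holo_at_0 g},
       mult = (\<lambda>g h z. g z * h z), one = (\<lambda>z. 1),
       ring.zero = (\<lambda>z. 0), add = (\<lambda>g h z. g z + h z) \<rparr>"

definition null_funs :: "(complex^'n::finite \<Rightarrow> complex) set" where
  "null_funs = {g. \<forall>\<^sub>F z in nhds 0. g z = 0}"

definition germ_ring :: "(complex^'n::finite \<Rightarrow> complex) set ring" where
  "germ_ring = holo_fun_ring Quot null_funs"

definition germ :: "(complex^'n::finite \<Rightarrow> complex) \<Rightarrow> (complex^'n \<Rightarrow> complex) set" where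
  "germ g = null_funs +>\<^bsub>holo_fun_ring\<^esub> g"

text \<open>
  The local ring of \<open>{f = 0}\<close> is the quotient by the principal ideal of \<open>f\<close>, even if \<open>f\<close> is not
  reduced.
\<close>

definition local_ring :: "(complex^'n::finite \<Rightarrow> complex) \<Rightarrow> (complex^'n \<Rightarrow> complex) set set ring" where
  "local_ring f = germ_ring Quot (PIdl\<^bsub>germ_ring\<^esub> (germ f))"

definition quot_class ::
    "(complex^'n::finite \<Rightarrow> complex) \<Rightarrow> (complex^'n \<Rightarrow> complex) \<Rightarrow> (complex^'n \<Rightarrow> complex) set set" where
  "quot_class f g = (PIdl\<^bsub>germ_ring\<^esub> (germ f)) +>\<^bsub>germ_ring\<^esub> germ g"

text \<open>Well defined when \<open>f 0 = 0\<close>: the ring is then local, with a unique maximal ideal.\<close>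

definition max_ideal :: "(complex^'n::finite \<Rightarrow> complex) \<Rightarrow> (complex^'n \<Rightarrow> complex) set set set" where
  "max_ideal f = (THE M. maximalideal M (local_ring f))"


definition arcs :: "(complex^'n::finite \<Rightarrow> complex) \<Rightarrow> (complex \<Rightarrow> complex^'n) set" where
  "arcs f = {\<phi>. (\<forall>i. (\<lambda>t. \<phi> t $ i) analytic_on {0}) \<and> \<phi> 0 = 0 \<and>
                (\<forall>\<^sub>F t in nhds 0. f (\<phi> t) = 0)}"

text \<open>
  The value of \<open>zorder\<close> is meaningful only for functions that do not vanish identically near
  the point, hence the case distinction.
\<close>

definition vanishing_order :: "(complex \<Rightarrow> complex) \<Rightarrow> enat" where
  "vanishing_order u =
     (if \<forall>\<^sub>F t in nhds 0. u t = 0 then \<infinity> else enat (nat (zorder u 0)))"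

text \<open>
  The infimum over all arcs is a minimum, since \<^typ>\<open>enat\<close> is well-ordered and the
  constant arc always exists.
\<close>

definition arc_val :: "(complex^'n::finite \<Rightarrow> complex) \<Rightarrow> (complex^'n \<Rightarrow> complex) \<Rightarrow> enat" where
  "arc_val f g = (INF \<phi>\<in>arcs f. vanishing_order (\<lambda>t. g (\<phi> t)))"

text \<open>
  \<open>arc_val f g\<close> depends only on \<open>quot_class f g\<close>, because \<open>f\<close> vanishes along every arc.
\<close>

definition arc_filtration ::
    "(complex^'n::finite \<Rightarrow> complex) \<Rightarrow> nat \<Rightarrow> (complex^'n \<Rightarrow> complex) set set set" where
  "arc_filtration f i = {quot_class f g | g. holo_at_0 g \<and> enat i \<le> arc_val f g}"


text \<open>
  The quotient \<open>F\<^sub>i / F\<^sub>i\<^sub>+\<^sub>1\<close> is regarded as a subspace of the ring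
  \<open>\<O> / F\<^sub>i\<^sub>+\<^sub>1\<close>, over the copy of the complex numbers formed by the classes of the
  constant functions.
\<close>

definition graded_ring ::
    "(complex^'n::finite \<Rightarrow> complex) \<Rightarrow> nat \<Rightarrow> (complex^'n \<Rightarrow> complex) set set set ring" where
  "graded_ring f i = local_ring f Quot arc_filtration f (Suc i)"

definition graded_scalars ::
    "(complex^'n::finite \<Rightarrow> complex) \<Rightarrow> nat \<Rightarrow> (complex^'n \<Rightarrow> complex) set set set set" where
  "graded_scalars f i =
     range (\<lambda>c. arc_filtration f (Suc i) +>\<^bsub>local_ring f\<^esub> quot_class f (\<lambda>z. c))"

definition graded_piece ::
    "(complex^'n::finite \<Rightarrow> complex) \<Rightarrow> nat \<Rightarrow> (complex^'n \<Rightarrow> complex) set set set set" where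
  "graded_piece f i =
     (\<lambda>x. arc_filtration f (Suc i) +>\<^bsub>local_ring f\<^esub> x) ` arc_filtration f i"

definition graded_dimension :: "(complex^'n::finite \<Rightarrow> complex) \<Rightarrow> nat \<Rightarrow> nat \<Rightarrow> bool" where
  "graded_dimension f i k \<longleftrightarrow>
     ring.dimension (graded_ring f i) k (graded_scalars f i) (graded_piece f i)"

text \<open>
  Meaningful only if every graded piece is finite-dimensional, i.e. if
  \<^prop>\<open>\<forall>i. \<exists>k. graded_dimension f i k\<close>.
\<close>

definition poincare_series :: "(complex^'n::finite \<Rightarrow> complex) \<Rightarrow> rat fps" where
  "poincare_series f = Abs_fps (\<lambda>i. of_nat (THE k. graded_dimension f i k))"


text \<open>Polynomials in the variables \<^typ>\<open>'n\<close>: exponent vectors mapped to coefficients.\<close>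

type_synonym 'n mpoly = "('n \<Rightarrow>\<^sub>0 nat) \<Rightarrow>\<^sub>0 complex"

definition mpoly_eval :: "'n::finite mpoly \<Rightarrow> complex^'n \<Rightarrow> complex" where
  "mpoly_eval p z =
     (\<Sum>m\<in>Poly_Mapping.keys p. Poly_Mapping.lookup p m * (\<Prod>i\<in>UNIV. z $ i ^ Poly_Mapping.lookup m i))"

definition homogeneous :: "nat \<Rightarrow> 'n::finite mpoly \<Rightarrow> bool" where
  "homogeneous j p \<longleftrightarrow> (\<forall>m\<in>Poly_Mapping.keys p. (\<Sum>i\<in>UNIV. Poly_Mapping.lookup m i) = j)"

text \<open>
  Every function holomorphic near \<open>0\<close> has exactly one such family \<open>P\<close>, the homogeneous parts of
  its Taylor series.
\<close>

definition homogeneous_parts ::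
    "(complex^'n::finite \<Rightarrow> complex) \<Rightarrow> (nat \<Rightarrow> 'n mpoly) \<Rightarrow> bool" where
  "homogeneous_parts f P \<longleftrightarrow>
     (\<forall>j. homogeneous j (P j)) \<and>
     (\<forall>\<^sub>F z in nhds 0. (\<lambda>j. mpoly_eval (P j) z) sums f z)"

definition no_multiple_factors :: "'n::finite mpoly \<Rightarrow> bool" where
  "no_multiple_factors p \<longleftrightarrow> (\<forall>q. Factorial_Ring.irreducible q \<longrightarrow> \<not> q ^ 2 dvd p)"

end

theory Submission
  imports Defs
begin

text \<open>
  Let \<open>F\<close> be the leading form of \<open>f\<close> and \<open>M\<close> the maximal ideal of the local ring of \<open>{f = 0}\<close>.

  Every arc starts at the origin, so functions in \<open>M\<^sup>i\<close> vanish along it to order at least \<open>i\<close>.  Conversely,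
  let \<open>g\<close> have order \<open>k\<close> and leading form \<open>p\<close>.  If \<open>F\<close> divides \<open>p\<close>, subtracting a multiple of \<open>f\<close> raises
  the order of \<open>g\<close> without changing its class.  Otherwise, as \<open>F\<close> has no multiple factors, the
  tangent cone \<open>{F = 0}\<close> has a smooth point at which \<open>p\<close> does not vanish
  (\<open>smooth_point_off_divisor\<close>), and by the implicit function theorem there is an arc on \<open>{f = 0}\<close> with
  this tangent direction (\<open>smooth_arc\<close>).  Along it \<open>g\<close> vanishes to order exactly \<open>k\<close>.  Hence the order along arcs of
  a class is the largest order of its representatives (\<open>arc_filtration_eq_quot_max_pow\<close>).

  The smooth point is found by restricting to lines \<open>a + T e\<close> in a fixed direction \<open>e\<close> with \<open>F e \<noteq> 0\<close>.
  It has to be shown that a form without multiple factors has only simple roots on a generic such line.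
  Otherwise the repeated roots define a nontrivial common divisor over the field of rational functions of
  \<open>a\<close>.  Its coefficients are locally bounded, since its roots are roots of \<open>F\<close>, and a
  locally bounded quotient of polynomials is a polynomial (\<open>polyfun_dvd_if_bounded\<close>).  This yields a
  multiple factor of \<open>F\<close> without any use of unique factorisation (\<open>generic_gcd\<close>).

  On the analytic side Hadamard's lemma (\<open>Hadamard\<close>) replaces power series in several
  variables: it identifies the powers of the maximal ideal of the ring of germs in affine space with the
  functions of given vanishing order and provides leading forms.

  Finally, the class of a function in the graded piece of degree \<open>i\<close> is determined by its leading form
  modulo the multiples of \<open>F\<close>.  So this piece has the dimension of the space of forms of degree \<open>i\<close>
  minus that of the space of forms of degree \<open>i - d\<close> (\<open>graded_dimension_formula\<close>), and these numbers are the
  coefficients of the asserted series.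
\<close>

text \<open>
  From here on \<open>$\<close> selects the coordinates of a vector, and \<open>coeff\<close>, \<open>monom\<close>, \<open>smult\<close>, \<open>degree\<close>
  and \<open>lead_coeff\<close> are those of univariate polynomials.  Points \<open>t *s (p + y *s e)\<close> occur
  throughout as points of arcs and have to keep this form, hence the removal of the distributive
  laws from the simplifier.
\<close>

no_notation fps_nth (infixl "$" 75)
hide_const (open) up_ring.coeff up_ring.monom module.smult Polynomials.degree Polynomials.lead_coeff
declare vector_add_ldistrib [simp del] vector_sadd_rdistrib [simp del]

section \<open>Holomorphic functions of several variables\<close>

text \<open>
  The derivative is recorded by its complex partial derivatives \<open>d\<close>, so that complex linearity
  is built into the form of the right-hand side.
\<close>

definition has_partials :: "(complex^'n::finite \<Rightarrow> complex) \<Rightarrow> ('n \<Rightarrow> complex) \<Rightarrow> complex^'n \<Rightarrow> bool" where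
  "has_partials g d z \<longleftrightarrow> (g has_derivative (\<lambda>v. \<Sum>j\<in>UNIV. v $ j * d j)) (at z)"

lemma complex_linear_expansion:
  fixes D :: "complex^'n::finite \<Rightarrow> complex"
  assumes "linear D" and "\<And>c v. D (c *s v) = c * D v"
  shows "D = (\<lambda>v. \<Sum>j\<in>UNIV. v $ j * D (axis j 1))"
proof
  fix v :: "complex^'n"
  have "D v = D (\<Sum>j\<in>UNIV. v $ j *s axis j 1)" by (simp add: basis_expansion)
  also have "\<dots> = (\<Sum>j\<in>UNIV. v $ j * D (axis j 1))"
    using assms by (simp add: linear_sum)
  finally show "D v = (\<Sum>j\<in>UNIV. v $ j * D (axis j 1))" .
qed

lemma holo_at_0_iff_has_partials:
  "holo_at_0 g \<longleftrightarrow> (\<exists>r>0. \<forall>z\<in>ball 0 r. \<exists>d. has_partials g d z)"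
proof
  assume "holo_at_0 g"
  then obtain U where U: "open U" "0 \<in> U"
    and D: "\<And>z. z \<in> U \<Longrightarrow> \<exists>D. (g has_derivative D) (at z) \<and> (\<forall>c v. D (c *s v) = c * D v)"
    unfolding holo_at_0_def by blast
  obtain r where r: "r > 0" "ball 0 r \<subseteq> U" using U by (meson openE)
  have "\<exists>d. has_partials g d z" if "z \<in> ball 0 r" for z
  proof -
    have "z \<in> U" using that r by auto
    from D[OF this] obtain D where D: "(g has_derivative D) (at z)" "\<And>c v. D (c *s v) = c * D v"
      by auto
    have "D = (\<lambda>v. \<Sum>j\<in>UNIV. v $ j * D (axis j 1))"
      by (intro complex_linear_expansion has_derivative_linear[OF D(1)] D(2))
    from has_derivative_eq_rhs[OF D(1) this] show ?thesis
      unfolding has_partials_def by (intro exI)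
  qed
  with r show "\<exists>r>0. \<forall>z\<in>ball 0 r. \<exists>d. has_partials g d z" by blast
next
  assume "\<exists>r>0. \<forall>z\<in>ball 0 r. \<exists>d. has_partials g d z"
  then obtain r where r: "r > 0" "\<And>z. z\<in>ball 0 r \<Longrightarrow> \<exists>d. has_partials g d z" by blast
  have "\<exists>D. (g has_derivative D) (at z) \<and> (\<forall>c v. D (c *s v) = c * D v)" if z: "z \<in> ball 0 r" for z
  proof -
    obtain d where d: "has_partials g d z" using r(2)[OF z] by blast
    have "(\<Sum>j\<in>UNIV. (c *s v) $ j * d j) = c * (\<Sum>j\<in>UNIV. v $ j * d j)" for c v
      by (simp add: sum_distrib_left mult.assoc)
    with d show ?thesis unfolding has_partials_def by blast
  qed
  then show "holo_at_0 g" unfolding holo_at_0_def using r(1)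
    by (intro exI[of _ "ball 0 r"]) auto
qed

lemma has_partials_const: "has_partials (\<lambda>z. c) (\<lambda>j. 0) z"
  by (simp add: has_partials_def)

lemma has_partials_coord: "has_partials (\<lambda>z. z $ i) (\<lambda>j. if j = i then 1 else 0) z"
proof -
  have "v $ j * (if j = i then 1 else 0) = (if j = i then v $ j else 0)" for v :: "complex^'a" and j
    by simp
  then show ?thesis
    by (simp add: has_partials_def bounded_linear_imp_has_derivative bounded_linear_vec_nth
          del: mult_cancel_left1 mult_eq_0_iff)
qed

lemma has_partials_add:
  "has_partials g d z \<Longrightarrow> has_partials h e z \<Longrightarrow> has_partials (\<lambda>z. g z + h z) (\<lambda>j. d j + e j) z"
  unfolding has_partials_def
  by (rule has_derivative_eq_rhs, (rule has_derivative_add; assumption))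
     (simp add: algebra_simps sum.distrib)

lemma has_partials_mult:
  "has_partials g d z \<Longrightarrow> has_partials h e z \<Longrightarrow> has_partials (\<lambda>z. g z * h z) (\<lambda>j. g z * e j + d j * h z) z"
  unfolding has_partials_def
  by (rule has_derivative_eq_rhs, (rule has_derivative_mult; assumption))
     (simp add: algebra_simps sum.distrib sum_distrib_left)

lemma has_partials_inverse:
  assumes "has_partials g d z" "g z \<noteq> 0"
  shows "has_partials (\<lambda>z. inverse (g z)) (\<lambda>j. - (d j / (g z)\<^sup>2)) z"
  unfolding has_partials_def
proof (rule has_derivative_eq_rhs)
  show "((\<lambda>z. inverse (g z)) has_derivative
      (\<lambda>v. - (inverse (g z) * (\<Sum>j\<in>UNIV. v $ j * d j) * inverse (g z)))) (at z)"
    using assms unfolding has_partials_def by (intro Deriv.has_derivative_inverse)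
qed (simp add: sum_negf sum_distrib_left sum_distrib_right power2_eq_square divide_inverse mult_ac)

lemma has_partials_continuous: "has_partials g d z \<Longrightarrow> isCont g z"
  unfolding has_partials_def using has_derivative_continuous by blast

lemma has_partials_cong:
  assumes "has_partials g d z" "open U" "z \<in> U" "\<And>w. w \<in> U \<Longrightarrow> h w = g w"
  shows "has_partials h d z"
  using has_derivative_transform_within_open[of g _ z UNIV U h] assms unfolding has_partials_def by simp

lemma has_partials_curve:
  assumes "has_partials g d (\<phi> t)" and "\<And>i. ((\<lambda>s. \<phi> s $ i) has_field_derivative e i) (at t)"
  shows "((\<lambda>s. g (\<phi> s)) has_field_derivative (\<Sum>j\<in>UNIV. e j * d j)) (at t)"
proof -
  have "(\<phi> has_derivative (\<lambda>h. \<chi> i. e i * h)) (at t)"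
    using assms(2) unfolding has_field_derivative_def
    by (subst has_derivative_componentwise_within) (auto simp: Basis_vec_def inner_axis intro!: has_derivative_inner_left)
  then have "(g \<circ> \<phi> has_derivative (\<lambda>v. \<Sum>j\<in>UNIV. v $ j * d j) \<circ> (\<lambda>h. \<chi> i. e i * h)) (at t)"
    using assms(1) unfolding has_partials_def by (rule diff_chain_at)
  then show ?thesis
    unfolding has_field_derivative_def o_def
    by (rule has_derivative_eq_rhs) (simp add: fun_eq_iff sum_distrib_left sum_distrib_right mult_ac)
qed

lemma has_partials_line:
  assumes "has_partials g d (z + t *s v)"
  shows "((\<lambda>s. g (z + s *s v)) has_field_derivative (\<Sum>j\<in>UNIV. v $ j * d j)) (at t)"
  proof (rule has_partials_curve[where \<phi> = "\<lambda>s. z + s *s v", OF assms])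
  show "((\<lambda>s. (z + s *s v) $ i) has_field_derivative v $ i) (at t)" for i
    unfolding vector_add_component vector_smult_component by (auto intro!: derivative_eq_intros)
qed

lemma norm_axis_complex: "norm (axis j c :: complex^'n::finite) = norm c"
proof -
  have "norm (axis j c $ i) ^ 2 = (if i = j then norm c ^ 2 else 0)" for i :: 'n
    by (simp add: axis_def)
  then show ?thesis by (simp add: norm_vec_def L2_set_def)
qed

lemma norm_scalar_mult: "norm (c *s v) = norm c * norm (v::complex^'n::finite)"
  unfolding norm_vec_def vector_smult_component norm_mult
  by (rule L2_set_right_distrib[symmetric]) simp

lemma continuous_on_snd_compose:
  "continuous_on T b \<Longrightarrow> continuous_on (U \<times> T) (\<lambda>y. b (snd y))"
  by (rule continuous_on_compose2[of T b _ snd]) (auto intro: continuous_on_snd continuous_on_id)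

text \<open>
  The point of the common shape \<open>k t * g (a t *\<^sub>R z + b t)\<close> is that it covers both integrals
  needed for Hadamard's lemma: Cauchy's formula for partial derivatives (\<open>a = 1\<close>, \<open>b\<close> a circle) and the
  mean value formula (\<open>a t = t\<close>, \<open>b = 0\<close>).
\<close>

lemma has_partials_integral:
  fixes a :: "real \<Rightarrow> real" and b :: "real \<Rightarrow> complex^'n::finite" and k :: "real \<Rightarrow> complex"
  assumes g: "\<And>z. z \<in> S \<Longrightarrow> has_partials g (d z) z"
    and d: "\<And>j. continuous_on S (\<lambda>z. d z j)"
    and cont: "continuous_on {0..1} a" "continuous_on {0..1} b" "continuous_on {0..1} k"
    and U: "open U" "convex U" "x0 \<in> U"
    and sub: "\<And>z t. z \<in> U \<Longrightarrow> t \<in> {0..1} \<Longrightarrow> a t *\<^sub>R z + b t \<in> S"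
  shows "has_partials (\<lambda>z. integral {0..1} (\<lambda>t. k t * g (a t *\<^sub>R z + b t)))
           (\<lambda>j. integral {0..1} (\<lambda>t. k t * a t * d (a t *\<^sub>R x0 + b t) j)) x0"
proof -
  define c where "c x t j = k t * a t * d (a t *\<^sub>R x + b t) j" for x t j
  define B where "B x t = Blinfun (\<lambda>v. \<Sum>j\<in>UNIV. v $ j * c x t j)" for x t
  have B: "blinfun_apply (B x t) = (\<lambda>v. \<Sum>j\<in>UNIV. v $ j * c x t j)" for x t
    unfolding B_def
    by (intro bounded_linear_Blinfun_apply bounded_linear_sum bounded_linear_mult_const
          bounded_linear_vec_nth)
  have cont': "continuous_on (U \<times> {0..1}) (\<lambda>y. a (snd y))" "continuous_on (U \<times> {0..1}) (\<lambda>y. b (snd y))"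
    "continuous_on (U \<times> {0..1}) (\<lambda>y. k (snd y))"
    by (intro continuous_on_snd_compose cont)+
  have contd: "continuous_on (U \<times> {0..1}) (\<lambda>y. c (fst y) (snd y) j)" for j
  proof -
    have "continuous_on (U \<times> {0..1}) (\<lambda>y. a (snd y) *\<^sub>R fst y + b (snd y))"
      by (intro continuous_on_add continuous_on_scaleR cont' continuous_on_fst continuous_on_id)
    then have "continuous_on (U \<times> {0..1}) (\<lambda>y. d (a (snd y) *\<^sub>R fst y + b (snd y)) j)"
      by (rule continuous_on_compose2[OF d, where f = "\<lambda>y. a (snd y) *\<^sub>R fst y + b (snd y)"])
         (auto intro: sub)
    then show ?thesis unfolding c_def
      by (intro continuous_on_mult continuous_on_of_real cont')
  qed
  have contB: "continuous_on (U \<times> {0..1}) (\<lambda>(x, t). B x t)"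
    unfolding split_beta
    by (rule continuous_on_blinfun_componentwise, unfold B)
      (intro continuous_on_sum continuous_on_mult continuous_on_const contd)
  have contg: "continuous_on S g"
    using g has_partials_continuous continuous_at_imp_continuous_on by blast
  have der: "((\<lambda>x. k t * g (a t *\<^sub>R x + b t)) has_derivative blinfun_apply (B x t)) (at x within U)"
    if "x \<in> U" "t \<in> cbox 0 1" for x t
  proof -
    have 1: "((\<lambda>x. a t *\<^sub>R x + b t) has_derivative (\<lambda>v. a t *\<^sub>R v)) (at x)"
      by (auto intro!: derivative_eq_intros)
    have "a t *\<^sub>R x + b t \<in> S" using that by (intro sub) auto
    from g[OF this, unfolded has_partials_def]
    have 2: "(g has_derivative (\<lambda>v. \<Sum>j\<in>UNIV. v $ j * d (a t *\<^sub>R x + b t) j)) (at (a t *\<^sub>R x + b t))" .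
    have "((\<lambda>x. g (a t *\<^sub>R x + b t)) has_derivative
        (\<lambda>v. \<Sum>j\<in>UNIV. (a t *\<^sub>R v) $ j * d (a t *\<^sub>R x + b t) j)) (at x)"
      by (rule has_derivative_compose[OF 1 2])
    then have 3: "((\<lambda>x. k t * g (a t *\<^sub>R x + b t)) has_derivative
        (\<lambda>v. k t * (\<Sum>j\<in>UNIV. (a t *\<^sub>R v) $ j * d (a t *\<^sub>R x + b t) j))) (at x)"
      by (rule has_derivative_mult_right)
    have 4: "(\<lambda>v. k t * (\<Sum>j\<in>UNIV. (a t *\<^sub>R v) $ j * d (a t *\<^sub>R x + b t) j)) = blinfun_apply (B x t)"
      unfolding B c_def sum_distrib_left
      by (intro ext sum.cong) (simp_all only: vector_scaleR_component scaleR_conv_of_real[where 'a = complex] mult_ac)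
    show ?thesis using has_derivative_at_withinI[OF 3] unfolding 4 .
  qed
  have int_der: "((\<lambda>x. integral (cbox 0 1) (\<lambda>t. k t * g (a t *\<^sub>R x + b t))) has_derivative
      blinfun_apply (integral (cbox 0 1) (B x0))) (at x0 within U)"
  proof (rule leibniz_rule[OF der])
    show "(\<lambda>t. k t * g (a t *\<^sub>R x + b t)) integrable_on cbox 0 1" if "x \<in> U" for x
      unfolding cbox_interval
      by (intro integrable_continuous_interval continuous_on_mult cont,
          rule continuous_on_compose2[OF contg])
         (auto intro!: continuous_on_add continuous_on_scaleR continuous_on_const cont intro: sub that)
  qed (use U contB in auto)
  have int_B: "blinfun_apply (integral (cbox 0 1) (B x0)) v =
      (\<Sum>j\<in>UNIV. v $ j * integral {0..1} (\<lambda>t. c x0 t j))" for v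
  proof -
    have int: "(\<lambda>t. c x0 t j) integrable_on {0..1}" for j
      by (rule integrable_continuous_interval,
          rule continuous_on_compose2[OF contd, of _ "\<lambda>t. (x0, t)", unfolded fst_conv snd_conv])
         (auto intro!: continuous_on_Pair continuous_on_const continuous_on_id U)
    have "continuous_on {0..1} (B x0)"
      by (rule continuous_on_compose2[OF contB, of _ "\<lambda>t. (x0, t)", unfolded prod.case])
         (auto intro!: continuous_on_Pair continuous_on_const continuous_on_id U)
    then have "blinfun_apply (integral (cbox 0 1) (B x0)) v = integral {0..1} (\<lambda>t. B x0 t v)"
      by (subst blinfun_apply_integral) (auto intro: integrable_continuous_interval)
    also have "\<dots> = (\<Sum>j\<in>UNIV. v $ j * integral {0..1} (\<lambda>t. c x0 t j))"
      unfolding B by (subst integral_sum) (auto intro!: integrable_on_mult_right int)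
    finally show ?thesis .
  qed
  have "blinfun_apply (integral (cbox 0 1) (B x0)) =
      (\<lambda>v. \<Sum>j\<in>UNIV. v $ j * integral {0..1} (\<lambda>t. c x0 t j))"
    by (rule ext) (rule int_B)
  with int_der show ?thesis
    unfolding has_partials_def c_def at_within_open[OF U(3,1)] cbox_interval by simp
qed

section \<open>Hadamard's lemma\<close>

text \<open>
  Cauchy's formula in one variable, applied on the disc of radius \<open>r\<close> in direction \<open>j\<close> around \<open>z\<close>.
  It expresses a partial derivative by values of \<open>g\<close>, which makes it as regular as \<open>g\<close>.
\<close>

lemma partial_eq_Cauchy_integral:
  fixes g :: "complex^'n::finite \<Rightarrow> complex"
  assumes g: "\<And>z. z \<in> ball 0 R \<Longrightarrow> has_partials g (d z) z"
    and r: "r > 0" "norm z + r < R"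
  shows "d z j = integral {0..1} (\<lambda>t. exp (- (2 * of_real pi * \<i> * of_real t)) / of_real r *
           g (1 *\<^sub>R z + (of_real r * exp (2 * of_real pi * \<i> * of_real t)) *s axis j 1))"
proof -
  define h where "h s = g (z + s *s axis j 1)" for s
  have der: "(h has_field_derivative d (z + s *s axis j 1) j) (at s)" if "norm z + norm s < R" for s
  proof -
    have "norm (z + s *s axis j 1) \<le> norm z + norm s"
      using norm_triangle_ineq[of z "s *s axis j 1"] by (simp add: norm_scalar_mult norm_axis_complex)
    then have "z + s *s axis j 1 \<in> ball 0 R" using that by simp
    moreover have "axis j 1 $ i * c i = (if i = j then c i else 0)" for i and c :: "'n \<Rightarrow> complex"
      by (simp add: axis_def)
    ultimately show ?thesis
      using has_partials_line[OF g] unfolding h_def by fastforce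
  qed
  have hol: "h holomorphic_on ball 0 (R - norm z)"
  proof -
    have "\<exists>f'. (h has_field_derivative f') (at s)" if "s \<in> ball 0 (R - norm z)" for s
    proof -
      have "norm z + norm s < R" using that by (simp add: less_diff_eq add.commute)
      from der[OF this] show ?thesis by blast
    qed
    then show ?thesis by (simp add: holomorphic_on_open)
  qed
  have "cball 0 r \<subseteq> ball 0 (R - norm z)" using r by auto
  then have "h holomorphic_on cball 0 r" by (rule holomorphic_on_subset[OF hol])
  then have "continuous_on (cball 0 r) h" "h holomorphic_on ball 0 r"
    by (auto intro: holomorphic_on_imp_continuous_on holomorphic_on_subset ball_subset_cball)
  from Cauchy_has_contour_integral_higher_derivative_circlepath[OF this, of 0 1]
  have "((\<lambda>u. h u / u ^ 2) has_contour_integral (2 * pi * \<i>) * deriv h 0) (circlepath 0 r)"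
    using r by (simp add: numeral_2_eq_2)
  moreover have "deriv h 0 = d z j" using der[of 0] r by (simp add: DERIV_imp_deriv)
  ultimately have "((\<lambda>u. h u / u ^ 2) has_contour_integral (2 * pi * \<i>) * d z j) (circlepath 0 r)" by simp
  then have "((\<lambda>t. h (circlepath 0 r t) / circlepath 0 r t ^ 2 * vector_derivative (circlepath 0 r) (at t within {0..1}))
      has_integral (2 * pi * \<i>) * d z j) {0..1}"
    unfolding has_contour_integral_def by simp
  moreover have "h (circlepath 0 r t) / circlepath 0 r t ^ 2 * vector_derivative (circlepath 0 r) (at t within {0..1})
      = (2 * pi * \<i>) * (exp (- (2 * of_real pi * \<i> * of_real t)) / of_real r *
           h (of_real r * exp (2 * of_real pi * \<i> * of_real t)))" if "t \<in> {0..1}" for t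
  proof -
    define E where "E = exp (2 * of_real pi * \<i> * of_real t :: complex)"
    have "circlepath 0 r t = of_real r * E" by (simp add: circlepath E_def)
    moreover have "vector_derivative (circlepath 0 r) (at t within {0..1}) = 2 * pi * \<i> * r * E"
      using that by (simp add: vector_derivative_circlepath01 E_def)
    moreover have "E \<noteq> 0" by (simp add: E_def)
    ultimately show ?thesis
      using r unfolding exp_minus E_def[symmetric] by (simp add: field_simps power2_eq_square)
  qed
  ultimately have *: "((\<lambda>t. (2 * pi * \<i>) * (exp (- (2 * of_real pi * \<i> * of_real t)) / of_real r *
           h (of_real r * exp (2 * of_real pi * \<i> * of_real t))))
      has_integral (2 * pi * \<i>) * d z j) {0..1}"
    by (rule has_integral_eq[rotated])
  have cancel: "(K has_integral y) A" if "((\<lambda>t. c * K t) has_integral c * y) A" "c \<noteq> 0"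
    for K :: "real \<Rightarrow> complex" and c y A
    using has_integral_mult_right[OF that(1), of "inverse c"] that(2) by (simp add: mult.assoc[symmetric])
  have "((\<lambda>t. exp (- (2 * of_real pi * \<i> * of_real t)) / of_real r *
           h (of_real r * exp (2 * of_real pi * \<i> * of_real t))) has_integral d z j) {0..1}"
    by (rule cancel[OF *]) simp
  then show ?thesis unfolding h_def scaleR_one by (rule integral_unique[symmetric])
qed

lemma circle_continuous:
  "continuous_on {0..1} (\<lambda>t. (of_real r * exp (2 * of_real pi * \<i> * of_real t)) *s axis j (1::complex))"
  "continuous_on {0..1} (\<lambda>t. exp (- (2 * of_real pi * \<i> * of_real t)) / of_real r)"
proof -
  have "(\<lambda>t::real. (of_real r * exp (2 * of_real pi * \<i> * of_real t)) *s axis j (1::complex)) =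
     (\<lambda>t. \<chi> i. (of_real r * exp (2 * of_real pi * \<i> * of_real t)) * axis j 1 $ i)"
    by (simp add: fun_eq_iff vec_eq_iff)
  then show "continuous_on {0..1} (\<lambda>t. (of_real r * exp (2 * of_real pi * \<i> * of_real t)) *s axis j (1::complex))"
    by (simp only:) (intro continuous_intros)
  show "continuous_on {0..1} (\<lambda>t. exp (- (2 * of_real pi * \<i> * of_real t)) / of_real r)"
    by (cases "r = 0") (auto intro!: continuous_intros)
qed

lemma norm_circle_add:
  assumes "r \<ge> 0"
  shows "norm (1 *\<^sub>R z + (of_real r * exp (2 * of_real pi * \<i> * of_real t)) *s axis j (1::complex)) \<le> norm z + r"
  using norm_triangle_ineq[of z "(of_real r * exp (2 * of_real pi * \<i> * of_real t)) *s axis j (1::complex)"] assms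
  by (simp add: norm_scalar_mult norm_axis_complex norm_mult)

lemma partial_continuous:
  fixes g :: "complex^'n::finite \<Rightarrow> complex"
  assumes g: "\<And>z. z \<in> ball 0 (3 * r) \<Longrightarrow> has_partials g (d z) z" and r: "r > 0"
  shows "continuous_on (ball 0 r) (\<lambda>z. d z j)"
proof -
  define b where "b t = (of_real r * exp (2 * of_real pi * \<i> * of_real t)) *s axis j (1::complex)" for t :: real
  define k where "k t = exp (- (2 * of_real pi * \<i> * of_real t)) / of_real r" for t :: real
  have bk: "continuous_on {0..1} b" "continuous_on {0..1} k"
    unfolding b_def k_def by (rule circle_continuous)+
  have contg: "continuous_on (ball 0 (3 * r)) g"
    using g has_partials_continuous continuous_at_imp_continuous_on by blast
  have "norm (1 *\<^sub>R z + b t) < 3 * r" if "z \<in> ball 0 r" for z t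
    using norm_circle_add[of r z t j] that r unfolding b_def by simp
  then have "continuous_on (ball 0 r \<times> {0..1}) (\<lambda>y. g (1 *\<^sub>R fst y + b (snd y)))"
    by (intro continuous_on_compose2[OF contg, where f = "\<lambda>y. 1 *\<^sub>R fst y + b (snd y)"] continuous_on_add
         continuous_on_scaleR continuous_on_const continuous_on_fst continuous_on_id)
       (auto intro!: continuous_on_snd_compose bk)
  then have "continuous_on (ball 0 r \<times> cbox 0 1) (\<lambda>(z,t). k t * g (1 *\<^sub>R z + b t))"
    unfolding split_beta cbox_interval
    by (intro continuous_on_mult continuous_on_snd_compose bk)
  then have "continuous_on (ball 0 r) (\<lambda>z. integral (cbox 0 1) (\<lambda>t. k t * g (1 *\<^sub>R z + b t)))"
    by (rule integral_continuous_on_param)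
  moreover have "integral (cbox 0 1) (\<lambda>t. k t * g (1 *\<^sub>R z + b t)) = d z j" if "z \<in> ball 0 r" for z
    unfolding k_def b_def cbox_interval using r that
    by (intro partial_eq_Cauchy_integral[OF g, symmetric]) auto
  ultimately show ?thesis by (rule continuous_on_eq)
qed

text \<open>
  Partial derivatives are again holomorphic: differentiate Cauchy's formula under the integral sign.
  The radius shrinks by a factor of 3 for the circle of integration, and by another 3 for the continuity of the
  partial derivatives on it.
\<close>

lemma partial_has_partials:
  fixes g :: "complex^'n::finite \<Rightarrow> complex"
  assumes g: "\<And>z. z \<in> ball 0 (9 * r) \<Longrightarrow> has_partials g (d z) z" and r: "r > 0" and z: "z \<in> ball 0 r"
  shows "\<exists>e. has_partials (\<lambda>z. d z j) e z"
proof -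
  define b where "b t = (of_real r * exp (2 * of_real pi * \<i> * of_real t)) *s axis j (1::complex)" for t :: real
  define k where "k t = exp (- (2 * of_real pi * \<i> * of_real t)) / of_real r" for t :: real
  have *: "has_partials (\<lambda>z. integral {0..1} (\<lambda>t. k t * g (1 *\<^sub>R z + b t)))
           (\<lambda>j. integral {0..1} (\<lambda>t. k t * complex_of_real 1 * d (1 *\<^sub>R z + b t) j)) z"
  proof (rule has_partials_integral[where S = "ball 0 (3 * r)" and U = "ball 0 r"])
    show "has_partials g (d z) z" if "z \<in> ball 0 (3 * r)" for z using that r by (intro g) auto
    show "continuous_on (ball 0 (3 * r)) (\<lambda>z. d z j)" for j
      using partial_continuous[of "3 * r" g d j] g r by simp
    show "continuous_on {0..1} b" "continuous_on {0..1} k"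
      unfolding b_def k_def by (rule circle_continuous)+
    show "1 *\<^sub>R z + b t \<in> ball 0 (3 * r)" if "z \<in> ball 0 r" for z t
      using norm_circle_add[of r z t j] that r unfolding b_def by simp
  qed (use z in auto)
  have "d w j = integral {0..1} (\<lambda>t. k t * g (1 *\<^sub>R w + b t))" if "w \<in> ball 0 r" for w
    unfolding k_def b_def using r that
    by (intro partial_eq_Cauchy_integral[OF g]) auto
  from has_partials_cong[OF * open_ball z this] show ?thesis by blast
qed

text \<open>
  Hadamard's lemma.  By the mean value formula
  \<open>g z - g 0 = \<Sum>j. z\<^sub>j * (\<integral> 0..1. \<partial>\<^sub>j g (t z) dt)\<close>, and the integrals are holomorphic in \<open>z\<close>.
  This one division step replaces power series in several variables: iterated, it shows that the
  functions vanishing at \<open>0\<close> to order \<open>i\<close> form the \<open>i\<close>-th power of the maximal ideal.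
\<close>

lemma Hadamard:
  fixes g :: "complex^'n::finite \<Rightarrow> complex"
  assumes "holo_at_0 g"
  obtains h where "\<And>j. holo_at_0 (h j)" "\<forall>\<^sub>F z in nhds 0. g z = g 0 + (\<Sum>j\<in>UNIV. z $ j * h j z)"
proof -
  obtain R0 where R0: "R0 > 0" "\<And>z. z \<in> ball 0 R0 \<Longrightarrow> \<exists>d. has_partials g d z"
    using assms unfolding holo_at_0_iff_has_partials by blast
  \<comment> \<open>a factor 9 for differentiating the partial derivatives, and 3 for their continuity\<close>
  define r where "r = R0 / 27"
  have r: "r > 0" using R0 by (simp add: r_def)
  define d where "d z = (SOME d. has_partials g d z)" for z
  have g: "has_partials g (d z) z" if "z \<in> ball 0 (9 * (3 * r))" for z
    using someI_ex[OF R0(2)[of z]] that unfolding d_def r_def by simp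
  define e where "e z j = (SOME e. has_partials (\<lambda>z. d z j) e z)" for z j
  have e: "has_partials (\<lambda>z. d z j) (e z j) z" if "z \<in> ball 0 (3 * r)" for z j
    unfolding e_def
    by (rule someI_ex[OF partial_has_partials[OF g]]) (use r that in auto)
  define h where "h j z = integral {0..1} (\<lambda>t::real. 1 * d (t *\<^sub>R z + 0) j)" for j z
  have in_ball: "t *\<^sub>R z + 0 \<in> ball 0 r" if "z \<in> ball 0 r" "t \<in> {0..1}" for t :: real and z :: "complex^'n"
    using that mult_left_le_one_le[of "norm z" t] by auto
  have "\<exists>e. has_partials (h j) e z" if z: "z \<in> ball 0 r" for j z
    unfolding h_def
  proof (rule exI, rule has_partials_integral[where S = "ball 0 r" and U = "ball 0 r"])
    show "has_partials (\<lambda>z. d z j) (e z j) z" if "z \<in> ball 0 r" for z using that r by (intro e) auto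
    show "continuous_on (ball 0 r) (\<lambda>z. e z j i)" for i
      by (rule partial_continuous[OF e r])
    show "t *\<^sub>R z + 0 \<in> ball 0 r" if "z \<in> ball 0 r" "t \<in> {0..1}" for t :: real and z :: "complex^'n"
      by (rule in_ball[OF that])
  qed (use z in \<open>auto intro: continuous_on_const continuous_on_id\<close>)
  then have hh: "holo_at_0 (h j)" for j
    unfolding holo_at_0_iff_has_partials using r by blast
  have eq: "g z = g 0 + (\<Sum>j\<in>UNIV. z $ j * h j z)" if z: "z \<in> ball 0 r" for z
  proof -
    have contd: "continuous_on (ball 0 r) (\<lambda>z. d z j)" for j
    proof -
      have "isCont (\<lambda>z. d z j) z" if "z \<in> ball 0 r" for z
        using has_partials_continuous[OF e] that r by auto
      then show ?thesis by (simp add: continuous_at_imp_continuous_on)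
    qed
    have "continuous_on {0..1} (\<lambda>t. d (t *\<^sub>R z + 0) j)" for j
      by (rule continuous_on_compose2[OF contd, where f = "\<lambda>t. t *\<^sub>R z + 0"])
         (use in_ball[OF z] in \<open>auto intro!: continuous_intros simp del: mem_ball\<close>)
    then have int: "((\<lambda>t. d (t *\<^sub>R z + 0) j) has_integral h j z) {0..1}" for j
      unfolding h_def by (simp add: integrable_continuous_interval integrable_integral)
    have "((\<lambda>t. \<Sum>j\<in>UNIV. z $ j * d (t *\<^sub>R z + 0) j) has_integral (g (1 *\<^sub>R z + 0) - g (0 *\<^sub>R z + 0))) {0..1}"
    proof (rule fundamental_theorem_of_calculus)
      fix t :: real assume "t \<in> {0..1}"
      then have "t *\<^sub>R z + 0 \<in> ball 0 r" by (rule in_ball[OF z])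
      then have "(g has_derivative (\<lambda>v. \<Sum>j\<in>UNIV. v $ j * d (t *\<^sub>R z + 0) j)) (at (t *\<^sub>R z + 0))"
        using g[of "t *\<^sub>R z + 0"] r unfolding has_partials_def by auto
      moreover have "((\<lambda>t. t *\<^sub>R z + 0) has_derivative (\<lambda>s. s *\<^sub>R z)) (at t)"
        by (auto intro!: derivative_eq_intros)
      ultimately have "((\<lambda>t. g (t *\<^sub>R z + 0)) has_derivative
          (\<lambda>s. \<Sum>j\<in>UNIV. (s *\<^sub>R z) $ j * d (t *\<^sub>R z + 0) j)) (at t)"
        using has_derivative_compose[of "\<lambda>t. t *\<^sub>R z + 0" _ t UNIV g] by blast
      then show "((\<lambda>t. g (t *\<^sub>R z + 0)) has_vector_derivative (\<Sum>j\<in>UNIV. z $ j * d (t *\<^sub>R z + 0) j)) (at t within {0..1})"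
        unfolding has_vector_derivative_def
        by (rule has_derivative_eq_rhs[OF has_derivative_at_withinI])
           (simp only: vector_scaleR_component scaleR_sum_right mult_scaleR_left)
    qed simp
    moreover have "((\<lambda>t. \<Sum>j\<in>UNIV. z $ j * d (t *\<^sub>R z + 0) j) has_integral (\<Sum>j\<in>UNIV. z $ j * h j z)) {0..1}"
      by (intro has_integral_sum has_integral_mult_right int) simp
    ultimately have "g (1 *\<^sub>R z + 0) - g (0 *\<^sub>R z + 0) = (\<Sum>j\<in>UNIV. z $ j * h j z)"
      by (rule has_integral_unique)
    then show ?thesis by (simp add: algebra_simps)
  qed
  have "\<forall>\<^sub>F z in nhds 0. z \<in> ball 0 r" using r by (intro eventually_nhds_in_open) auto
  then have "\<forall>\<^sub>F z in nhds 0. g z = g 0 + (\<Sum>j\<in>UNIV. z $ j * h j z)"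
    by eventually_elim (rule eq)
  with hh show thesis by (rule that)
qed

section \<open>Germs and powers of the maximal ideal\<close>

text \<open>
  Closure of holomorphic germs under a binary operation follows from closure of differentiability
  at a single point.
\<close>

lemma holo_at_0_has_partialsI:
  assumes "holo_at_0 g" "holo_at_0 h"
    and "\<And>z d e. has_partials g d z \<Longrightarrow> has_partials h e z \<Longrightarrow> \<exists>c. has_partials k c z"
  shows "holo_at_0 k"
proof -
  obtain r where r: "r > 0" "\<And>z. z \<in> ball 0 r \<Longrightarrow> \<exists>d. has_partials g d z"
    using assms(1) unfolding holo_at_0_iff_has_partials by blast
  obtain s where s: "s > 0" "\<And>z. z \<in> ball 0 s \<Longrightarrow> \<exists>d. has_partials h d z"
    using assms(2) unfolding holo_at_0_iff_has_partials by blast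
  have "\<exists>c. has_partials k c z" if z: "z \<in> ball 0 (min r s)" for z
  proof -
    obtain d e where "has_partials g d z" "has_partials h e z" using r(2)[of z] s(2)[of z] z by auto
    then show ?thesis by (rule assms(3))
  qed
  with r(1) s(1) show ?thesis
    unfolding holo_at_0_iff_has_partials by (intro exI[of _ "min r s"]) simp
qed

lemma holo_at_0_const [simp]: "holo_at_0 (\<lambda>z. c)"
  unfolding holo_at_0_iff_has_partials using has_partials_const zero_less_one by blast

lemma holo_at_0_coord [simp]: "holo_at_0 (\<lambda>z. z $ i)"
  unfolding holo_at_0_iff_has_partials using has_partials_coord zero_less_one by blast

lemma holo_at_0_add: "holo_at_0 g \<Longrightarrow> holo_at_0 h \<Longrightarrow> holo_at_0 (\<lambda>z. g z + h z)"
  by (erule (1) holo_at_0_has_partialsI) (rule exI, erule (1) has_partials_add)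

lemma holo_at_0_mult: "holo_at_0 g \<Longrightarrow> holo_at_0 h \<Longrightarrow> holo_at_0 (\<lambda>z. g z * h z)"
  by (erule (1) holo_at_0_has_partialsI) (rule exI, erule (1) has_partials_mult)

lemma holo_at_0_uminus: "holo_at_0 g \<Longrightarrow> holo_at_0 (\<lambda>z. - g z)"
  using holo_at_0_mult[of "\<lambda>z. - 1" g] by simp

lemma holo_at_0_diff: "holo_at_0 g \<Longrightarrow> holo_at_0 h \<Longrightarrow> holo_at_0 (\<lambda>z. g z - h z)"
  using holo_at_0_add[of g "\<lambda>z. - h z"] holo_at_0_uminus[of h] by simp

lemma holo_at_0_sum: "finite A \<Longrightarrow> (\<And>a. a \<in> A \<Longrightarrow> holo_at_0 (g a)) \<Longrightarrow> holo_at_0 (\<lambda>z. \<Sum>a\<in>A. g a z)"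
  by (induction A rule: finite_induct) (simp_all add: holo_at_0_add)

lemma holo_at_0_cong:
  assumes "holo_at_0 g" and "\<forall>\<^sub>F z in nhds 0. h z = g z"
  shows "holo_at_0 h"
proof -
  obtain r where r: "r > 0" "\<And>z. z\<in>ball 0 r \<Longrightarrow> \<exists>d. has_partials g d z"
    using assms(1) unfolding holo_at_0_iff_has_partials by blast
  obtain s where s: "s > 0" "\<And>z. z \<in> ball 0 s \<Longrightarrow> h z = g z"
    using assms(2) unfolding eventually_nhds_metric by (auto simp: dist_commute)
  have "\<exists>d. has_partials h d z" if z: "z \<in> ball 0 (min r s)" for z
  proof -
    obtain d where "has_partials g d z" using r(2)[of z] z by auto
    then have "has_partials h d z"
      by (rule has_partials_cong[OF _ open_ball[of 0 s]]) (use z s(2) in auto)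
    then show ?thesis by blast
  qed
  with r(1) s(1) show ?thesis
    unfolding holo_at_0_iff_has_partials by (intro exI[of _ "min r s"]) simp
qed

lemma holo_at_0_isCont: "holo_at_0 g \<Longrightarrow> isCont g 0"
  unfolding holo_at_0_iff_has_partials using has_partials_continuous
  by (metis centre_in_ball)

lemma holo_at_0_inverse:
  assumes "holo_at_0 g" "g 0 \<noteq> 0"
  shows "holo_at_0 (\<lambda>z. inverse (g z))"
proof -
  have "\<forall>\<^sub>F z in nhds 0. g z \<noteq> 0"
    using holo_at_0_isCont[OF assms(1)] assms(2)
    by (simp add: continuous_within tendsto_imp_eventually_ne eventually_nhds_conv_at)
  then obtain s where s: "s > 0" "\<And>z. z \<in> ball 0 s \<Longrightarrow> g z \<noteq> 0"
    unfolding eventually_nhds_metric by (auto simp: dist_commute)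
  obtain r where r: "r > 0" "\<And>z. z\<in>ball 0 r \<Longrightarrow> \<exists>d. has_partials g d z"
    using assms(1) unfolding holo_at_0_iff_has_partials by blast
  have "\<exists>d. has_partials (\<lambda>z. inverse (g z)) d z" if z: "z \<in> ball 0 (min r s)" for z
  proof -
    have "z \<in> ball 0 r" "z \<in> ball 0 s" using z by auto
    with r(2) s(2) has_partials_inverse show ?thesis by blast
  qed
  with r(1) s(1) show ?thesis
    unfolding holo_at_0_iff_has_partials by (intro exI[of _ "min r s"]) simp
qed

lemma tendsto_nhds_curve:
  fixes \<phi> :: "complex \<Rightarrow> complex^'n::finite"
  assumes "\<And>i. (\<lambda>t. \<phi> t $ i) analytic_on {0}" "\<phi> 0 = 0"
  shows "filterlim \<phi> (nhds 0) (nhds 0)"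
proof -
  have "isCont (\<lambda>t. \<phi> t $ i) 0" for i
    using assms(1) by (simp add: analytic_at_imp_isCont)
  then have "isCont \<phi> 0"
    unfolding continuous_within by (intro vec_tendstoI) auto
  then show ?thesis
    unfolding isCont_def tendsto_at_iff_tendsto_nhds using assms(2) by simp
qed

lemma holo_at_0_curve:
  fixes g :: "complex^'n::finite \<Rightarrow> complex"
  assumes "holo_at_0 g" "\<And>i. (\<lambda>t. \<phi> t $ i) analytic_on {0}" "\<phi> 0 = 0"
  shows "(\<lambda>t. g (\<phi> t)) analytic_on {0}"
proof -
  obtain r where r: "r > 0" "\<And>z. z\<in>ball 0 r \<Longrightarrow> \<exists>d. has_partials g d z"
    using assms(1) unfolding holo_at_0_iff_has_partials by blast
  have "\<forall>\<^sub>F z in nhds 0. z \<in> ball 0 r" using r by (intro eventually_nhds_in_open) auto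
  then have 1: "\<forall>\<^sub>F t in nhds 0. \<phi> t \<in> ball 0 r"
    by (rule eventually_compose_filterlim[OF _ tendsto_nhds_curve[OF assms(2,3)]])
  have "\<forall>\<^sub>F t in nhds 0. (\<lambda>t. \<phi> t $ i) field_differentiable at t" for i
  proof -
    obtain S where S: "open S" "0 \<in> S" "(\<lambda>t. \<phi> t $ i) holomorphic_on S"
      using assms(2)[of i] unfolding analytic_at by blast
    have "\<forall>\<^sub>F t in nhds 0. t \<in> S" using S by (intro eventually_nhds_in_open)
    then show ?thesis
      by eventually_elim (use S holomorphic_on_imp_differentiable_at in blast)
  qed
  then have "\<forall>\<^sub>F t in nhds 0. \<forall>i. (\<lambda>t. \<phi> t $ i) field_differentiable at t"
    by (simp add: eventually_all_finite)
  with 1 have "\<forall>\<^sub>F t in nhds 0. (\<lambda>t. g (\<phi> t)) field_differentiable at t"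
  proof eventually_elim
    case (elim t)
    then obtain d where 1: "has_partials g d (\<phi> t)" using r(2)[of "\<phi> t"] by blast
    have "((\<lambda>s. \<phi> s $ i) has_field_derivative deriv (\<lambda>s. \<phi> s $ i) t) (at t)" for i
      using elim by (simp add: field_differentiable_derivI)
    from has_partials_curve[where \<phi> = \<phi> and t = t, OF 1 this] show ?case
      unfolding field_differentiable_def by blast
  qed
  then obtain U where "open U" "0 \<in> U" "\<And>t. t \<in> U \<Longrightarrow> (\<lambda>t. g (\<phi> t)) field_differentiable at t"
    unfolding eventually_nhds by blast
  then show ?thesis
    unfolding analytic_at by (auto simp: holomorphic_on_def intro: field_differentiable_at_within)
qed

lemma analytic_factor_zero:
  assumes "u analytic_on {0}" "u 0 = 0"
  obtains w where "w analytic_on {0}" "\<And>t. u t = t * w t"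
proof -
  obtain S where S: "open S" "0 \<in> S" "u holomorphic_on S"
    using assms(1) unfolding analytic_at by blast
  define w where "w t = (if t = 0 then deriv u 0 else (u t - u 0) / (t - 0))" for t
  have "w holomorphic_on S"
    unfolding w_def using S by (intro pole_lemma) (auto simp: interior_open)
  then have "w analytic_on {0}" unfolding analytic_at using S by blast
  moreover have "u t = t * w t" for t using assms(2) by (simp add: w_def)
  ultimately show thesis by (rule that)
qed

text \<open>
  The \<open>i\<close>-th power of the maximal ideal of the ring of germs at \<open>0\<close> in affine space.  The recursion
  provides exactly the representation \<open>g = \<Sum>j. z\<^sub>j h\<^sub>j\<close> on which all inductions over the order run.
\<close>

primrec max_pow :: "nat \<Rightarrow> (complex^'n::finite \<Rightarrow> complex) set" where
  "max_pow 0 = {g. holo_at_0 g}"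
| "max_pow (Suc i) = {g. \<exists>h. (\<forall>j. h j \<in> max_pow i) \<and> (\<forall>\<^sub>F z in nhds 0. g z = (\<Sum>j\<in>UNIV. z $ j * h j z))}"

lemma max_pow_SucI:
  "(\<And>j. h j \<in> max_pow i) \<Longrightarrow> \<forall>\<^sub>F z in nhds 0. g z = (\<Sum>j\<in>UNIV. z $ j * h j z) \<Longrightarrow> g \<in> max_pow (Suc i)"
  by auto

lemma max_pow_SucE:
  assumes "g \<in> max_pow (Suc i)"
  obtains h where "\<And>j. h j \<in> max_pow i" "\<forall>\<^sub>F z in nhds 0. g z = (\<Sum>j\<in>UNIV. z $ j * h j z)"
  using assms by auto

lemma max_pow_holo: "g \<in> max_pow i \<Longrightarrow> holo_at_0 g"
proof (induction i arbitrary: g)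
  case (Suc i)
  obtain h where h: "\<And>j. h j \<in> max_pow i" "\<forall>\<^sub>F z in nhds 0. g z = (\<Sum>j\<in>UNIV. z $ j * h j z)"
    using max_pow_SucE[OF Suc.prems] by blast
  have "holo_at_0 (\<lambda>z. \<Sum>j\<in>UNIV. z $ j * h j z)"
    by (intro holo_at_0_sum holo_at_0_mult holo_at_0_coord Suc.IH[OF h(1)]) auto
  then show ?case by (rule holo_at_0_cong) (rule h)
qed simp

lemma max_pow_cong: "g \<in> max_pow i \<Longrightarrow> \<forall>\<^sub>F z in nhds 0. h z = g z \<Longrightarrow> h \<in> max_pow i"
proof (cases i)
  case (Suc k)
  assume "g \<in> max_pow i" and eq: "\<forall>\<^sub>F z in nhds 0. h z = g z"
  with Suc obtain q where q: "\<And>j. q j \<in> max_pow k" "\<forall>\<^sub>F z in nhds 0. g z = (\<Sum>j\<in>UNIV. z $ j * q j z)"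
    using max_pow_SucE by blast
  from eq q(2) have "\<forall>\<^sub>F z in nhds 0. h z = (\<Sum>j\<in>UNIV. z $ j * q j z)" by eventually_elim simp
  with q(1) Suc show ?thesis using max_pow_SucI by blast
qed (auto intro: holo_at_0_cong)

lemma max_pow_mult_holo: "holo_at_0 a \<Longrightarrow> g \<in> max_pow i \<Longrightarrow> (\<lambda>z. a z * g z) \<in> max_pow i"
proof (induction i arbitrary: g)
  case (Suc i)
  obtain h where h: "\<And>j. h j \<in> max_pow i" "\<forall>\<^sub>F z in nhds 0. g z = (\<Sum>j\<in>UNIV. z $ j * h j z)"
    using max_pow_SucE[OF Suc.prems(2)] by blast
  show ?case
  proof (rule max_pow_SucI)
    show "(\<lambda>z. a z * h j z) \<in> max_pow i" for j by (intro Suc.IH Suc.prems h)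
    show "\<forall>\<^sub>F z in nhds 0. a z * g z = (\<Sum>j\<in>UNIV. z $ j * (a z * h j z))"
      using h(2) by eventually_elim (simp add: sum_distrib_left mult_ac)
  qed
qed (simp add: holo_at_0_mult)

lemma max_pow_add: "g \<in> max_pow i \<Longrightarrow> g' \<in> max_pow i \<Longrightarrow> (\<lambda>z. g z + g' z) \<in> max_pow i"
proof (induction i arbitrary: g g')
  case (Suc i)
  obtain h where h: "\<And>j. h j \<in> max_pow i" "\<forall>\<^sub>F z in nhds 0. g z = (\<Sum>j\<in>UNIV. z $ j * h j z)"
    using max_pow_SucE[OF Suc.prems(1)] by blast
  obtain h' where h': "\<And>j. h' j \<in> max_pow i" "\<forall>\<^sub>F z in nhds 0. g' z = (\<Sum>j\<in>UNIV. z $ j * h' j z)"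
    using max_pow_SucE[OF Suc.prems(2)] by blast
  show ?case
  proof (rule max_pow_SucI)
    show "(\<lambda>z. h j z + h' j z) \<in> max_pow i" for j by (intro Suc.IH h h')
    show "\<forall>\<^sub>F z in nhds 0. g z + g' z = (\<Sum>j\<in>UNIV. z $ j * (h j z + h' j z))"
      using h(2) h'(2) by eventually_elim (simp add: sum.distrib distrib_left)
  qed
qed (simp add: holo_at_0_add)

lemma max_pow_uminus: "g \<in> max_pow i \<Longrightarrow> (\<lambda>z. - g z) \<in> max_pow i"
  using max_pow_mult_holo[of "\<lambda>z. - 1" g] by simp

lemma max_pow_diff: "g \<in> max_pow i \<Longrightarrow> h \<in> max_pow i \<Longrightarrow> (\<lambda>z. g z - h z) \<in> max_pow i"
  using max_pow_add[OF _ max_pow_uminus] by fastforce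

lemma max_pow_zero: "(\<lambda>z. 0) \<in> max_pow i"
proof (induction i)
  case (Suc i)
  then show ?case by (intro max_pow_SucI[of "\<lambda>j z. 0"]) auto
qed simp

lemma max_pow_sum: "finite A \<Longrightarrow> (\<And>a. a \<in> A \<Longrightarrow> g a \<in> max_pow i) \<Longrightarrow> (\<lambda>z. \<Sum>a\<in>A. g a z) \<in> max_pow i"
  by (induction A rule: finite_induct) (simp_all add: max_pow_add max_pow_zero)

lemma max_pow_coord_mult: "g \<in> max_pow i \<Longrightarrow> (\<lambda>z. z $ j * g z) \<in> max_pow (Suc i)"
proof (rule max_pow_SucI)
  assume g: "g \<in> max_pow i"
  show "(if k = j then g else (\<lambda>z. 0)) \<in> max_pow i" for k using g max_pow_zero by auto
  have "z $ k * (if k = j then g else (\<lambda>z. 0)) z = (if k = j then z $ j * g z else 0)" for k z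
    by simp
  then show "\<forall>\<^sub>F z in nhds 0. z $ j * g z = (\<Sum>k\<in>UNIV. z $ k * (if k = j then g else (\<lambda>z. 0)) z)"
    by (simp only: sum.delta finite UNIV_I if_True) simp
qed

lemma max_pow_Suc_subset: "g \<in> max_pow (Suc i) \<Longrightarrow> g \<in> max_pow i"
proof -
  assume "g \<in> max_pow (Suc i)"
  then obtain h where h: "\<And>j. h j \<in> max_pow i" "\<forall>\<^sub>F z in nhds 0. g z = (\<Sum>j\<in>UNIV. z $ j * h j z)"
    using max_pow_SucE by blast
  have "(\<lambda>z. \<Sum>j\<in>UNIV. z $ j * h j z) \<in> max_pow i"
    by (intro max_pow_sum max_pow_mult_holo h) auto
  then show ?thesis by (rule max_pow_cong) (rule h)
qed

lemma max_pow_mono: "i \<le> k \<Longrightarrow> g \<in> max_pow k \<Longrightarrow> g \<in> max_pow i"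
  by (induction k rule: dec_induct) (auto dest: max_pow_Suc_subset simp del: max_pow.simps)

lemma max_pow_mult: "g \<in> max_pow i \<Longrightarrow> h \<in> max_pow k \<Longrightarrow> (\<lambda>z. g z * h z) \<in> max_pow (i + k)"
proof (induction i arbitrary: g)
  case 0
  then show ?case by (simp add: max_pow_mult_holo)
next
  case (Suc i)
  obtain q where q: "\<And>j. q j \<in> max_pow i" "\<forall>\<^sub>F z in nhds 0. g z = (\<Sum>j\<in>UNIV. z $ j * q j z)"
    using max_pow_SucE[OF Suc.prems(1)] by blast
  have "(\<lambda>z. g z * h z) \<in> max_pow (Suc (i + k))"
  proof (rule max_pow_SucI)
    show "(\<lambda>z. q j z * h z) \<in> max_pow (i + k)" for j by (intro Suc.IH Suc.prems q)
    show "\<forall>\<^sub>F z in nhds 0. g z * h z = (\<Sum>j\<in>UNIV. z $ j * (q j z * h z))"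
      using q(2) by eventually_elim (simp add: sum_distrib_left sum_distrib_right mult_ac)
  qed
  then show ?case by simp
qed

text \<open>
  The case of order one is Hadamard's lemma.
\<close>

lemma max_pow_1_iff: "g \<in> max_pow (Suc 0) \<longleftrightarrow> holo_at_0 g \<and> g 0 = 0"
proof
  assume g: "g \<in> max_pow (Suc 0)"
  then obtain h where "\<forall>\<^sub>F z in nhds 0. g z = (\<Sum>j\<in>UNIV. z $ j * h j z)"
    using max_pow_SucE by blast
  then have "g 0 = 0" by (auto dest: eventually_nhds_x_imp_x)
  with g max_pow_holo show "holo_at_0 g \<and> g 0 = 0" by blast
next
  assume g: "holo_at_0 g \<and> g 0 = 0"
  then obtain h where "\<And>j. holo_at_0 (h j)" "\<forall>\<^sub>F z in nhds 0. g z = g 0 + (\<Sum>j\<in>UNIV. z $ j * h j z)"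
    using Hadamard[OF conjunct1[OF g]] by blast
  with g show "g \<in> max_pow (Suc 0)" by (intro max_pow_SucI[of h]) auto
qed

text \<open>
  Along a curve through the origin each coordinate is divisible by \<open>t\<close>, hence a function of the
  \<open>i\<close>-th power of the maximal ideal is divisible by \<open>t ^ i\<close>.
\<close>

lemma max_pow_curve:
  fixes g :: "complex^'n::finite \<Rightarrow> complex"
  assumes "\<And>i. (\<lambda>t. \<phi> t $ i) analytic_on {0}" "\<phi> 0 = 0" "g \<in> max_pow i"
  shows "\<exists>u. u analytic_on {0} \<and> (\<forall>\<^sub>F t in nhds 0. g (\<phi> t) = t ^ i * u t)"
  using assms(3)
proof (induction i arbitrary: g)
  case 0
  then have "(\<lambda>t. g (\<phi> t)) analytic_on {0}" using holo_at_0_curve[OF _ assms(1,2)] by simp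
  then show ?case by (intro exI[of _ "\<lambda>t. g (\<phi> t)"]) simp
next
  case (Suc i)
  obtain h where h: "\<And>j. h j \<in> max_pow i" "\<forall>\<^sub>F z in nhds 0. g z = (\<Sum>j\<in>UNIV. z $ j * h j z)"
    using max_pow_SucE[OF Suc.prems] by blast
  have "\<exists>w. w analytic_on {0} \<and> (\<forall>t. \<phi> t $ j = t * w t)" for j
  proof -
    have "\<phi> 0 $ j = 0" using assms(2) by simp
    from analytic_factor_zero[OF assms(1) this] show ?thesis by blast
  qed
  then obtain w where w: "\<And>j. w j analytic_on {0}" "\<And>j t. \<phi> t $ j = t * w j t" by metis
  obtain u where u: "\<And>j. u j analytic_on {0}" "\<And>j. \<forall>\<^sub>F t in nhds 0. h j (\<phi> t) = t ^ i * u j t"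
    using Suc.IH[OF h(1)] by metis
  have "\<forall>\<^sub>F t in nhds 0. \<forall>j. h j (\<phi> t) = t ^ i * u j t"
    using u(2) by (simp add: eventually_all_finite)
  moreover have "\<forall>\<^sub>F t in nhds 0. g (\<phi> t) = (\<Sum>j\<in>UNIV. \<phi> t $ j * h j (\<phi> t))"
    by (rule eventually_compose_filterlim[OF h(2) tendsto_nhds_curve[OF assms(1,2)]])
  ultimately have "\<forall>\<^sub>F t in nhds 0. g (\<phi> t) = t ^ Suc i * (\<Sum>j\<in>UNIV. w j t * u j t)"
    by eventually_elim (simp add: w(2) sum_distrib_left mult_ac)
  moreover have "(\<lambda>t. \<Sum>j\<in>UNIV. w j t * u j t) analytic_on {0}"
    by (intro analytic_on_sum analytic_on_mult w u)
  ultimately show ?case by blast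
qed

section \<open>Polynomials as functions\<close>

definition monom_fun :: "('n::finite \<Rightarrow>\<^sub>0 nat) \<Rightarrow> complex^'n \<Rightarrow> complex" where
  "monom_fun m z = (\<Prod>i\<in>UNIV. z $ i ^ Poly_Mapping.lookup m i)"

definition mdeg :: "('n::finite \<Rightarrow>\<^sub>0 nat) \<Rightarrow> nat" where
  "mdeg m = (\<Sum>i\<in>UNIV. Poly_Mapping.lookup m i)"

lemma homogeneous_iff: "homogeneous j p \<longleftrightarrow> (\<forall>m\<in>Poly_Mapping.keys p. mdeg m = j)"
  by (simp add: homogeneous_def mdeg_def)

lemma mdeg_add: "mdeg (m + m') = mdeg m + mdeg m'"
  by (simp add: mdeg_def lookup_add sum.distrib)

lemma monom_fun_add: "monom_fun (m + m') z = monom_fun m z * monom_fun m' z"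
  by (simp add: monom_fun_def lookup_add power_add prod.distrib)

lemma monom_fun_0 [simp]: "monom_fun 0 z = 1"
  by (simp add: monom_fun_def)

lemma monom_fun_scale: "monom_fun m (c *s z) = c ^ mdeg m * monom_fun m z"
  by (simp add: monom_fun_def mdeg_def power_mult_distrib prod.distrib power_sum)

lemma mpoly_eval_superset:
  assumes "finite S" "Poly_Mapping.keys p \<subseteq> S"
  shows "mpoly_eval p z = (\<Sum>m\<in>S. Poly_Mapping.lookup p m * monom_fun m z)"
  unfolding mpoly_eval_def monom_fun_def[symmetric]
  using assms by (intro sum.mono_neutral_left) (auto simp: in_keys_iff)

lemma mpoly_eval_eq: "mpoly_eval p z = (\<Sum>m\<in>Poly_Mapping.keys p. Poly_Mapping.lookup p m * monom_fun m z)"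
  by (rule mpoly_eval_superset) auto

lemma mpoly_eval_0 [simp]: "mpoly_eval 0 z = 0"
  by (simp add: mpoly_eval_eq)

lemma mpoly_eval_single [simp]: "mpoly_eval (Poly_Mapping.single m c) z = c * monom_fun m z"
  by (subst mpoly_eval_superset[of "{m}"]) auto

lemma mpoly_eval_1 [simp]: "mpoly_eval 1 z = 1"
  using mpoly_eval_single[of 0 1 z] by simp

lemma mpoly_eval_add [simp]: "mpoly_eval (p + q) z = mpoly_eval p z + mpoly_eval q z"
proof -
  let ?S = "Poly_Mapping.keys p \<union> Poly_Mapping.keys q"
  have "mpoly_eval (p + q) z = (\<Sum>m\<in>?S. Poly_Mapping.lookup (p + q) m * monom_fun m z)"
    by (rule mpoly_eval_superset) (auto simp: Poly_Mapping.keys_add)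
  also have "\<dots> = mpoly_eval p z + mpoly_eval q z"
    by (simp add: mpoly_eval_superset[of ?S p] mpoly_eval_superset[of ?S q] lookup_add
          distrib_right sum.distrib)
  finally show ?thesis .
qed

lemma mpoly_eval_sum: "mpoly_eval (\<Sum>a\<in>A. p a) z = (\<Sum>a\<in>A. mpoly_eval (p a) z)"
  by (induction A rule: infinite_finite_induct) simp_all

lemma mpoly_sum_monomials:
  "p = (\<Sum>m\<in>Poly_Mapping.keys p. Poly_Mapping.single m (Poly_Mapping.lookup p m))"
  by (rule poly_mapping_eqI) (auto simp: lookup_sum lookup_single when_def in_keys_iff)

lemma mpoly_eval_mult [simp]: "mpoly_eval (p * q) z = mpoly_eval p z * mpoly_eval q z"
proof -
  have "p * q = (\<Sum>m\<in>Poly_Mapping.keys p. \<Sum>m'\<in>Poly_Mapping.keys q.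
      Poly_Mapping.single (m + m') (Poly_Mapping.lookup p m * Poly_Mapping.lookup q m'))"
    by (subst mpoly_sum_monomials[of p], subst mpoly_sum_monomials[of q])
       (simp only: sum_product mult_single)
  then show ?thesis
    by (simp add: mpoly_eval_sum monom_fun_add mpoly_eval_eq[of p] mpoly_eval_eq[of q] sum_product mult_ac)
qed

lemma mpoly_eval_uminus [simp]: "mpoly_eval (- p) z = - mpoly_eval p z"
  using mpoly_eval_add[of p "- p" z] by (simp del: mpoly_eval_add add: eq_neg_iff_add_eq_0 add.commute)

lemma mpoly_eval_diff [simp]: "mpoly_eval (p - q) z = mpoly_eval p z - mpoly_eval q z"
  using mpoly_eval_add[of p "- q" z] by (simp del: mpoly_eval_add)

lemma base_expansion_unique:
  fixes a b :: "nat \<Rightarrow> nat"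
  assumes "\<And>k. k < N \<Longrightarrow> a k < B" "\<And>k. k < N \<Longrightarrow> b k < B"
    and "(\<Sum>k<N. a k * B ^ k) = (\<Sum>k<N. b k * B ^ k)" and "k < N"
  shows "a k = b k"
  using assms
proof (induction N arbitrary: a b k)
  case (Suc N)
  have shift: "(\<Sum>k<Suc N. c k * B ^ k) = c 0 + B * (\<Sum>k<N. c (Suc k) * B ^ k)" for c :: "nat \<Rightarrow> nat"
    unfolding sum.lessThan_Suc_shift by (simp add: sum_distrib_left mult_ac)
  have B: "a 0 < B" "b 0 < B" using Suc.prems(1,2) by auto
  have eq: "a 0 + B * (\<Sum>k<N. a (Suc k) * B ^ k) = b 0 + B * (\<Sum>k<N. b (Suc k) * B ^ k)"
    using Suc.prems(3) unfolding shift .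
  from arg_cong[OF eq, of "\<lambda>x. x mod B"] have 0: "a 0 = b 0" using B by simp
  with eq B have "(\<Sum>k<N. a (Suc k) * B ^ k) = (\<Sum>k<N. b (Suc k) * B ^ k)" by simp
  then have "a (Suc k) = b (Suc k)" if "k < N" for k
    using Suc.IH[of "\<lambda>k. a (Suc k)" "\<lambda>k. b (Suc k)" k] Suc.prems(1,2) that by simp
  with 0 Suc.prems(4) show ?case by (cases k) auto
qed simp

text \<open>
  Kronecker substitution: if \<open>B\<close> exceeds all exponents, the powers \<open>z\<^sub>k = t ^ (B ^ k)\<close>
  turn distinct monomials into distinct powers of \<open>t\<close>.
\<close>

lemma mpoly_eval_eq_0_imp:
  fixes p :: "'n::finite mpoly"
  assumes "\<And>z. mpoly_eval p z = 0"
  shows "p = 0"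
proof (rule ccontr)
  assume "p \<noteq> 0"
  then obtain m0 where m0: "m0 \<in> Poly_Mapping.keys p" by (metis Poly_Mapping.keys_eq_empty all_not_in_conv)
  define N where "N = CARD('n)"
  obtain \<iota> :: "nat \<Rightarrow> 'n" where \<iota>: "bij_betw \<iota> {..<N} UNIV"
    unfolding N_def using ex_bij_betw_nat_finite[OF finite_class.finite_UNIV] by (auto simp: atLeast0LessThan)
  define \<kappa>' where "\<kappa>' = the_inv_into {..<N} \<iota>"
  have inv: "\<kappa>' (\<iota> k) = k" if "k < N" for k
    unfolding \<kappa>'_def using \<iota> that by (simp add: the_inv_into_f_f bij_betw_def)
  define B where "B = Suc (Max ((\<lambda>(m,i). Poly_Mapping.lookup m i) ` (Poly_Mapping.keys p \<times> UNIV)))"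
  have B: "Poly_Mapping.lookup m i < B" if "m \<in> Poly_Mapping.keys p" for m i
    unfolding B_def less_Suc_eq_le using that by (intro Max_ge) force+
  define \<kappa> where "\<kappa> m = (\<Sum>i\<in>UNIV. Poly_Mapping.lookup m i * B ^ \<kappa>' i)" for m
  have \<kappa>: "\<kappa> m = (\<Sum>k<N. Poly_Mapping.lookup m (\<iota> k) * B ^ k)" for m
    unfolding \<kappa>_def using sum.reindex_bij_betw[OF \<iota>, of "\<lambda>i. Poly_Mapping.lookup m i * B ^ \<kappa>' i"]
    by (simp add: inv)
  have inj: "inj_on \<kappa> (Poly_Mapping.keys p)"
  proof (rule inj_onI)
    fix m m' assume m: "m \<in> Poly_Mapping.keys p" "m' \<in> Poly_Mapping.keys p" "\<kappa> m = \<kappa> m'"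
    have "Poly_Mapping.lookup m (\<iota> k) = Poly_Mapping.lookup m' (\<iota> k)" if "k < N" for k
      by (rule base_expansion_unique[of N _ B]) (use B m \<kappa> that in auto)
    moreover have "\<exists>k<N. i = \<iota> k" for i using \<iota> unfolding bij_betw_def by (metis UNIV_I imageE lessThan_iff)
    ultimately show "m = m'" by (intro poly_mapping_eqI) metis
  qed
  define Q where "Q = (\<Sum>m\<in>Poly_Mapping.keys p. monom (Poly_Mapping.lookup p m) (\<kappa> m))"
  have "poly Q t = 0" for t
  proof -
    have "monom_fun m (\<chi> i. t ^ (B ^ \<kappa>' i)) = t ^ \<kappa> m" for m :: "'n \<Rightarrow>\<^sub>0 nat"
      by (simp add: monom_fun_def \<kappa>_def power_sum power_mult[symmetric] mult.commute)
    then have "poly Q t = mpoly_eval p (\<chi> i. t ^ (B ^ \<kappa>' i))"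
      by (simp add: Q_def poly_sum poly_monom mpoly_eval_eq)
    with assms show ?thesis by simp
  qed
  then have "Q = 0" by (simp add: poly_all_0_iff_0[symmetric])
  have "coeff Q (\<kappa> m0) = (\<Sum>m\<in>Poly_Mapping.keys p. if m = m0 then Poly_Mapping.lookup p m else 0)"
    unfolding Q_def coeff_sum coeff_monom using inj m0 by (intro sum.cong) (auto simp: inj_on_eq_iff)
  also have "\<dots> = Poly_Mapping.lookup p m0" using m0 by simp
  finally show False using \<open>Q = 0\<close> m0 by (simp add: in_keys_iff)
qed

lemma mpoly_eval_inj:
  assumes "\<And>z. mpoly_eval p z = mpoly_eval q z"
  shows "p = q"
  using mpoly_eval_eq_0_imp[of "p - q"] assms by simp

definition hom_part :: "nat \<Rightarrow> 'n::finite mpoly \<Rightarrow> 'n mpoly" where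
  "hom_part k p = (\<Sum>m | m \<in> Poly_Mapping.keys p \<and> mdeg m = k. Poly_Mapping.single m (Poly_Mapping.lookup p m))"

lemma lookup_hom_part: "Poly_Mapping.lookup (hom_part k p) m = (if mdeg m = k then Poly_Mapping.lookup p m else 0)"
  by (auto simp: hom_part_def lookup_sum lookup_single when_def in_keys_iff)

lemma homogeneous_hom_part: "homogeneous k (hom_part k p)"
  by (auto simp: homogeneous_iff in_keys_iff lookup_hom_part split: if_splits)

lemma sum_hom_parts:
  assumes "\<And>m. m \<in> Poly_Mapping.keys p \<Longrightarrow> mdeg m \<le> D"
  shows "p = (\<Sum>k\<le>D. hom_part k p)"
proof (rule poly_mapping_eqI)
  fix m
  have "Poly_Mapping.lookup (\<Sum>k\<le>D. hom_part k p) m = (\<Sum>k\<le>D. if mdeg m = k then Poly_Mapping.lookup p m else 0)"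
    by (simp add: lookup_sum lookup_hom_part)
  also have "\<dots> = (if mdeg m \<le> D then Poly_Mapping.lookup p m else 0)" by simp
  also have "\<dots> = Poly_Mapping.lookup p m" using assms[of m] by (auto simp: in_keys_iff)
  finally show "Poly_Mapping.lookup p m = Poly_Mapping.lookup (\<Sum>k\<le>D. hom_part k p) m" by simp
qed

lemma homogeneous_0 [simp]: "homogeneous k 0"
  by (simp add: homogeneous_iff)

lemma homogeneous_add: "homogeneous k p \<Longrightarrow> homogeneous k q \<Longrightarrow> homogeneous k (p + q)"
  unfolding homogeneous_iff using Poly_Mapping.keys_add[of p q] by auto

lemma homogeneous_sum: "finite A \<Longrightarrow> (\<And>a. a \<in> A \<Longrightarrow> homogeneous k (p a)) \<Longrightarrow> homogeneous k (\<Sum>a\<in>A. p a)"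
  by (induction A rule: finite_induct) (auto intro: homogeneous_add)

lemma homogeneous_mult: "homogeneous i p \<Longrightarrow> homogeneous k q \<Longrightarrow> homogeneous (i + k) (p * q)"
  unfolding homogeneous_iff using keys_mult[of p q] by (auto simp: mdeg_add)

lemma homogeneous_single: "mdeg m = k \<Longrightarrow> homogeneous k (Poly_Mapping.single m c)"
  by (simp add: homogeneous_iff)

lemma homogeneous_scale: "homogeneous k p \<Longrightarrow> mpoly_eval p (c *s z) = c ^ k * mpoly_eval p z"
  by (auto simp: mpoly_eval_eq homogeneous_iff monom_fun_scale sum_distrib_left mult_ac intro!: sum.cong)

definition mvar :: "'n::finite \<Rightarrow> 'n mpoly" where
  "mvar j = Poly_Mapping.single (Poly_Mapping.single j 1) 1"

lemma mpoly_eval_mvar [simp]: "mpoly_eval (mvar j) z = z $ j"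
proof -
  have "z $ i ^ Poly_Mapping.lookup (Poly_Mapping.single j (1::nat)) i = (if i = j then z $ j else 1)" for i
    by (simp add: lookup_single when_def)
  then show ?thesis by (simp add: mvar_def monom_fun_def)
qed

lemma homogeneous_mvar: "homogeneous 1 (mvar j)"
  unfolding mvar_def by (rule homogeneous_single) (simp add: mdeg_def lookup_single when_def)

lemma homogeneous_const: "homogeneous 0 (Poly_Mapping.single 0 c)"
  by (rule homogeneous_single) (simp add: mdeg_def)

section \<open>The integral domain of polynomial functions\<close>

lemma mpoly_eval_on_line: "\<exists>P. \<forall>t. mpoly_eval p (a + t *s v) = poly P t"
proof (intro exI allI)
  fix t
  show "mpoly_eval p (a + t *s v) = poly (\<Sum>m\<in>Poly_Mapping.keys p.
      smult (Poly_Mapping.lookup p m) (\<Prod>i\<in>UNIV. [:a $ i, v $ i:] ^ Poly_Mapping.lookup m i)) t"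
    by (simp add: mpoly_eval_eq monom_fun_def poly_sum poly_prod)
qed

text \<open>
  Polynomials are studied through the functions they define.  These form an integral domain, as
  two nonzero polynomials stay nonzero on a suitable common line; therefore univariate polynomials over
  them have a multiplicative degree and pseudo-division.
\<close>

typedef ('n::finite) polyfun = "range (mpoly_eval :: 'n mpoly \<Rightarrow> complex^'n \<Rightarrow> complex)"
  morphisms peval Abs_polyfun by blast

setup_lifting type_definition_polyfun

lift_definition of_mpoly :: "'n::finite mpoly \<Rightarrow> 'n polyfun" is mpoly_eval by blast

lemma peval_of_mpoly [simp]: "peval (of_mpoly p) = mpoly_eval p"
  by transfer simp

lemma of_mpoly_surj: "\<exists>p. g = of_mpoly p"
  by transfer auto

lemma polyfun_eqI: "(\<And>a. peval g a = peval h a) \<Longrightarrow> g = h"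
  by (simp add: peval_inject[symmetric] fun_eq_iff)

lemma of_mpoly_eq_iff [simp]: "of_mpoly p = of_mpoly q \<longleftrightarrow> p = q"
  by (metis mpoly_eval_inj peval_of_mpoly)

instantiation polyfun :: (finite) idom
begin

lift_definition zero_polyfun :: "'a polyfun" is "\<lambda>z. 0"
  by (rule range_eqI[of _ _ 0]) auto
lift_definition one_polyfun :: "'a polyfun" is "\<lambda>z. 1"
  by (rule range_eqI[of _ _ 1]) auto
lift_definition plus_polyfun :: "'a polyfun \<Rightarrow> 'a polyfun \<Rightarrow> 'a polyfun" is "\<lambda>g h z. g z + h z"
proof (clarify)
  fix p q :: "'a mpoly"
  show "(\<lambda>z. mpoly_eval p z + mpoly_eval q z) \<in> range mpoly_eval" by (rule range_eqI[of _ _ "p + q"]) auto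
qed
lift_definition minus_polyfun :: "'a polyfun \<Rightarrow> 'a polyfun \<Rightarrow> 'a polyfun" is "\<lambda>g h z. g z - h z"
proof (clarify)
  fix p q :: "'a mpoly"
  show "(\<lambda>z. mpoly_eval p z - mpoly_eval q z) \<in> range mpoly_eval" by (rule range_eqI[of _ _ "p - q"]) auto
qed
lift_definition uminus_polyfun :: "'a polyfun \<Rightarrow> 'a polyfun" is "\<lambda>g z. - g z"
proof (clarify)
  fix p :: "'a mpoly"
  show "(\<lambda>z. - mpoly_eval p z) \<in> range mpoly_eval" by (rule range_eqI[of _ _ "- p"]) auto
qed
lift_definition times_polyfun :: "'a polyfun \<Rightarrow> 'a polyfun \<Rightarrow> 'a polyfun" is "\<lambda>g h z. g z * h z"
proof (clarify)
  fix p q :: "'a mpoly"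
  show "(\<lambda>z. mpoly_eval p z * mpoly_eval q z) \<in> range mpoly_eval" by (rule range_eqI[of _ _ "p * q"]) auto
qed

lemma peval_simps [simp]:
  "peval 0 a = 0" "peval 1 a = 1" "peval (g + h) a = peval g a + peval h a"
  "peval (g - h) a = peval g a - peval h a" "peval (- g) a = - peval g a"
  "peval (g * h) a = peval g a * peval h a"
  by (transfer; simp)+

instance
proof
  fix g h :: "'a polyfun"
  show "(0::'a polyfun) \<noteq> 1"
  proof
    assume "(0::'a polyfun) = 1"
    then have "peval (0::'a polyfun) 0 = peval 1 0" by simp
    then show False by simp
  qed
  assume "g \<noteq> 0" "h \<noteq> 0"
  then obtain a b where a: "peval g a \<noteq> 0" and b: "peval h b \<noteq> 0"
    by (metis polyfun_eqI peval_simps(1))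
  obtain p q where pq: "g = of_mpoly p" "h = of_mpoly q" using of_mpoly_surj by metis
  obtain P Q where P: "\<And>t. mpoly_eval p (a + t *s (b - a)) = poly P t"
    and Q: "\<And>t. mpoly_eval q (a + t *s (b - a)) = poly Q t"
    using mpoly_eval_on_line by metis
  have "poly P 0 \<noteq> 0" "poly Q 1 \<noteq> 0"
    using a b P[of 0, symmetric] Q[of 1, symmetric] pq by auto
  then have "P * Q \<noteq> 0" by auto
  then obtain t where "poly (P * Q) t \<noteq> 0" using poly_all_0_iff_0 by blast
  then have "peval (g * h) (a + t *s (b - a)) \<noteq> 0" using P Q pq by simp
  then show "g * h \<noteq> 0" by (metis peval_simps(1))
qed (rule polyfun_eqI; simp add: algebra_simps)+

end

lemma peval_power [simp]: "peval (g ^ k) a = peval g a ^ k"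
  by (induction k) simp_all

lemma peval_sum: "peval (\<Sum>x\<in>A. g x) a = (\<Sum>x\<in>A. peval (g x) a)"
  by (induction A rule: infinite_finite_induct) simp_all

lemma peval_prod: "peval (\<Prod>x\<in>A. g x) a = (\<Prod>x\<in>A. peval (g x) a)"
  by (induction A rule: infinite_finite_induct) simp_all

lemma of_mpoly_mult: "of_mpoly (p * q) = of_mpoly p * of_mpoly q"
  by (rule polyfun_eqI) simp

lemma of_mpoly_1: "of_mpoly 1 = 1"
  by (rule polyfun_eqI) simp

lemma of_mpoly_0: "of_mpoly 0 = 0"
  by (rule polyfun_eqI) simp

lemma of_mpoly_dvd_iff: "of_mpoly p dvd of_mpoly q \<longleftrightarrow> p dvd q"
proof
  assume "of_mpoly p dvd of_mpoly q"
  then obtain s where "of_mpoly q = of_mpoly p * s" by blast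
  moreover obtain s' where "s = of_mpoly s'" using of_mpoly_surj by blast
  ultimately have "of_mpoly q = of_mpoly (p * s')" by (simp add: of_mpoly_mult)
  then show "p dvd q" by simp
qed (auto simp: of_mpoly_mult)

lemma polyfun_nonzeroE:
  assumes "g \<noteq> 0"
  obtains a where "peval g a \<noteq> 0"
  using assms by (metis polyfun_eqI peval_simps(1))

definition const_pf :: "complex \<Rightarrow> 'n::finite polyfun" where
  "const_pf c = of_mpoly (Poly_Mapping.single 0 c)"

lemma peval_const_pf [simp]: "peval (const_pf c) a = c"
  by (simp add: const_pf_def)

lemma const_pf_unit: "c \<noteq> 0 \<Longrightarrow> const_pf c * const_pf (inverse c) = 1"
  by (rule polyfun_eqI) simp

definition slice :: "complex^'n::finite \<Rightarrow> 'n polyfun poly \<Rightarrow> complex poly" where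
  "slice a W = map_poly (\<lambda>g. peval g a) W"

lemma coeff_slice [simp]: "coeff (slice a W) k = peval (coeff W k) a"
  by (simp add: slice_def coeff_map_poly)

lemma slice_0 [simp]: "slice a 0 = 0" by (rule poly_eqI) simp
lemma slice_1 [simp]: "slice a 1 = 1" by (rule poly_eqI) (simp add: coeff_1)
lemma slice_add [simp]: "slice a (V + W) = slice a V + slice a W" by (rule poly_eqI) simp
lemma slice_smult [simp]: "slice a (smult c W) = smult (peval c a) (slice a W)" by (rule poly_eqI) simp
lemma slice_mult [simp]: "slice a (V * W) = slice a V * slice a W"
  by (rule poly_eqI) (simp add: coeff_mult peval_sum)
lemma slice_pderiv [simp]: "slice a (pderiv W) = pderiv (slice a W)"
proof (rule poly_eqI)
  have "peval (of_nat n) a = of_nat n" for n by (induction n) simp_all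
  then show "coeff (slice a (pderiv W)) n = coeff (pderiv (slice a W)) n" for n
    by (simp add: coeff_pderiv del: of_nat_Suc)
qed

lemma slice_eqI: "(\<And>a. slice a V = slice a W) \<Longrightarrow> V = W"
  by (intro poly_eqI polyfun_eqI) (metis coeff_slice)

lemma degree_slice_le: "degree (slice a W) \<le> degree W"
  by (rule degree_le) (simp add: coeff_eq_0)

lemma degree_slice:
  assumes "peval (lead_coeff W) a \<noteq> 0"
  shows "degree (slice a W) = degree W"
  using assms le_degree[of "slice a W" "degree W"] degree_slice_le[of a W] by simp

lemma poly_slice: "poly (slice a W) (peval g a) = peval (poly W g) a"
proof -
  have "poly (slice a W) (peval g a) = (\<Sum>k\<le>degree W. peval (coeff W k) a * peval g a ^ k)"
    unfolding poly_altdef coeff_slice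
    by (rule sum.mono_neutral_left) (use degree_slice_le[of a W] coeff_eq_0[of "slice a W"] in auto)
  then show ?thesis by (simp add: poly_altdef peval_sum)
qed

section \<open>Polynomials along a direction\<close>

text \<open>\<open>shift e g\<close> is the polynomial \<open>g (z + T e)\<close> in the variable \<open>T\<close>, with
  polynomial functions of \<open>z\<close> as coefficients.\<close>

definition shift :: "complex^'n::finite \<Rightarrow> 'n polyfun \<Rightarrow> 'n polyfun poly" where
  "shift e g = (SOME W. \<forall>a t. poly (slice a W) t = peval g (a + t *s e))"

definition shift_formula :: "complex^'n::finite \<Rightarrow> 'n mpoly \<Rightarrow> 'n polyfun poly" where
  "shift_formula e p = (\<Sum>m\<in>Poly_Mapping.keys p. smult (const_pf (Poly_Mapping.lookup p m))
      (\<Prod>i\<in>UNIV. [:of_mpoly (mvar i), const_pf (e $ i):] ^ Poly_Mapping.lookup m i))"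

lemma poly_slice_shift_formula: "poly (slice a (shift_formula e p)) t = mpoly_eval p (a + t *s e)"
proof -
  have "poly (slice a (shift_formula e p)) (peval (const_pf t) a) = mpoly_eval p (a + t *s e)"
    unfolding poly_slice shift_formula_def
    by (simp add: poly_sum poly_prod peval_sum peval_prod mpoly_eval_eq[of p] monom_fun_def)
  then show ?thesis by simp
qed

lemma poly_slice_shift: "poly (slice a (shift e g)) t = peval g (a + t *s e)"
proof -
  obtain p where "g = of_mpoly p" using of_mpoly_surj by blast
  then have "\<forall>a t. poly (slice a (shift_formula e p)) t = peval g (a + t *s e)"
    by (simp add: poly_slice_shift_formula)
  then have "\<forall>a t. poly (slice a (shift e g)) t = peval g (a + t *s e)"
    unfolding shift_def by (rule someI)
  then show ?thesis by blast
qed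

lemma shift_unique:
  assumes "\<And>a t. poly (slice a W) t = peval g (a + t *s e)"
  shows "W = shift e g"
  by (intro slice_eqI poly_eq_poly_eq_iff[THEN iffD1] ext) (simp add: assms poly_slice_shift)

lemma poly_shift_0: "poly (shift e g) 0 = g"
proof (rule polyfun_eqI)
  show "peval (poly (shift e g) 0) a = peval g a" for a
    using poly_slice[of a "shift e g" 0] poly_slice_shift[of a e g 0] by simp
qed

lemma shift_mult: "shift e (g * h) = shift e g * shift e h"
  by (rule shift_unique[symmetric]) (simp add: poly_slice_shift)

text \<open>
  Every monomial of the product of top degree comes from the top coefficients of all factors.
\<close>

lemma coeff_prod_linear_powers:
  fixes x :: "'i \<Rightarrow> 'a::comm_ring_1"
  assumes "finite A"
  shows "degree (\<Prod>i\<in>A. [:x i, y i:] ^ k i) \<le> (\<Sum>i\<in>A. k i) \<and>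
         coeff (\<Prod>i\<in>A. [:x i, y i:] ^ k i) (\<Sum>i\<in>A. k i) = (\<Prod>i\<in>A. y i ^ k i)"
  using assms
proof (induction A rule: finite_induct)
  case (insert j A)
  have pow: "degree ([:x j, y j:] ^ n) \<le> n \<and> coeff ([:x j, y j:] ^ n) n = y j ^ n" for n
  proof (induction n)
    case (Suc n)
    have "degree ([:x j, y j:] * [:x j, y j:] ^ n) \<le> 1 + n"
      by (rule order_trans[OF degree_mult_le add_mono]) (use Suc in auto)
    with Suc show ?case by (simp add: coeff_eq_0)
  qed simp
  let ?p = "[:x j, y j:] ^ k j" and ?q = "\<Prod>i\<in>A. [:x i, y i:] ^ k i"
  have "degree (?p * ?q) \<le> k j + (\<Sum>i\<in>A. k i)"
    by (rule order_trans[OF degree_mult_le add_mono]) (use pow insert in auto)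
  moreover have "coeff (?p * ?q) (k j + (\<Sum>i\<in>A. k i)) = coeff ?p (k j) * coeff ?q (\<Sum>i\<in>A. k i)"
  proof -
    have "(\<Sum>i\<le>k j + (\<Sum>i\<in>A. k i). coeff ?p i * coeff ?q (k j + (\<Sum>i\<in>A. k i) - i)) =
        (\<Sum>i\<in>{k j}. coeff ?p i * coeff ?q (k j + (\<Sum>i\<in>A. k i) - i))"
    proof (rule sum.mono_neutral_right)
      show "\<forall>i\<in>{..k j + (\<Sum>i\<in>A. k i)} - {k j}. coeff ?p i * coeff ?q (k j + (\<Sum>i\<in>A. k i) - i) = 0"
      proof
        fix i assume i: "i \<in> {..k j + (\<Sum>i\<in>A. k i)} - {k j}"
        show "coeff ?p i * coeff ?q (k j + (\<Sum>i\<in>A. k i) - i) = 0"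
        proof (cases "i < k j")
          case True
          then have "degree ?q < k j + (\<Sum>i\<in>A. k i) - i" using insert.IH by linarith
          then show ?thesis by (simp add: coeff_eq_0)
        next
          case False
          then have "degree ?p < i" using pow[of "k j"] i by auto
          then show ?thesis by (simp add: coeff_eq_0)
        qed
      qed
    qed auto
    then show ?thesis by (simp add: coeff_mult)
  qed
  ultimately show ?case using insert pow[of "k j"] by simp
qed simp

lemma shift_of_mpoly: "shift e (of_mpoly p) = shift_formula e p"
  by (rule shift_unique[symmetric]) (simp add: poly_slice_shift_formula)

text \<open>
  The coefficient of \<open>T ^ D\<close> in \<open>p (z + T e)\<close> is the top homogeneous part of \<open>p\<close> at \<open>e\<close>; in
  particular it does not depend on \<open>z\<close>.
\<close>

lemma shift_top_coeff:
  assumes "\<And>m. m \<in> Poly_Mapping.keys p \<Longrightarrow> mdeg m \<le> D"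
  shows "degree (shift e (of_mpoly p)) \<le> D"
    and "coeff (shift e (of_mpoly p)) D = const_pf (mpoly_eval (hom_part D p) e)"
proof -
  let ?q = "\<lambda>m. \<Prod>i\<in>UNIV. [:of_mpoly (mvar i), const_pf (e $ i):] ^ Poly_Mapping.lookup m i :: 'a polyfun poly"
  have q: "degree (?q m) \<le> mdeg m" "coeff (?q m) (mdeg m) = const_pf (monom_fun m e)" for m
    using coeff_prod_linear_powers[OF finite_class.finite_UNIV,
        of "\<lambda>i. of_mpoly (mvar i)" "\<lambda>i. const_pf (e $ i)" "Poly_Mapping.lookup m"]
    by (auto simp: mdeg_def monom_fun_def peval_prod intro!: polyfun_eqI)
  have "degree (smult (const_pf (Poly_Mapping.lookup p m)) (?q m)) \<le> D" if "m \<in> Poly_Mapping.keys p" for m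
    using order_trans[OF degree_smult_le order_trans[OF q(1) assms[OF that]]] .
  then show "degree (shift e (of_mpoly p)) \<le> D"
    unfolding shift_of_mpoly shift_formula_def by (intro degree_sum_le) auto
  have top: "coeff (?q m) D = (if mdeg m = D then const_pf (monom_fun m e) else 0)"
    if "m \<in> Poly_Mapping.keys p" for m
    using q[of m] assms[OF that] by (auto intro!: coeff_eq_0)
  have "coeff (shift e (of_mpoly p)) D =
      (\<Sum>m\<in>Poly_Mapping.keys p. const_pf (Poly_Mapping.lookup p m) * (if mdeg m = D then const_pf (monom_fun m e) else 0))"
    unfolding shift_of_mpoly shift_formula_def by (simp add: coeff_sum top)
  also have "\<dots> = const_pf (mpoly_eval (hom_part D p) e)"
  proof -
    have "Poly_Mapping.keys (hom_part D p) \<subseteq> Poly_Mapping.keys p"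
      by (auto simp: in_keys_iff lookup_hom_part split: if_splits)
    from mpoly_eval_superset[OF _ this, of e] show ?thesis
      by (intro polyfun_eqI) (auto simp: peval_sum lookup_hom_part intro!: sum.cong)
  qed
  finally show "coeff (shift e (of_mpoly p)) D = const_pf (mpoly_eval (hom_part D p) e)" .
qed

lemma shift_homogeneous:
  assumes "homogeneous d p" "mpoly_eval p e \<noteq> 0"
  shows "degree (shift e (of_mpoly p)) = d" "lead_coeff (shift e (of_mpoly p)) = const_pf (mpoly_eval p e)"
proof -
  have p: "hom_part d p = p"
    using assms(1) by (intro poly_mapping_eqI) (auto simp: lookup_hom_part homogeneous_iff in_keys_iff)
  have le: "degree (shift e (of_mpoly p)) \<le> d"
    and c: "coeff (shift e (of_mpoly p)) d = const_pf (mpoly_eval p e)"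
    using shift_top_coeff[of p d e] assms(1) p by (auto simp: homogeneous_iff)
  have "const_pf (mpoly_eval p e) \<noteq> (0 :: 'a polyfun)"
    using assms(2) by (metis peval_const_pf peval_simps(1))
  then show "degree (shift e (of_mpoly p)) = d" using le le_degree[of "shift e (of_mpoly p)" d] c by simp
  with c show "lead_coeff (shift e (of_mpoly p)) = const_pf (mpoly_eval p e)" by simp
qed

text \<open>
  In a direction where the top homogeneous part does not vanish, \<open>g (z + T e)\<close> is monic in \<open>T\<close> up
  to a constant.  Choosing such a direction plays the role of a linear change of coordinates.
\<close>

lemma generic_direction:
  fixes g :: "'n::finite polyfun"
  assumes "g \<noteq> 0"
  obtains e c where "c \<noteq> 0" "lead_coeff (shift e g) = const_pf c"
proof -
  obtain p where p: "g = of_mpoly p" using of_mpoly_surj by blast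
  with assms have "p \<noteq> 0" by (auto simp: of_mpoly_0)
  then have ne: "Poly_Mapping.keys p \<noteq> {}" by (metis Poly_Mapping.keys_eq_empty)
  define D where "D = Max (mdeg ` Poly_Mapping.keys p)"
  have D: "mdeg m \<le> D" if "m \<in> Poly_Mapping.keys p" for m
    unfolding D_def using that by (intro Max_ge) auto
  have "D \<in> mdeg ` Poly_Mapping.keys p" unfolding D_def using ne by (intro Max_in) auto
  then obtain m where "m \<in> Poly_Mapping.keys p" "mdeg m = D" by auto
  then have "Poly_Mapping.lookup (hom_part D p) m \<noteq> 0" by (simp add: lookup_hom_part in_keys_iff)
  then have "hom_part D p \<noteq> 0" by auto
  then obtain e where e: "mpoly_eval (hom_part D p) e \<noteq> 0" using mpoly_eval_eq_0_imp by blast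
  then have "const_pf (mpoly_eval (hom_part D p) e) \<noteq> (0 :: 'n polyfun)"
    by (metis peval_const_pf peval_simps(1))
  then have "degree (shift e g) = D"
    using shift_top_coeff[of p D e, OF D] le_degree[of "shift e g" D] unfolding p by simp
  with shift_top_coeff(2)[of p D e, OF D] have "lead_coeff (shift e g) = const_pf (mpoly_eval (hom_part D p) e)"
    unfolding p by simp
  with e show thesis by (rule that)
qed

section \<open>Greatest common divisors with parameters\<close>

text \<open>
  A linear factor \<open>T - x\<close> of \<open>v\<close> divides \<open>u\<close>, because the bound forces \<open>u x = 0\<close>; removing it from
  both sides preserves the bound outside a finite set.
\<close>

lemma dvd_if_bounded_univariate:
  fixes u v :: "complex poly" and C :: "complex \<Rightarrow> real"
  assumes "v \<noteq> 0" "finite S" "continuous_on UNIV C"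
    and "\<And>t. t \<notin> S \<Longrightarrow> norm (poly u t) \<le> C t * norm (poly v t)"
  shows "v dvd u"
  using assms(1,2,4)
proof (induction "degree v" arbitrary: u v S)
  case 0
  then obtain c where "v = [:c:]" using degree_eq_zeroE by metis
  with 0 have "u = v * smult (inverse c) u" by simp
  then show ?case by (rule dvdI)
next
  case (Suc n)
  have "degree v > 0" using Suc.hyps(2) by simp
  then obtain x where x: "poly v x = 0"
    using fundamental_theorem_of_algebra[of v] constant_degree[of v] by auto
  have ev: "\<forall>\<^sub>F t in at x. t \<notin> S"
  proof -
    have "open (- (S - {x}))" using Suc.prems(2) by (intro open_Compl finite_imp_closed) simp
    then show ?thesis
      unfolding eventually_at_topological by (intro exI[of _ "- (S - {x})"]) simp
  qed
  then have "\<forall>\<^sub>F t in at x. norm (poly u t) \<le> C t * norm (poly v t)"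
    by eventually_elim (rule Suc.prems(3))
  moreover have "((\<lambda>t. norm (poly u t)) \<longlongrightarrow> norm (poly u x)) (at x)"
    by (intro tendsto_norm) (simp add: poly_isCont[unfolded isCont_def])
  moreover have "isCont C x" using assms(3) by (simp add: continuous_on_eq_continuous_at)
  then have "((\<lambda>t. C t * norm (poly v t)) \<longlongrightarrow> C x * norm (poly v x)) (at x)"
    by (intro tendsto_mult tendsto_norm) (simp_all add: isCont_def poly_isCont[unfolded isCont_def])
  ultimately have "norm (poly u x) \<le> C x * norm (poly v x)"
    by (intro tendsto_le[OF at_neq_bot]) auto
  then have "poly u x = 0" using x by simp
  then obtain u1 where u1: "u = [:- x, 1:] * u1" unfolding poly_eq_0_iff_dvd dvd_def by blast
  obtain v1 where v1: "v = [:- x, 1:] * v1" using x unfolding poly_eq_0_iff_dvd dvd_def by blast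
  have "v1 dvd u1"
  proof (rule Suc.hyps(1))
    show "v1 \<noteq> 0" using v1 Suc.prems(1) by auto
    have "degree v = 1 + degree v1" unfolding v1 using \<open>v1 \<noteq> 0\<close> by (subst degree_mult_eq) auto
    then show "n = degree v1" using Suc.hyps(2) by simp
    show "finite (insert x S)" using Suc.prems(2) by simp
    fix t assume t: "t \<notin> insert x S"
    then have "norm (t - x) * norm (poly u1 t) \<le> norm (t - x) * (C t * norm (poly v1 t))"
      using Suc.prems(3)[of t] unfolding u1 v1 by (simp add: norm_mult[symmetric] algebra_simps)
    then show "norm (poly u1 t) \<le> C t * norm (poly v1 t)" using t by simp
  qed
  then show ?case unfolding u1 v1 by (rule mult_dvd_mono[OF dvd_refl])
qed

lemma unit_lead_division:
  fixes U V :: "'a::idom poly"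
  assumes "lead_coeff V * w = 1"
  obtains Q R where "U = V * Q + R" "R = 0 \<or> degree R < degree V"
proof -
  have V: "V \<noteq> 0" using assms by auto
  obtain q r where qr: "pseudo_divmod U V = (q, r)" by (metis surj_pair)
  define k where "k = Suc (degree U) - degree V"
  from pseudo_divmod[OF V qr]
  have 1: "smult (lead_coeff V ^ k) U = V * q + r" and 2: "r = 0 \<or> degree r < degree V"
    by (auto simp: k_def)
  have "w ^ k * lead_coeff V ^ k = 1" using assms by (metis mult.commute power_mult_distrib power_one)
  then have "U = smult (w ^ k) (smult (lead_coeff V ^ k) U)" by simp
  also have "\<dots> = V * smult (w ^ k) q + smult (w ^ k) r" unfolding 1 by (simp add: smult_add_right)
  finally have "U = V * smult (w ^ k) q + smult (w ^ k) r" .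
  moreover have "smult (w ^ k) r = 0 \<or> degree (smult (w ^ k) r) < degree V"
    using 2 degree_smult_le[of "w ^ k" r] by auto
  ultimately show thesis by (rule that)
qed

lemma poly_dvd_degree_0:
  fixes p r :: "'a::idom poly"
  assumes "p dvd r" "r = 0 \<or> degree r < degree p"
  shows "r = 0"
  using assms dvd_imp_degree_le not_less by blast

text \<open>
  A quotient of polynomials that is locally bounded is a polynomial.  Divide \<open>u (z + T e)\<close> by
  \<open>v (z + T e)\<close>, which is monic up to a constant in a generic direction \<open>e\<close>.  On every line the quotient is
  bounded, so the remainder vanishes there by the univariate case; hence it vanishes.  This replaces
  unique factorisation and Gauss's lemma in several variables.
\<close>

lemma polyfun_dvd_if_bounded:
  fixes u v :: "'n::finite polyfun" and C :: "complex^'n \<Rightarrow> real"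
  assumes "v \<noteq> 0" and C: "continuous_on UNIV C"
    and le: "\<And>a. peval v a \<noteq> 0 \<Longrightarrow> norm (peval u a) \<le> C a * norm (peval v a)"
  shows "v dvd u"
proof -
  obtain e c where c: "c \<noteq> 0" "lead_coeff (shift e v) = const_pf c"
    using generic_direction[OF assms(1)] by blast
  then have "lead_coeff (shift e v) * const_pf (inverse c) = 1" using const_pf_unit by simp
  then obtain Q R where QR: "shift e u = shift e v * Q + R" "R = 0 \<or> degree R < degree (shift e v)"
    by (rule unit_lead_division)
  have "slice a R = slice a 0" for a
  proof -
    have deg: "degree (slice a (shift e v)) = degree (shift e v)" using c by (intro degree_slice) simp
    have "coeff (slice a (shift e v)) (degree (shift e v)) = c" using c by simp
    then have ne: "slice a (shift e v) \<noteq> 0" using c(1) by (metis coeff_0)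
    have "slice a (shift e v) dvd slice a (shift e u)"
    proof (rule dvd_if_bounded_univariate[OF ne])
      show "finite {t. poly (slice a (shift e v)) t = 0}" using ne by (rule poly_roots_finite)
      have "(\<lambda>t. a + t *s e) = (\<lambda>t. \<chi> i. a $ i + t * e $ i)" by (simp add: fun_eq_iff vec_eq_iff)
      then have "continuous_on UNIV (\<lambda>t. a + t *s e)" by (simp only:) (intro continuous_intros)
      then show "continuous_on UNIV (\<lambda>t. C (a + t *s e))"
        by (rule continuous_on_compose2[OF C]) auto
      show "norm (poly (slice a (shift e u)) t) \<le> C (a + t *s e) * norm (poly (slice a (shift e v)) t)"
        if "t \<notin> {t. poly (slice a (shift e v)) t = 0}" for t
        using le[of "a + t *s e"] that by (simp add: poly_slice_shift)
    qed
    then have "slice a (shift e v) dvd slice a R"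
      unfolding QR(1) by (metis dvd_add_right_iff dvd_triv_left slice_add slice_mult)
    moreover have "slice a R = 0 \<or> degree (slice a R) < degree (slice a (shift e v))"
      using QR(2) degree_slice_le[of a R] deg by auto
    ultimately show ?thesis using poly_dvd_degree_0 by auto
  qed
  then have "R = 0" by (rule slice_eqI)
  then have "poly (shift e u) 0 = poly (shift e v) 0 * poly Q 0" using QR by simp
  then show ?thesis unfolding poly_shift_0 by simp
qed

lemma norm_root_le:
  fixes p :: "complex poly"
  assumes "lead_coeff p = 1" "poly p x = 0"
  shows "norm x \<le> 1 + (\<Sum>k<degree p. norm (coeff p k))"
proof (cases "norm x \<le> 1")
  case True
  then show ?thesis by (simp add: add_increasing2 sum_nonneg)
next
  case False
  define d where "d = degree p"
  have "d \<noteq> 0" 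
  proof
    assume "d = 0"
    then obtain c where "p = [:c:]" unfolding d_def by (metis degree_eq_zeroE)
    with assms show False by simp
  qed
  then obtain n where n: "d = Suc n" by (cases d) auto
  have "0 = (\<Sum>k\<le>d. coeff p k * x ^ k)" using assms(2) by (simp add: poly_altdef d_def)
  also have "\<dots> = (\<Sum>k<d. coeff p k * x ^ k) + x ^ d"
    using assms(1) by (simp add: d_def lessThan_Suc_atMost[symmetric])
  finally have "x ^ d = - (\<Sum>k<d. coeff p k * x ^ k)" by (simp add: eq_neg_iff_add_eq_0 add.commute)
  then have "norm x ^ d = norm (\<Sum>k<d. coeff p k * x ^ k)" by (metis norm_minus_cancel norm_power)
  also have "\<dots> \<le> (\<Sum>k<d. norm (coeff p k) * norm x ^ n)"
  proof (rule sum_norm_le)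
    fix k assume "k \<in> {..<d}"
    then have "norm x ^ k \<le> norm x ^ n" using False n by (intro power_increasing) auto
    then show "norm (coeff p k * x ^ k) \<le> norm (coeff p k) * norm x ^ n"
      by (simp add: norm_mult norm_power mult_left_mono)
  qed
  finally have "norm x * norm x ^ n \<le> (\<Sum>k<d. norm (coeff p k)) * norm x ^ n"
    by (simp add: n sum_distrib_right distrib_right)
  moreover have "norm x ^ n > 0" using False by (intro zero_less_power) linarith
  ultimately have "norm x \<le> (\<Sum>k<d. norm (coeff p k))" by (simp add: mult_le_cancel_right)
  then show ?thesis by (simp add: d_def)
qed

text \<open>
  The coefficients are, up to the leading one, elementary symmetric functions of the roots; the proof
  splits off one root at a time.
\<close>

lemma norm_coeff_le:
  fixes p :: "complex poly"
  assumes "\<And>x. poly p x = 0 \<Longrightarrow> norm x \<le> M" "M \<ge> 0" "p \<noteq> 0"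
  shows "norm (coeff p j) \<le> (1 + M) ^ degree p * norm (lead_coeff p)"
  using assms(1,3)
proof (induction "degree p" arbitrary: p j)
  case 0
  then obtain c where "p = [:c:]" using degree_eq_zeroE by metis
  then show ?case by (simp add: coeff_pCons split: nat.split)
next
  case (Suc n)
  have "degree p > 0" using Suc.hyps(2) by simp
  then obtain x where x: "poly p x = 0"
    using fundamental_theorem_of_algebra[of p] constant_degree[of p] by auto
  then obtain q where q: "p = [:- x, 1:] * q" unfolding poly_eq_0_iff_dvd dvd_def by blast
  have "q \<noteq> 0" using q Suc.prems(2) by auto
  have deg: "degree p = Suc (degree q)" unfolding q using \<open>q \<noteq> 0\<close> by (subst degree_mult_eq) auto
  have lead: "lead_coeff p = lead_coeff q" unfolding q lead_coeff_mult by simp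
  define B where "B = (1 + M) ^ n * norm (lead_coeff q)"
  have "n = degree q" using Suc.hyps(2) deg by simp
  then have IH: "norm (coeff q j) \<le> B" for j
    unfolding B_def using Suc.hyps(1)[of q j] \<open>q \<noteq> 0\<close> Suc.prems(1) q by auto
  have B0: "B \<ge> 0" using IH[of 0] norm_ge_zero order_trans by blast
  have "coeff p j = (case j of 0 \<Rightarrow> 0 | Suc i \<Rightarrow> coeff q i) - x * coeff q j"
    unfolding q by (simp add: coeff_pCons split: nat.split)
  then have "norm (coeff p j) \<le> norm (case j of 0 \<Rightarrow> 0 | Suc i \<Rightarrow> coeff q i) + norm x * norm (coeff q j)"
    by (metis norm_mult norm_triangle_ineq4)
  also have "\<dots> \<le> B + M * B"
    using IH B0 Suc.prems(1)[OF x] assms(2) by (intro add_mono mult_mono) (auto split: nat.split)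
  also have "\<dots> = (1 + M) ^ degree p * norm (lead_coeff p)"
    unfolding lead using Suc.hyps(2)[symmetric] by (simp add: B_def algebra_simps)
  finally show ?case .
qed

lemma peval_continuous: "continuous_on UNIV (peval g)"
proof -
  obtain p where "g = of_mpoly p" using of_mpoly_surj by blast
  moreover have "continuous_on UNIV (\<lambda>z. mpoly_eval p z)"
    unfolding mpoly_eval_eq monom_fun_def by (intro continuous_intros)
  ultimately show ?thesis by simp
qed

text \<open>
  The greatest common divisor of \<open>U\<close> and \<open>V\<close> over the field of rational functions has polynomial
  coefficients if \<open>U\<close> is monic.  Take a nonzero \<open>W\<close> of minimal degree in the ideal generated by \<open>U\<close> and
  \<open>V\<close>, with leading coefficient \<open>b\<close>; it divides \<open>U\<close> and \<open>V\<close> up to powers of \<open>b\<close>.  Where \<open>b\<close> does not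
  vanish, all roots of \<open>W\<close> are roots of \<open>U\<close> and thus locally bounded.  So the coefficients of \<open>W / b\<close> are locally
  bounded quotients of polynomials, and \<open>b\<close> divides \<open>W\<close>.
\<close>

lemma generic_gcd:
  fixes U V :: "'n::finite polyfun poly"
  assumes U: "lead_coeff U = 1"
  obtains G c \<alpha> \<beta> where "lead_coeff G = 1" "G dvd U" "G dvd V" "c \<noteq> 0" "smult c G = \<alpha> * U + \<beta> * V"
proof -
  define J where "J W \<longleftrightarrow> W \<noteq> 0 \<and> (\<exists>\<alpha> \<beta>. W = \<alpha> * U + \<beta> * V)" for W
  have "J U" unfolding J_def using U by (metis add.right_neutral leading_coeff_0_iff mult_1 mult_zero_left zero_neq_one)
  then obtain W where W: "J W" and min: "\<And>W'. J W' \<Longrightarrow> degree W \<le> degree W'"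
    using ex_has_least_nat[of J U degree] by blast
  obtain \<alpha> \<beta> where ab: "W = \<alpha> * U + \<beta> * V" and W0: "W \<noteq> 0" using W unfolding J_def by blast
  define b where "b = lead_coeff W"
  have b: "b \<noteq> 0" using W0 by (simp add: b_def)
  have pdiv: "\<exists>k s. smult (b ^ k) Y = W * s" if Y: "Y = c1 * U + c2 * V" for Y c1 c2
  proof -
    obtain q r where qr: "pseudo_divmod Y W = (q, r)" by (metis surj_pair)
    define k where "k = Suc (degree Y) - degree W"
    from pseudo_divmod[OF W0 qr]
    have 1: "smult (b ^ k) Y = W * q + r" and 2: "r = 0 \<or> degree r < degree W"
      by (auto simp: k_def b_def)
    have "r = smult (b ^ k) Y - W * q" using 1 by simp
    also have "\<dots> = (smult (b ^ k) c1 - q * \<alpha>) * U + (smult (b ^ k) c2 - q * \<beta>) * V"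
      unfolding Y ab by (simp add: algebra_simps smult_add_right)
    finally have "r \<noteq> 0 \<Longrightarrow> J r" unfolding J_def by blast
    with 2 min have "r = 0" by force
    with 1 show ?thesis by auto
  qed
  obtain k s where ks: "smult (b ^ k) U = W * s" using pdiv[of U 1 0] by auto
  obtain l s' where ls: "smult (b ^ l) V = W * s'" using pdiv[of V 0 1] by auto
  define M where "M a = 1 + (\<Sum>k<degree U. norm (peval (coeff U k) a))" for a
  have M0: "M a \<ge> 0" for a unfolding M_def by (simp add: sum_nonneg)
  have "b dvd coeff W j" for j
  proof (rule polyfun_dvd_if_bounded[OF b])
    show "continuous_on UNIV (\<lambda>a. (1 + M a) ^ degree W)"
      unfolding M_def by (intro continuous_intros continuous_on_compose2[OF peval_continuous]) auto
    fix a assume a: "peval b a \<noteq> 0"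
    have deg: "degree (slice a W) = degree W" using a unfolding b_def by (rule degree_slice)
    have degU: "degree (slice a U) = degree U" using U by (intro degree_slice) simp
    have ne: "slice a W \<noteq> 0" using a unfolding b_def by (metis coeff_0 coeff_slice)
    have "norm (coeff (slice a W) j) \<le> (1 + M a) ^ degree (slice a W) * norm (lead_coeff (slice a W))"
    proof (rule norm_coeff_le[OF _ M0 ne])
      fix x assume "poly (slice a W) x = 0"
      then have "poly (slice a (smult (b ^ k) U)) x = 0" unfolding ks by simp
      then have "poly (slice a U) x = 0" using a by simp
      then show "norm x \<le> M a"
        using norm_root_le[of "slice a U" x] U degU unfolding M_def by simp
    qed
    then show "norm (peval (coeff W j) a) \<le> (1 + M a) ^ degree W * norm (peval b a)"
      unfolding deg by (simp add: b_def)
  qed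
  then obtain G where G: "W = smult b G"
    using const_poly_dvd_iff[of b W] by (auto elim: dvdE)
  have lG: "lead_coeff G = 1" using b_def b unfolding G by simp
  have dvd: "G dvd Y" if "smult (b ^ m) Y = W * t" for Y m t
  proof -
    obtain Q R where QR: "Y = G * Q + R" "R = 0 \<or> degree R < degree G"
      using unit_lead_division[of G 1 Y] lG by auto
    have "smult (b ^ m) R = G * (smult b t - smult (b ^ m) Q)"
      using that unfolding QR(1) G by (simp add: algebra_simps smult_add_right)
    then have "G dvd smult (b ^ m) R" by (metis dvd_triv_left)
    then have "smult (b ^ m) R = 0" by (rule poly_dvd_degree_0) (use QR(2) b in auto)
    with b QR(1) show ?thesis by simp
  qed
  show thesis using that[OF lG dvd[OF ks] dvd[OF ls] b] ab unfolding G by blast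
qed

section \<open>Smooth points of a reduced cone\<close>

text \<open>
  The leading coefficients of the two factors of \<open>\<phi>\<close> multiply to a constant, hence are units.
\<close>

lemma unit_if_shift_constant:
  fixes \<phi> y :: "'n::finite polyfun"
  assumes "c \<noteq> 0" "lead_coeff (shift e \<phi>) = const_pf c" "y dvd \<phi>" "degree (shift e y) = 0"
  shows "y dvd 1"
proof -
  obtain w where "\<phi> = y * w" using assms(3) by blast
  then have "lead_coeff (shift e y) * lead_coeff (shift e w) = const_pf c"
    using assms(2) by (simp add: shift_mult lead_coeff_mult)
  moreover have "lead_coeff (shift e y) = y"
    using poly_shift_0[of e y] assms(4) by (metis poly_0_coeff_0)
  ultimately have "y * (lead_coeff (shift e w) * const_pf (inverse c)) = 1"
    using const_pf_unit[OF assms(1)] by (metis mult.assoc)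
  then show ?thesis by (metis dvd_triv_left)
qed

text \<open>
  A divisor of \<open>\<phi>\<close> is a unit iff its degree in direction \<open>e\<close> is zero, so a divisor of \<open>y\<close> that is not a
  unit and has the least degree in direction \<open>e\<close> is irreducible.
\<close>

lemma irreducible_divisor:
  fixes \<phi> y :: "'n::finite polyfun"
  assumes c: "c \<noteq> 0" "lead_coeff (shift e \<phi>) = const_pf c" and y: "y dvd \<phi>" "\<not> y dvd 1"
  obtains q where "Factorial_Ring.irreducible q" "q dvd y"
proof -
  have \<phi>0: "\<phi> \<noteq> 0"
  proof
    assume "\<phi> = 0"
    then have "shift e \<phi> = 0" using shift_unique[of 0 0 e] by simp
    with c have "const_pf c = (0 :: 'n polyfun)" by simp
    with c(1) show False by (metis peval_const_pf peval_simps(1))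
  qed
  define P where "P q \<longleftrightarrow> q dvd y \<and> \<not> q dvd 1" for q :: "'n polyfun"
  have "P y" using y by (simp add: P_def)
  then obtain q where q: "P q" and min: "\<And>q'. P q' \<Longrightarrow> degree (shift e q) \<le> degree (shift e q')"
    using ex_has_least_nat[of P y "\<lambda>q. degree (shift e q)"] by blast
  have "q dvd \<phi>" using q y(1) dvd_trans unfolding P_def by blast
  then have q0: "q \<noteq> 0" using \<phi>0 by auto
  have "Factorial_Ring.irreducible q"
  proof (rule Factorial_Ring.irreducibleI[OF q0])
    show "\<not> q dvd 1" using q by (simp add: P_def)
    fix a b assume ab: "q = a * b"
    show "a dvd 1 \<or> b dvd 1"
    proof (rule disjCI)
      assume "\<not> b dvd 1"
      then have "P b" using q ab unfolding P_def by (metis dvd_mult_right)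
      then have "degree (shift e a * shift e b) \<le> degree (shift e b)"
        using min[of b] unfolding ab by (simp add: shift_mult)
      moreover have "shift e a * shift e b \<noteq> 0"
        using q0 poly_shift_0[of e q] unfolding ab shift_mult by auto
      then have "degree (shift e a * shift e b) = degree (shift e a) + degree (shift e b)"
        by (intro degree_mult_eq) auto
      ultimately have "degree (shift e a) = 0" by simp
      moreover have "a dvd \<phi>" using \<open>q dvd \<phi>\<close> unfolding ab by (rule dvd_mult_left)
      ultimately show "a dvd 1" by (intro unit_if_shift_constant[OF c])
    qed
  qed
  then show thesis using that q unfolding P_def by blast
qed

lemma irreducible_of_mpoly:
  assumes "Factorial_Ring.irreducible (of_mpoly q)"
  shows "Factorial_Ring.irreducible q"
proof (rule Factorial_Ring.irreducibleI)
  show "q \<noteq> 0" using assms by (auto simp: of_mpoly_0)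
  show "\<not> q dvd 1" using Factorial_Ring.irreducible_not_unit[OF assms] of_mpoly_dvd_iff[of q 1] by (simp add: of_mpoly_1)
  fix a b assume "q = a * b"
  then have "of_mpoly q = of_mpoly a * of_mpoly b" by (simp add: of_mpoly_mult)
  then have "of_mpoly a dvd 1 \<or> of_mpoly b dvd 1" by (rule Factorial_Ring.irreducibleD[OF assms])
  then show "a dvd 1 \<or> b dvd 1" using of_mpoly_dvd_iff[of a 1] of_mpoly_dvd_iff[of b 1] by (simp add: of_mpoly_1)
qed

text \<open>
  If \<open>F\<close> has no multiple factors and does not divide \<open>h\<close>, some smooth point of \<open>{F = 0}\<close> lies off
  \<open>{h = 0}\<close>.  Fix \<open>e\<close> with \<open>F e \<noteq> 0\<close> and normalise \<open>F (z + T e)\<close> to a monic polynomial \<open>U\<close> in \<open>T\<close>.  Let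
  \<open>G = gcd (U, U')\<close> and \<open>R = U / G\<close>.  The square of \<open>G1 = gcd (G, R)\<close> divides \<open>U\<close>; if \<open>G1\<close> had positive degree,
  its value at \<open>T = 0\<close> would be a nonunit whose square divides \<open>F\<close>.  So \<open>G1 = 1\<close>, and for generic \<open>a\<close> the
  polynomial \<open>F (a + T e)\<close> has only simple roots, \<open>d\<close> in number.  The remainder of \<open>h (z + T e)\<close> modulo \<open>U\<close> is
  nonzero of degree less than \<open>d\<close>, so at generic \<open>a\<close> it cannot vanish at all of them.
\<close>

lemma smooth_point_off_divisor:
  fixes F h :: "'n::finite mpoly"
  assumes F: "homogeneous d F" "d \<ge> 1" "F \<noteq> 0" "no_multiple_factors F" and h: "\<not> F dvd h"
  obtains p e A where "\<And>t. poly A t = mpoly_eval F (p + t *s e)" "poly A 0 = 0"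
    "poly (pderiv A) 0 \<noteq> 0" "mpoly_eval h p \<noteq> 0"
proof -
  obtain e where e: "mpoly_eval F e \<noteq> 0" using mpoly_eval_eq_0_imp F(3) by blast
  define c0 where "c0 = mpoly_eval F e"
  define S where "S = shift e (of_mpoly F)"
  have c0: "c0 \<noteq> 0" using e by (simp add: c0_def)
  have S: "degree S = d" "lead_coeff S = const_pf c0"
    using shift_homogeneous[OF F(1) e] by (auto simp: S_def c0_def)
  define U where "U = smult (const_pf (inverse c0)) S"
  have ne: "const_pf (inverse c0) \<noteq> (0 :: 'n polyfun)"
    using c0 by (metis inverse_nonzero_iff_nonzero peval_const_pf peval_simps(1))
  have U: "degree U = d" "lead_coeff U = 1"
    using S ne const_pf_unit[OF c0] by (auto simp: U_def mult.commute)
  have U0: "U \<noteq> 0" using U(2) by auto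
  have slU: "poly (slice a U) t = inverse c0 * mpoly_eval F (a + t *s e)" for a t
    by (simp add: U_def S_def poly_slice_shift)
  obtain G c1 \<alpha>1 \<beta>1 where G: "lead_coeff G = 1" "G dvd U" "G dvd pderiv U" "c1 \<noteq> 0"
    "smult c1 G = \<alpha>1 * U + \<beta>1 * pderiv U"
    using generic_gcd[OF U(2), of "pderiv U"] by metis
  obtain R where R: "U = G * R" using G(2) by blast
  obtain G1 c2 \<alpha>2 \<beta>2 where G1: "lead_coeff G1 = 1" "G1 dvd G" "G1 dvd R" "c2 \<noteq> 0"
    "smult c2 G1 = \<alpha>2 * G + \<beta>2 * R"
    using generic_gcd[OF G(1), of R] by metis
  have G1_sq: "G1 * G1 dvd U" unfolding R using G1(2,3) by (rule mult_dvd_mono)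
  have "degree G1 = 0"
  proof (rule ccontr)
    assume deg: "degree G1 \<noteq> 0"
    define y where "y = poly G1 0"
    obtain K where "U = G1 * G1 * K" using G1_sq by blast
    then have "poly U 0 = y * y * poly K 0" by (simp add: y_def)
    moreover have "of_mpoly F = const_pf c0 * poly U 0"
      unfolding U_def S_def
      by (simp add: poly_shift_0 mult.assoc[symmetric] const_pf_unit[OF c0])
    ultimately have "of_mpoly F = y * y * (const_pf c0 * poly K 0)" by (simp add: mult_ac)
    then have y2: "y * y dvd of_mpoly F" by (metis dvd_triv_left)
    \<comment> \<open>at \<open>a = 0\<close> the polynomial \<open>U\<close> is \<open>T ^ d\<close>, so its divisor \<open>G1\<close> can only have the root \<open>0\<close>\<close>
    have "degree (slice 0 G1) \<noteq> 0" using deg G1(1) by (subst degree_slice) auto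
    then obtain x where x: "poly (slice 0 G1) x = 0"
      using fundamental_theorem_of_algebra[of "slice 0 G1"] constant_degree[of "slice 0 G1"] by auto
    have "poly (slice 0 U) x = 0" using x \<open>U = G1 * G1 * K\<close> by simp
    then have "x ^ d * c0 = 0"
      using slU[of 0 x] c0 homogeneous_scale[OF F(1), of x e] by (simp add: c0_def)
    then have "x = 0" using c0 by simp
    then have "peval y 0 = 0" using x poly_slice[of 0 G1 0] by (simp add: y_def)
    then have "\<not> y dvd 1" by (metis dvdE mult_zero_left peval_simps(2,6) zero_neq_one)
    then obtain q where q: "Factorial_Ring.irreducible q" "q dvd y"
      using irreducible_divisor[OF c0 S(2)[unfolded S_def], of y] dvd_mult_left[OF y2] by blast
    obtain q' where q': "q = of_mpoly q'" using of_mpoly_surj by blast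
    have "of_mpoly (q' ^ 2) dvd of_mpoly F"
      using dvd_trans[OF mult_dvd_mono[OF q(2) q(2)] y2] by (simp add: power2_eq_square of_mpoly_mult q')
    then have "q' ^ 2 dvd F" by (simp add: of_mpoly_dvd_iff)
    with q(1) F(4) irreducible_of_mpoly show False unfolding no_multiple_factors_def q' by blast
  qed
  then have "G1 = 1" using G1(1) by (metis degree_eq_zeroE lead_coeff_pCons(2) one_pCons)
  obtain Q r where Qr: "shift e (of_mpoly h) = U * Q + r" "r = 0 \<or> degree r < degree U"
    using unit_lead_division[of U 1 "shift e (of_mpoly h)"] U(2) by auto
  have "r \<noteq> 0"
  proof
    assume "r = 0"
    then have "poly (shift e (of_mpoly h)) 0 = poly U 0 * poly Q 0" using Qr(1) by simp
    then have "of_mpoly h = of_mpoly F * (const_pf (inverse c0) * poly Q 0)"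
      unfolding U_def S_def by (simp add: poly_shift_0 mult_ac)
    then have "of_mpoly F dvd of_mpoly h" by (metis dvd_triv_left)
    with h show False by (simp add: of_mpoly_dvd_iff)
  qed
  then have "c1 * c2 * lead_coeff r \<noteq> 0" using G(4) G1(4) by simp
  then obtain a where "peval (c1 * c2 * lead_coeff r) a \<noteq> 0" by (rule polyfun_nonzeroE)
  then have a: "peval c1 a \<noteq> 0" "peval c2 a \<noteq> 0" "peval (lead_coeff r) a \<noteq> 0" by auto
  have degUa: "degree (slice a U) = d" using U by (subst degree_slice) auto
  have Ga0: "coeff (slice a G) (degree G) = 1" using G(1) by simp
  \<comment> \<open>a multiple root is a root of \<open>G\<close>, and as \<open>G\<close> divides \<open>R G'\<close> also one of \<open>R\<close>\<close>
  have sqf: "\<not> (poly (slice a U) x = 0 \<and> poly (pderiv (slice a U)) x = 0)" for x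
  proof
    assume x: "poly (slice a U) x = 0 \<and> poly (pderiv (slice a U)) x = 0"
    have "poly (slice a (smult c1 G)) x = 0" unfolding G(5) using x by simp
    then have Gx: "poly (slice a G) x = 0" using a(1) by simp
    have Gne: "slice a G \<noteq> 0" using Ga0 by (metis coeff_0 zero_neq_one)
    have "G dvd R * pderiv G"
      using G(3) unfolding R pderiv_mult by (metis dvd_add_right_iff dvd_triv_left)
    then have dvd: "slice a G dvd slice a R * pderiv (slice a G)"
      by (metis dvdE dvdI slice_mult slice_pderiv)
    have Rne: "slice a R \<noteq> 0"
    proof
      assume "slice a R = 0"
      then have "slice a U = 0" by (simp add: R)
      with degUa F(2) show False by simp
    qed
    have ord: "Polynomial.order x (slice a G) \<noteq> 0" using Gx Gne by (simp add: order_root)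
    have "pderiv (slice a G) \<noteq> 0"
    proof
      assume "pderiv (slice a G) = 0"
      then have "degree (slice a G) = 0" by (simp add: pderiv_eq_0_iff)
      then obtain k where "slice a G = [:k:]" by (metis degree_eq_zeroE)
      with Gx Gne show False by simp
    qed
    then have "Polynomial.order x (slice a G) = Suc (Polynomial.order x (pderiv (slice a G)))"
      and "slice a R * pderiv (slice a G) \<noteq> 0"
      using ord Rne order_pderiv[OF Gne Gx] by auto
    moreover from this have "Polynomial.order x (slice a G) \<le> Polynomial.order x (slice a R) + Polynomial.order x (pderiv (slice a G))"
      using dvd_imp_order_le[OF _ dvd, of x] by (simp add: order_mult)
    ultimately have "Polynomial.order x (slice a R) \<noteq> 0" by simp
    then have "poly (slice a R) x = 0" using Rne by (simp add: order_root)
    then have "poly (smult (peval c2 a) (slice a G1)) x = 0"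
      unfolding slice_smult[symmetric] G1(5) using Gx by simp
    then show False using a(2) by (simp add: \<open>G1 = 1\<close>)
  qed
  have "rsquarefree (slice a U)" using sqf by (simp add: rsquarefree_roots)
  from complex_poly_decompose_rsquarefree[OF this]
  have "d = degree (smult (lead_coeff (slice a U)) (\<Prod>z | poly (slice a U) z = 0. [:- z, 1:]))"
    using degUa by simp
  also have "\<dots> = degree (\<Prod>z | poly (slice a U) z = 0. [:- z, 1:])"
    using U by (simp add: degUa)
  finally have "card {x. poly (slice a U) x = 0} = d"
    by (simp add: degree_prod_eq_sum_degree)
  moreover have "slice a r \<noteq> 0" using a(3) by (metis coeff_0 coeff_slice)
  then have "card {x. poly (slice a r) x = 0} < d"
    using card_poly_roots_bound[of "slice a r"] degree_slice_le[of a r] Qr(2) \<open>r \<noteq> 0\<close> U(1) by force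
  moreover have "finite {x. poly (slice a r) x = 0}" using \<open>slice a r \<noteq> 0\<close> by (rule poly_roots_finite)
  ultimately have "\<not> {x. poly (slice a U) x = 0} \<subseteq> {x. poly (slice a r) x = 0}"
    using card_mono not_less by blast
  then obtain x where x: "poly (slice a U) x = 0" "poly (slice a r) x \<noteq> 0" by blast
  define A where "A = pcompose (slice a S) [:x, 1:]"
  have "poly A t = mpoly_eval F ((a + x *s e) + t *s e)" for t
    by (simp add: A_def poly_pcompose S_def poly_slice_shift vector_sadd_rdistrib add.assoc)
  moreover have "slice a U = smult (inverse c0) (slice a S)" by (simp add: U_def)
  then have "poly A 0 = 0" "poly (pderiv A) 0 \<noteq> 0"
    using x(1) sqf[of x] c0 by (auto simp: A_def poly_pcompose pderiv_pcompose pderiv_smult pderiv_pCons)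
  moreover have "mpoly_eval h (a + x *s e) = poly (slice a (shift e (of_mpoly h))) x"
    by (simp add: poly_slice_shift)
  then have "mpoly_eval h (a + x *s e) \<noteq> 0" using x unfolding Qr(1) by simp
  ultimately show thesis by (rule that)
qed

section \<open>Vanishing orders and leading forms\<close>

lemma vanishing_order_exact:
  assumes "w analytic_on {0}" "w 0 \<noteq> 0" "\<forall>\<^sub>F t in nhds 0. u t = t ^ i * w t"
  shows "vanishing_order u = enat i"
proof -
  obtain S where S: "open S" "0 \<in> S" "w holomorphic_on S"
    using assms(1) unfolding analytic_at by blast
  obtain T where T: "open T" "0 \<in> T" "\<And>t. t \<in> T \<Longrightarrow> u t = t ^ i * w t"
    using assms(3) unfolding eventually_nhds by blast
  have "zorder u 0 = int i"
    by (rule zorder_eqI[of "S \<inter> T" 0 w])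
       (use S T assms(2) in \<open>auto simp: power_int_of_nat mult.commute intro: holomorphic_on_subset\<close>)
  moreover have "\<not> (\<forall>\<^sub>F t in nhds 0. u t = 0)"
  proof
    assume "\<forall>\<^sub>F t in nhds 0. u t = 0"
    then have "\<forall>\<^sub>F t in at 0. u t = 0" by (simp add: eventually_nhds_conv_at)
    moreover have "\<forall>\<^sub>F t in at 0. w t \<noteq> 0"
      using analytic_at_imp_isCont[OF assms(1)] assms(2)
      unfolding isCont_def by (rule tendsto_imp_eventually_ne)
    moreover have "\<forall>\<^sub>F t in at 0. u t = t ^ i * w t"
      using assms(3) by (simp add: eventually_nhds_conv_at)
    moreover have "\<forall>\<^sub>F t in at 0. t \<noteq> (0::complex)" by (simp add: eventually_at_filter)
    ultimately have "\<forall>\<^sub>F t in at (0::complex). False" by eventually_elim simp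
    then show False by simp
  qed
  ultimately show ?thesis unfolding vanishing_order_def by simp
qed

lemma vanishing_order_ge:
  assumes "w analytic_on {0}" "\<forall>\<^sub>F t in nhds 0. u t = t ^ i * w t"
  shows "enat i \<le> vanishing_order u"
proof (cases "\<forall>\<^sub>F t in nhds 0. w t = 0")
  case True
  with assms(2) have "\<forall>\<^sub>F t in nhds 0. u t = 0" by eventually_elim simp
  then show ?thesis by (simp add: vanishing_order_def)
next
  case False
  obtain r where r: "r > 0" "w holomorphic_on ball 0 r"
    using assms(1) by (auto simp: analytic_on_def)
  have "\<exists>t\<in>ball 0 r. w t \<noteq> 0"
  proof (rule ccontr)
    assume "\<not> ?thesis"
    moreover have "\<forall>\<^sub>F t in nhds 0. t \<in> ball 0 r" using r by (intro eventually_nhds_in_open) auto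
    ultimately have "\<forall>\<^sub>F t in nhds 0. w t = 0" by (auto elim: eventually_mono)
    with False show False by simp
  qed
  moreover have "0 \<in> ball 0 r" using r(1) by simp
  ultimately obtain s where s: "s > 0" "zor_poly w 0 holomorphic_on cball 0 s"
    "\<forall>t\<in>cball 0 s. w t = zor_poly w 0 t * (t - 0) ^ nat (zorder w 0) \<and> zor_poly w 0 t \<noteq> 0"
    using conjunct2[OF zorder_exist_zero[OF r(2) open_ball connected_ball, of 0]] by blast
  have "zor_poly w 0 analytic_on {0}"
    unfolding analytic_at using s(1,2) by (intro exI[of _ "ball 0 s"]) (auto intro: holomorphic_on_subset)
  moreover have "zor_poly w 0 0 \<noteq> 0" using s(3) s(1) by simp
  moreover have "\<forall>\<^sub>F t in nhds 0. t \<in> ball 0 s" using s(1) by (intro eventually_nhds_in_open) auto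
  with assms(2) have "\<forall>\<^sub>F t in nhds 0. u t = t ^ (i + nat (zorder w 0)) * zor_poly w 0 t"
  proof eventually_elim
    case (elim t)
    with s(3) have "w t = zor_poly w 0 t * t ^ nat (zorder w 0)" by simp
    with elim show ?case by (simp add: power_add mult_ac)
  qed
  ultimately have "vanishing_order u = enat (i + nat (zorder w 0))"
    by (rule vanishing_order_exact)
  then show ?thesis by simp
qed

lemma monom_fun_max_pow: "monom_fun m \<in> max_pow (mdeg m)"
proof -
  have power: "(\<lambda>z. z $ i ^ k) \<in> max_pow k" for i :: 'a and k
  proof (induction k)
    case (Suc k)
    then show ?case using max_pow_coord_mult[of "\<lambda>z. z $ i ^ k" k i] by (simp del: max_pow.simps)
  qed simp
  have "(\<lambda>z. \<Prod>i\<in>A. z $ i ^ Poly_Mapping.lookup m i) \<in> max_pow (\<Sum>i\<in>A. Poly_Mapping.lookup m i)"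
    if "finite A" for A
    using that
  proof (induction A rule: finite_induct)
    case (insert i A)
    then show ?case using max_pow_mult[OF power insert.IH, of i] by simp
  qed simp
  then show ?thesis unfolding monom_fun_def[abs_def] mdeg_def by simp
qed

lemma homogeneous_max_pow: "homogeneous i p \<Longrightarrow> mpoly_eval p \<in> max_pow i"
proof -
  assume p: "homogeneous i p"
  have "monom_fun m \<in> max_pow i" if "m \<in> Poly_Mapping.keys p" for m
    using monom_fun_max_pow[of m] p that by (simp add: homogeneous_iff del: max_pow.simps)
  then have "(\<lambda>z. \<Sum>m\<in>Poly_Mapping.keys p. Poly_Mapping.lookup p m * monom_fun m z) \<in> max_pow i"
    by (intro max_pow_sum max_pow_mult_holo) auto
  then show ?thesis unfolding mpoly_eval_eq[abs_def] .
qed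

text \<open>
  Iterated division by the coordinates leaves constant coefficients in degree \<open>i\<close>, as a function
  minus its value at \<open>0\<close> has order one.
\<close>

lemma leading_form:
  fixes g :: "complex^'n::finite \<Rightarrow> complex"
  assumes "g \<in> max_pow i"
  shows "\<exists>p. homogeneous i p \<and> (\<lambda>z. g z - mpoly_eval p z) \<in> max_pow (Suc i)"
  using assms
proof (induction i arbitrary: g)
  case 0
  then have "(\<lambda>z. g z - mpoly_eval (Poly_Mapping.single 0 (g 0)) z) \<in> max_pow (Suc 0)"
    unfolding max_pow_1_iff by (auto intro: holo_at_0_diff)
  then show ?case using homogeneous_const by blast
next
  case (Suc i)
  obtain h where h: "\<And>j. h j \<in> max_pow i" "\<forall>\<^sub>F z in nhds 0. g z = (\<Sum>j\<in>UNIV. z $ j * h j z)"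
    using max_pow_SucE[OF Suc.prems] by blast
  have "\<forall>j. \<exists>p. homogeneous i p \<and> (\<lambda>z. h j z - mpoly_eval p z) \<in> max_pow (Suc i)"
    using Suc.IH[OF h(1)] by blast
  then obtain p where p: "\<And>j. homogeneous i (p j)" "\<And>j. (\<lambda>z. h j z - mpoly_eval (p j) z) \<in> max_pow (Suc i)"
    by metis
  define q where "q = (\<Sum>j\<in>UNIV. mvar j * p j)"
  have "homogeneous (Suc i) (mvar j * p j)" for j
    using homogeneous_mult[OF homogeneous_mvar p(1)] by simp
  then have "homogeneous (Suc i) q" unfolding q_def by (intro homogeneous_sum) auto
  moreover have "(\<lambda>z. g z - mpoly_eval q z) \<in> max_pow (Suc (Suc i))"
  proof (rule max_pow_SucI)
    show "(\<lambda>z. h j z - mpoly_eval (p j) z) \<in> max_pow (Suc i)" for j by (rule p(2))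
    show "\<forall>\<^sub>F z in nhds 0. g z - mpoly_eval q z = (\<Sum>j\<in>UNIV. z $ j * (h j z - mpoly_eval (p j) z))"
      using h(2) by eventually_elim
        (simp add: q_def mpoly_eval_sum right_diff_distrib sum_subtractf)
  qed
  ultimately show ?case by blast
qed

lemma line_analytic: "(\<lambda>t. (t *s z) $ i) analytic_on {0}"
  unfolding vector_smult_component by (intro analytic_intros)

text \<open>
  On each line through \<open>0\<close> the form is \<open>p z * t ^ i\<close>, which is divisible by \<open>t ^ (i + 1)\<close> only if \<open>p z = 0\<close>.
\<close>

lemma homogeneous_max_pow_Suc_imp_0:
  fixes p :: "'n::finite mpoly"
  assumes p: "homogeneous i p" "mpoly_eval p \<in> max_pow (Suc i)"
  shows "p = 0"
proof (rule mpoly_eval_eq_0_imp)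
  fix z :: "complex^'n"
  obtain u where u: "u analytic_on {0}" "\<forall>\<^sub>F t in nhds 0. mpoly_eval p (t *s z) = t ^ Suc i * u t"
    using max_pow_curve[of "\<lambda>t. t *s z", OF line_analytic _ p(2)] by auto
  have "\<forall>\<^sub>F t in at 0. mpoly_eval p (t *s z) = t ^ Suc i * u t"
    using u(2) by (simp add: eventually_nhds_conv_at)
  moreover have "\<forall>\<^sub>F t in at 0. t \<noteq> (0::complex)" by (simp add: eventually_at_filter)
  ultimately have "\<forall>\<^sub>F t in at 0. mpoly_eval p z = t * u t"
    by eventually_elim (simp add: homogeneous_scale[OF p(1)])
  then have "((\<lambda>t. t * u t) \<longlongrightarrow> mpoly_eval p z) (at 0)"
    by (rule tendsto_eventually[OF eventually_mono]) simp
  moreover have "((\<lambda>t. t * u t) \<longlongrightarrow> 0 * u 0) (at 0)"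
    using analytic_at_imp_isCont[OF u(1)] by (intro tendsto_mult) (auto simp: isCont_def)
  ultimately show "mpoly_eval p z = 0" using tendsto_unique[OF at_neq_bot] by fastforce
qed

lemma leading_form_unique:
  assumes "homogeneous i p" "homogeneous i q"
    and "(\<lambda>z. g z - mpoly_eval p z) \<in> max_pow (Suc i)" "(\<lambda>z. g z - mpoly_eval q z) \<in> max_pow (Suc i)"
  shows "p = q"
proof -
  have "mdeg m = i" if "m \<in> Poly_Mapping.keys (p - q)" for m
  proof -
    have "m \<in> Poly_Mapping.keys p \<or> m \<in> Poly_Mapping.keys q"
      using that by (auto simp: in_keys_iff lookup_minus)
    with assms(1,2) show ?thesis unfolding homogeneous_iff by blast
  qed
  then have "homogeneous i (p - q)" unfolding homogeneous_iff by blast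
  moreover have "mpoly_eval (p - q) \<in> max_pow (Suc i)"
    by (rule max_pow_cong[OF max_pow_diff[OF assms(4,3)]]) simp
  ultimately have "p - q = 0" by (rule homogeneous_max_pow_Suc_imp_0)
  then show ?thesis by simp
qed

text \<open>
  The leading form produced by division agrees with the part of degree \<open>k\<close> of the given
  expansion, since on each line through \<open>0\<close> both are the coefficient of \<open>t ^ k\<close> of the same power series.
\<close>

lemma homogeneous_parts_leading_form:
  fixes f :: "complex^'n::finite \<Rightarrow> complex"
  assumes f: "f \<in> max_pow k" and P: "homogeneous_parts f P" "\<And>j. j < k \<Longrightarrow> P j = 0"
  shows "(\<lambda>z. f z - mpoly_eval (P k) z) \<in> max_pow (Suc k)"
proof -
  have homP: "homogeneous j (P j)" for j using P(1) unfolding homogeneous_parts_def by blast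
  obtain q where q: "homogeneous k q" "(\<lambda>z. f z - mpoly_eval q z) \<in> max_pow (Suc k)"
    using leading_form[OF f] by blast
  have "\<forall>\<^sub>F z in nhds 0. (\<lambda>j. mpoly_eval (P j) z) sums f z"
    using P(1) unfolding homogeneous_parts_def by blast
  then obtain r where r: "r > 0" "\<And>z. z \<in> ball 0 r \<Longrightarrow> (\<lambda>j. mpoly_eval (P j) z) sums f z"
    unfolding eventually_nhds_metric by (auto simp: dist_commute)
  have small: "mpoly_eval (P k) z = mpoly_eval q z" if z: "z \<in> ball 0 r" for z
  proof -
    define b where "b j = mpoly_eval (P (j + k)) z" for j
    define T where "T t = suminf (\<lambda>j. b j * t ^ j)" for t
    have "summable (\<lambda>j. mpoly_eval (P j) z)" using r(2)[OF z] sums_summable by blast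
    then have "summable b" unfolding b_def by (rule summable_ignore_initial_segment)
    then have "isCont T 0" unfolding T_def by (intro isCont_powser[of b 1]) auto
    obtain u where u: "u analytic_on {0}"
      "\<forall>\<^sub>F t in nhds 0. f (t *s z) - mpoly_eval q (t *s z) = t ^ Suc k * u t"
      using max_pow_curve[of "\<lambda>t. t *s z", OF line_analytic _ q(2)] by auto
    have "f (t *s z) = t ^ k * T t" if t: "norm t < 1" for t
    proof -
      have "norm t * norm z \<le> norm z" using t mult_left_le_one_le[of "norm z" "norm t"] by simp
      then have "t *s z \<in> ball 0 r" using z by (simp add: norm_scalar_mult)
      then have "(\<lambda>j. mpoly_eval (P j) (t *s z)) sums f (t *s z)" by (rule r(2))
      then have "(\<lambda>j. t ^ j * mpoly_eval (P j) z) sums f (t *s z)"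
        by (simp add: homogeneous_scale[OF homP])
      then have "(\<lambda>j. t ^ (j + k) * mpoly_eval (P (j + k)) z) sums f (t *s z)"
        by (subst sums_iff_shift) (simp add: P(2))
      then have "(\<lambda>j. t ^ k * (b j * t ^ j)) sums f (t *s z)"
        by (simp add: b_def power_add mult_ac)
      moreover have "summable (\<lambda>j. b j * t ^ j)"
        by (rule powser_inside[of b 1]) (use \<open>summable b\<close> t in auto)
      then have "(\<lambda>j. t ^ k * (b j * t ^ j)) sums (t ^ k * T t)"
        unfolding T_def by (intro sums_mult summable_sums)
      ultimately show ?thesis using sums_unique2 by blast
    qed
    moreover have "\<forall>\<^sub>F t in nhds 0. norm (t::complex) < 1"
      using eventually_nhds_in_open[of "ball 0 1" "0::complex"] by simp
    ultimately have "\<forall>\<^sub>F t in nhds 0. f (t *s z) = t ^ k * T t" by (auto elim: eventually_mono)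
    with u(2) have "\<forall>\<^sub>F t in nhds 0. t ^ k * T t - t ^ k * mpoly_eval q z = t ^ Suc k * u t"
      by eventually_elim (simp add: homogeneous_scale[OF q(1)])
    then have "\<forall>\<^sub>F t in at 0. t ^ k * T t - t ^ k * mpoly_eval q z = t ^ Suc k * u t"
      by (simp add: eventually_nhds_conv_at)
    moreover have "\<forall>\<^sub>F t in at 0. t \<noteq> (0::complex)" by (simp add: eventually_at_filter)
    ultimately have "\<forall>\<^sub>F t in at 0. T t - t * u t = mpoly_eval q z"
    proof eventually_elim
      case (elim t)
      then have "t ^ k * (T t - t * u t) = t ^ k * mpoly_eval q z" by (simp add: algebra_simps)
      with elim show ?case by simp
    qed
    then have "((\<lambda>t. T t - t * u t) \<longlongrightarrow> mpoly_eval q z) (at 0)" by (rule tendsto_eventually)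
    moreover have "((\<lambda>t. T t - t * u t) \<longlongrightarrow> T 0 - 0 * u 0) (at 0)"
      using analytic_at_imp_isCont[OF u(1)] \<open>isCont T 0\<close>
      by (intro tendsto_diff tendsto_mult) (auto simp: isCont_def)
    ultimately have "T 0 - 0 * u 0 = mpoly_eval q z" using tendsto_unique[OF at_neq_bot] by blast
    moreover have "T 0 = mpoly_eval (P k) z" by (simp add: T_def b_def)
    ultimately show ?thesis by simp
  qed
  have "P k = q"
  proof (rule mpoly_eval_inj)
    fix z :: "complex^'n"
    define \<sigma> where "\<sigma> = r / (norm z + 1) / 2"
    define s where "s = complex_of_real \<sigma>"
    have pos: "norm z + 1 > 0" by (simp add: add_nonneg_pos)
    then have \<sigma>: "\<sigma> > 0" using r(1) by (simp add: \<sigma>_def)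
    then have "s \<noteq> 0" by (simp add: s_def)
    have "\<sigma> * norm z = r / 2 * (norm z / (norm z + 1))" by (simp add: \<sigma>_def)
    also have "\<dots> \<le> r / 2 * 1" using r(1) pos by (intro mult_left_mono) auto
    finally have "s *s z \<in> ball 0 r" using r(1) \<sigma> by (simp add: norm_scalar_mult s_def)
    from small[OF this] show "mpoly_eval (P k) z = mpoly_eval q z"
      using \<open>s \<noteq> 0\<close> by (simp add: homogeneous_scale[OF homP] homogeneous_scale[OF q(1)])
  qed
  with q(2) show ?thesis by simp
qed

lemma homogeneous_parts_max_pow:
  assumes "holo_at_0 f" "homogeneous_parts f P" "\<And>j. j < d \<Longrightarrow> P j = 0"
  shows "f \<in> max_pow d"
proof -
  have "k \<le> d \<Longrightarrow> f \<in> max_pow k" for k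
  proof (induction k)
    case 0
    with assms show ?case by simp
  next
    case (Suc k)
    then have f: "f \<in> max_pow k" by simp
    have "(\<lambda>z. f z - mpoly_eval (P k) z) \<in> max_pow (Suc k)"
      by (rule homogeneous_parts_leading_form[OF f assms(2)]) (use Suc.prems assms(3) in auto)
    moreover have "P k = 0" using Suc.prems assms(3) by simp
    ultimately show ?case by simp
  qed
  then show ?thesis by simp
qed

section \<open>Arcs through smooth points of the tangent cone\<close>

text \<open>
  The second clause makes substitution of holomorphic functions for both arguments immediate and so
  avoids a theory of functions of two variables: constant and identity arguments recover
  holomorphy in each variable.
\<close>

definition bidisc_holo :: "real \<Rightarrow> (complex \<Rightarrow> complex \<Rightarrow> complex) \<Rightarrow> bool" where
  "bidisc_holo r \<Theta> \<longleftrightarrow>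
     continuous_on (ball 0 r \<times> ball 0 1) (\<lambda>x. \<Theta> (fst x) (snd x)) \<and>
     (\<forall>S a b. open S \<and> a holomorphic_on S \<and> b holomorphic_on S \<and> a ` S \<subseteq> ball 0 r \<and> b ` S \<subseteq> ball 0 1
        \<longrightarrow> (\<lambda>s. \<Theta> (a s) (b s)) holomorphic_on S)"

lemma bidisc_holo_mono: "bidisc_holo r \<Theta> \<Longrightarrow> s \<le> r \<Longrightarrow> bidisc_holo s \<Theta>"
  unfolding bidisc_holo_def
  by (auto intro!: continuous_on_subset[of "ball 0 r \<times> ball 0 1"] dest: subset_trans[OF _ subset_ball])

lemma bidisc_holo_holomorphic:
  "bidisc_holo r \<Theta> \<Longrightarrow> open S \<Longrightarrow> a holomorphic_on S \<Longrightarrow> b holomorphic_on S \<Longrightarrow> a ` S \<subseteq> ball 0 r \<Longrightarrow>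
     b ` S \<subseteq> ball 0 1 \<Longrightarrow> (\<lambda>s. \<Theta> (a s) (b s)) holomorphic_on S"
  unfolding bidisc_holo_def by blast

lemma bidisc_holo_continuous:
  assumes "bidisc_holo r \<Theta>" "continuous_on S a" "continuous_on S b" "a ` S \<subseteq> ball 0 r" "b ` S \<subseteq> ball 0 1"
  shows "continuous_on S (\<lambda>s. \<Theta> (a s) (b s))"
proof -
  have "continuous_on (ball 0 r \<times> ball 0 1) (\<lambda>x. \<Theta> (fst x) (snd x))"
    using assms(1) unfolding bidisc_holo_def by blast
  from continuous_on_compose2[OF this, of S "\<lambda>s. (a s, b s)"] show ?thesis
    using assms(2-5) by (auto intro: continuous_on_Pair)
qed

lemma blowup_in_ball:
  fixes p e :: "complex^'n::finite"
  assumes t: "t \<in> ball 0 (R / (norm p + norm e + 1))" and y: "y \<in> ball 0 1"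
  shows "t *s (p + y *s e) \<in> ball 0 R"
proof -
  have pos: "norm p + norm e + 1 > 0" by (simp add: add_nonneg_pos)
  have "norm y * norm e \<le> norm e" using y by (intro mult_left_le_one_le) auto
  then have "norm (p + y *s e) \<le> norm p + norm e"
    using norm_triangle_ineq[of p "y *s e"] by (simp add: norm_scalar_mult)
  then have "norm t * norm (p + y *s e) \<le> norm t * (norm p + norm e + 1)" by (intro mult_left_mono) auto
  also have "\<dots> < R" using t pos by (simp add: pos_less_divide_eq)
  finally show ?thesis by (simp add: norm_scalar_mult)
qed

text \<open>
  In the chart \<open>z = t (p + y e)\<close> of the blow-up of the origin a function of order \<open>i\<close> is divisible by
  \<open>t ^ i\<close>, with a holomorphic quotient.
\<close>

lemma blowup_expansion:
  fixes g :: "complex^'n::finite \<Rightarrow> complex"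
  assumes "g \<in> max_pow i"
  shows "\<exists>r>0. \<exists>\<Theta>. bidisc_holo r \<Theta> \<and>
    (\<forall>t\<in>ball 0 r. \<forall>y\<in>ball 0 1. g (t *s (p + y *s e)) = t ^ i * \<Theta> t y)"
  using assms
proof (induction i arbitrary: g)
  case 0
  then obtain R where R: "R > 0" "\<And>z. z\<in>ball 0 R \<Longrightarrow> \<exists>d. has_partials g d z"
    unfolding max_pow.simps holo_at_0_iff_has_partials by blast
  define r where "r = R / (norm p + norm e + 1)"
  have pos: "norm p + norm e + 1 > 0" by (simp add: add_nonneg_pos)
  have r: "r > 0" using R(1) pos by (simp add: r_def)
  have in_ball: "t *s (p + y *s e) \<in> ball 0 R" if "t \<in> ball 0 r" "y \<in> ball 0 1" for t y
    using blowup_in_ball that unfolding r_def by blast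
  have contg: "continuous_on (ball 0 R) g"
  proof -
    have "isCont g z" if "z \<in> ball 0 R" for z
      using R(2)[OF that] has_partials_continuous by blast
    then show ?thesis by (simp add: continuous_at_imp_continuous_on)
  qed
  define \<Theta> where "\<Theta> t y = g (t *s (p + y *s e))" for t y
  have "bidisc_holo r \<Theta>"
    unfolding bidisc_holo_def
  proof (intro conjI allI impI)
    have "(\<lambda>x. fst x *s (p + snd x *s e)) = (\<lambda>x. \<chi> i. fst x * (p $ i + snd x * e $ i))"
      by (simp add: fun_eq_iff vec_eq_iff)
    then have "continuous_on (ball 0 r \<times> ball 0 1) (\<lambda>x. fst x *s (p + snd x *s e))"
      by (simp only:) (intro continuous_intros)
    then show "continuous_on (ball 0 r \<times> ball 0 1) (\<lambda>x. \<Theta> (fst x) (snd x))"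
      unfolding \<Theta>_def by (rule continuous_on_compose2[OF contg]) (auto intro!: in_ball simp del: mem_ball)
  next
    fix S a b
    assume S: "open S \<and> a holomorphic_on S \<and> b holomorphic_on S \<and> a ` S \<subseteq> ball 0 r \<and> b ` S \<subseteq> ball 0 1"
    have "\<exists>f'. ((\<lambda>s. \<Theta> (a s) (b s)) has_field_derivative f') (at s)" if s: "s \<in> S" for s
    proof -
      obtain a' b' where ab: "(a has_field_derivative a') (at s)" "(b has_field_derivative b') (at s)"
        using S s by (meson holomorphic_on_open)
      have "a s *s (p + b s *s e) \<in> ball 0 R" using S s by (intro in_ball) auto
      then obtain d where d: "has_partials g d (a s *s (p + b s *s e))" using R(2) by blast
      have "((\<lambda>s. (a s *s (p + b s *s e)) $ i) has_field_derivative
          a' * (p $ i + b s * e $ i) + b' * e $ i * a s) (at s)" for i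
        unfolding vector_smult_component vector_add_component
        by (auto intro!: derivative_eq_intros ab)
      from has_partials_curve[where \<phi> = "\<lambda>s. a s *s (p + b s *s e)", OF d this]
      show ?thesis unfolding \<Theta>_def by blast
    qed
    then show "(\<lambda>s. \<Theta> (a s) (b s)) holomorphic_on S" using S by (simp add: holomorphic_on_open)
  qed
  moreover have "g (t *s (p + y *s e)) = t ^ 0 * \<Theta> t y" for t y by (simp add: \<Theta>_def)
  ultimately show ?case using r by blast
next
  case (Suc i)
  obtain h where h: "\<And>j. h j \<in> max_pow i" "\<forall>\<^sub>F z in nhds 0. g z = (\<Sum>j\<in>UNIV. z $ j * h j z)"
    using max_pow_SucE[OF Suc.prems] by blast
  have "\<forall>j. \<exists>r \<Theta>. r > 0 \<and> bidisc_holo r \<Theta> \<and>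
    (\<forall>t\<in>ball 0 r. \<forall>y\<in>ball 0 1. h j (t *s (p + y *s e)) = t ^ i * \<Theta> t y)"
    using Suc.IH[OF h(1)] by blast
  then obtain R \<Theta> where R: "\<And>j. R j > 0" "\<And>j. bidisc_holo (R j) (\<Theta> j)"
    "\<And>j t y. t\<in>ball 0 (R j) \<Longrightarrow> y\<in>ball 0 1 \<Longrightarrow> h j (t *s (p + y *s e)) = t ^ i * \<Theta> j t y"
    by metis
  obtain s where s: "s > 0" "\<And>z. z \<in> ball 0 s \<Longrightarrow> g z = (\<Sum>j\<in>UNIV. z $ j * h j z)"
    using h(2) unfolding eventually_nhds_metric by (auto simp: dist_commute)
  have pos: "norm p + norm e + 1 > 0" by (simp add: add_nonneg_pos)
  define r where "r = min (Min (range R)) (s / (norm p + norm e + 1))"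
  have r: "r > 0" using R(1) s(1) pos by (simp add: r_def)
  have rR: "r \<le> R j" for j unfolding r_def by (rule min.coboundedI1) simp
  have in_ball: "t *s (p + y *s e) \<in> ball 0 s" if "t \<in> ball 0 r" "y \<in> ball 0 1" for t y
    by (rule blowup_in_ball) (use that in \<open>auto simp: r_def\<close>)
  define \<Theta>' where "\<Theta>' t y = (\<Sum>j\<in>UNIV. (p $ j + y * e $ j) * \<Theta> j t y)" for t y
  have good: "bidisc_holo r (\<Theta> j)" for j using bidisc_holo_mono[OF R(2) rR] .
  have "bidisc_holo r \<Theta>'"
    unfolding bidisc_holo_def \<Theta>'_def
  proof (intro conjI allI impI)
    show "continuous_on (ball 0 r \<times> ball 0 1) (\<lambda>x. \<Sum>j\<in>UNIV. (p $ j + snd x * e $ j) * \<Theta> j (fst x) (snd x))"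
      using good unfolding bidisc_holo_def by (intro continuous_intros) auto
    fix S a b
    assume "open S \<and> a holomorphic_on S \<and> b holomorphic_on S \<and> a ` S \<subseteq> ball 0 r \<and> b ` S \<subseteq> ball 0 1"
    then show "(\<lambda>s. \<Sum>j\<in>UNIV. (p $ j + b s * e $ j) * \<Theta> j (a s) (b s)) holomorphic_on S"
      using good unfolding bidisc_holo_def by (intro holomorphic_intros) auto
  qed
  moreover have "g (t *s (p + y *s e)) = t ^ Suc i * \<Theta>' t y" if t: "t \<in> ball 0 r" and y: "y \<in> ball 0 1" for t y
  proof -
    have "h j (t *s (p + y *s e)) = t ^ i * \<Theta> j t y" for j
      by (rule R(3)) (use t y rR[of j] in auto)
    then show ?thesis using s(2)[OF in_ball[OF t y]]
      by (simp add: \<Theta>'_def sum_distrib_left mult_ac)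
  qed
  ultimately show ?case using r by blast
qed

text \<open>
  The implicit function theorem for \<open>A y + t * \<Theta> t y = 0\<close> at a simple zero of \<open>A\<close>.  With \<open>c = A' 0\<close>, solutions are
  the fixed points of \<open>\<Psi> t y = y - (A y + t * \<Theta> t y) / c\<close>.  For small \<open>t\<close> this is a contraction of a small
  disc: \<open>y - A y / c\<close> has derivative \<open>0\<close> at \<open>0\<close>, and the derivative of \<open>\<Theta> t\<close> is bounded by Cauchy's inequality.
  The iterates starting at \<open>0\<close> are holomorphic in \<open>t\<close> and converge uniformly.
\<close>

lemma implicit_zero_curve:
  fixes A :: "complex poly"
  assumes A: "poly A 0 = 0" "poly (pderiv A) 0 \<noteq> 0" and \<Theta>: "bidisc_holo r \<Theta>" "r > 0"
  obtains y \<tau> where "\<tau> > 0" "\<tau> \<le> r" "y holomorphic_on ball 0 \<tau>" "y 0 = 0"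
    "\<And>t. t \<in> ball 0 \<tau> \<Longrightarrow> y t \<in> ball 0 1 \<and> poly A (y t) + t * \<Theta> t (y t) = 0"
proof -
  define c where "c = poly (pderiv A) 0"
  have c: "c \<noteq> 0" using A(2) by (simp add: c_def)
  define K where "K = [:0, 1:] - smult (inverse c) A"
  have K0: "poly K 0 = 0" using A(1) by (simp add: K_def)
  have "poly (pderiv K) 0 = 0" using c by (simp add: K_def pderiv_diff pderiv_smult pderiv_pCons c_def)
  then have "((\<lambda>y. poly (pderiv K) y) \<longlongrightarrow> 0) (at 0)" using poly_isCont[of 0 "pderiv K"] by (simp add: isCont_def)
  then have "\<forall>\<^sub>F y in at 0. norm (poly (pderiv K) y) < 1/4" by (auto dest: tendstoD[of _ _ _ "1/4"])
  then obtain \<rho>0 where \<rho>0: "\<rho>0 > 0" "\<And>y. y \<noteq> 0 \<Longrightarrow> norm y < \<rho>0 \<Longrightarrow> norm (poly (pderiv K) y) < 1/4"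
    unfolding eventually_at by auto
  define \<rho> where "\<rho> = min (1/2) (\<rho>0 / 2)"
  have \<rho>: "\<rho> > 0" "\<rho> \<le> 1/2" using \<rho>0 by (auto simp: \<rho>_def)
  have K': "norm (poly (pderiv K) y) \<le> 1/4" if "y \<in> cball 0 \<rho>" for y
    using \<rho>0(2)[of y] that \<open>poly (pderiv K) 0 = 0\<close> \<rho>0(1) by (cases "y = 0") (auto simp: \<rho>_def)
  have "continuous_on (cball 0 (r/2) \<times> cball 0 (3/4)) (\<lambda>x. \<Theta> (fst x) (snd x))"
    by (rule bidisc_holo_continuous[OF \<Theta>(1)]) (use \<Theta>(2) in \<open>auto intro!: continuous_on_fst continuous_on_snd continuous_on_id\<close>)
  moreover have "compact (cball (0::complex) (r/2) \<times> cball (0::complex) (3/4))" by (intro compact_Times) auto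
  ultimately have "bounded ((\<lambda>x. \<Theta> (fst x) (snd x)) ` (cball 0 (r/2) \<times> cball 0 (3/4)))"
    by (intro compact_imp_bounded compact_continuous_image)
  then obtain B where B: "B > 0" "\<And>x. x \<in> cball 0 (r/2) \<times> cball 0 (3/4) \<Longrightarrow> norm (\<Theta> (fst x) (snd x)) \<le> B"
    unfolding bounded_pos by auto
  have bound: "norm (\<Theta> t y) \<le> B" if "norm t \<le> r/2" "norm y \<le> 3/4" for t y
    using B(2)[of "(t, y)"] that by simp
  \<comment> \<open>\<open>\<tau> B / |c|\<close> is at most \<open>\<rho> / 16\<close>: small enough for \<open>\<Psi> t\<close> to preserve the disc of radius \<open>\<rho>\<close> and for its derivative to be at most \<open>1/2\<close>\<close>
  define \<tau> where "\<tau> = min (r/2) (\<rho> * norm c / (16 * B))"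
  have \<tau>: "\<tau> > 0" "\<tau> \<le> r/2" "\<tau> * B \<le> \<rho> * norm c / 16"
  proof -
    show "\<tau> > 0" "\<tau> \<le> r/2" using \<Theta>(2) \<rho>(1) B(1) c by (auto simp: \<tau>_def)
    have "\<tau> * B \<le> \<rho> * norm c / (16 * B) * B" using B(1) by (intro mult_right_mono) (auto simp: \<tau>_def)
    then show "\<tau> * B \<le> \<rho> * norm c / 16" using B(1) by simp
  qed
  define \<Psi> where "\<Psi> t y = poly K y - t * \<Theta> t y / c" for t y
  have hol\<Theta>: "\<Theta> t holomorphic_on ball 0 1" if "norm t < r" for t
    using bidisc_holo_holomorphic[OF \<Theta>(1) open_ball[of 0 1] holomorphic_on_const holomorphic_on_ident, of t] that
    by (simp add: image_subset_iff)
  have deriv\<Theta>: "norm (deriv (\<Theta> t) y) \<le> 4 * B" if t: "norm t \<le> r/2" and y: "y \<in> cball 0 \<rho>" for t y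
  proof -
    have "dist 0 x \<le> 3/4" if "x \<in> cball y (1/4)" for x
      using that y \<rho>(2) dist_triangle[of 0 x y] by simp
    then have sub: "cball y (1/4) \<subseteq> cball 0 (3/4)" by auto
    have hol: "\<Theta> t holomorphic_on cball y (1/4)"
      by (rule holomorphic_on_subset[OF hol\<Theta>]) (use t sub \<Theta>(2) in auto)
    have "norm ((deriv ^^ 1) (\<Theta> t) y) \<le> fact 1 * B / (1/4) ^ 1"
    proof (rule Cauchy_inequality)
      show "\<Theta> t holomorphic_on ball y (1/4)" using hol by (rule holomorphic_on_subset) auto
      show "continuous_on (cball y (1/4)) (\<Theta> t)" using hol by (rule holomorphic_on_imp_continuous_on)
      show "norm (\<Theta> t x) \<le> B" if "norm (y - x) = 1/4" for x
        using that sub t by (intro bound) (auto simp: dist_norm subset_iff)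
    qed simp
    then show ?thesis by simp
  qed
  have lip: "norm (\<Psi> t y - \<Psi> t y') \<le> 1/2 * norm (y - y')"
    if t: "t \<in> ball 0 \<tau>" and y: "y \<in> cball 0 \<rho>" "y' \<in> cball 0 \<rho>" for t y y'
  proof (rule field_differentiable_bound[OF convex_cball _ _ y])
    fix x assume x: "x \<in> cball (0::complex) \<rho>"
    have t': "norm t \<le> r/2" "norm t < r" using t \<tau> \<Theta>(2) by auto
    have "x \<in> ball 0 1" using x \<rho>(2) by auto
    then have "(\<Theta> t has_field_derivative deriv (\<Theta> t) x) (at x)"
      using holomorphic_derivI[OF hol\<Theta>[OF t'(2)] open_ball] by blast
    then have "(\<Psi> t has_field_derivative (poly (pderiv K) x - t * deriv (\<Theta> t) x / c)) (at x)"
      unfolding \<Psi>_def[abs_def] using c by (auto intro!: derivative_eq_intros)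
    then show "(\<Psi> t has_field_derivative (poly (pderiv K) x - t * deriv (\<Theta> t) x / c)) (at x within cball 0 \<rho>)"
      by (rule has_field_derivative_at_within)
    have "norm t * norm (deriv (\<Theta> t) x) \<le> \<tau> * (4 * B)"
      using deriv\<Theta>[OF t'(1) x] t \<tau>(1) by (intro mult_mono) auto
    also have "\<dots> \<le> 1/4 * norm c"
    proof -
      have "\<rho> * norm c \<le> 1/2 * norm c" using \<rho>(2) by (intro mult_right_mono) auto
      moreover have "\<tau> * (4 * B) = 4 * (\<tau> * B)" "norm c \<ge> 0" by auto
      ultimately show ?thesis using \<tau>(3) by linarith
    qed
    finally have "norm (t * deriv (\<Theta> t) x / c) \<le> 1/4" using c by (simp add: norm_mult norm_divide divide_le_eq)
    then show "norm (poly (pderiv K) x - t * deriv (\<Theta> t) x / c) \<le> 1/2"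
      using K'[OF x] norm_triangle_ineq4[of "poly (pderiv K) x" "t * deriv (\<Theta> t) x / c"] by linarith
  qed
  have \<Psi>0: "norm (\<Psi> t 0) \<le> \<rho> / 2" if t: "t \<in> ball 0 \<tau>" for t
  proof -
    have "norm t * norm (\<Theta> t 0) \<le> \<tau> * B" using t \<tau> by (intro mult_mono bound) auto
    also have "\<dots> \<le> \<rho> / 2 * norm c"
    proof -
      have "0 \<le> \<rho> * norm c" using \<rho>(1) by simp
      then show ?thesis using \<tau>(3) by linarith
    qed
    finally show ?thesis using c by (simp add: \<Psi>_def K0 norm_mult norm_divide divide_le_eq)
  qed
  have self: "\<Psi> t y \<in> cball 0 \<rho>" if t: "t \<in> ball 0 \<tau>" and y: "y \<in> cball 0 \<rho>" for t y
  proof -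
    have "norm (\<Psi> t y - \<Psi> t 0) \<le> 1/2 * norm (y - 0)" using \<rho>(1) by (intro lip[OF t y]) auto
    then show ?thesis using \<Psi>0[OF t] y norm_triangle_sub[of "\<Psi> t y" "\<Psi> t 0"] by simp
  qed
  define Y where "Y n t = ((\<Psi> t) ^^ n) 0" for n t
  have Y0: "Y 0 t = 0" and YS: "Y (Suc n) t = \<Psi> t (Y n t)" for n t by (auto simp: Y_def)
  have Yin: "Y n t \<in> cball 0 \<rho>" if "t \<in> ball 0 \<tau>" for n t
  proof (induction n)
    case (Suc n)
    then show ?case unfolding YS by (rule self[OF that])
  qed (use \<rho>(1) in \<open>simp add: Y0\<close>)
  have Yhol: "Y n holomorphic_on ball 0 \<tau>" for n
  proof (induction n)
    case (Suc n)
    have "(\<lambda>t. t) ` ball 0 \<tau> \<subseteq> ball 0 r" using \<tau> by auto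
    moreover have "Y n ` ball 0 \<tau> \<subseteq> ball 0 1" using Yin[of _ n] \<rho>(2) by fastforce
    ultimately have "(\<lambda>t. \<Theta> t (Y n t)) holomorphic_on ball 0 \<tau>"
      by (rule bidisc_holo_holomorphic[OF \<Theta>(1) open_ball holomorphic_on_ident Suc])
    then have 1: "(\<lambda>t. t * \<Theta> t (Y n t) / c) holomorphic_on ball 0 \<tau>"
      using c by (intro holomorphic_on_divide holomorphic_on_mult holomorphic_on_ident holomorphic_on_const) auto
    have "poly K holomorphic_on UNIV"
      by (auto simp: holomorphic_on_open intro: poly_DERIV)
    then have "(\<lambda>t. poly K (Y n t)) holomorphic_on ball 0 \<tau>"
      using holomorphic_on_compose_gen[OF Suc, of "poly K" UNIV] by (simp add: o_def)
    from this 1 have "(\<lambda>t. poly K (Y n t) - t * \<Theta> t (Y n t) / c) holomorphic_on ball 0 \<tau>"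
      by (rule holomorphic_on_diff)
    then show ?case by (simp add: YS \<Psi>_def)
  qed (simp add: Y0)
  have step: "norm (Y (Suc n) t - Y n t) \<le> \<rho> * (1/2) ^ n" if t: "t \<in> ball 0 \<tau>" for n t
  proof (induction n)
    case 0
    then show ?case using Yin[OF t, of "Suc 0"] by (simp add: Y0)
  next
    case (Suc n)
    have "norm (\<Psi> t (Y (Suc n) t) - \<Psi> t (Y n t)) \<le> 1/2 * norm (Y (Suc n) t - Y n t)"
      by (rule lip[OF t Yin[OF t] Yin[OF t]])
    with Suc show ?case by (simp add: YS)
  qed
  define y where "y t = suminf (\<lambda>n. Y (Suc n) t - Y n t)" for t
  have "uniform_limit (ball 0 \<tau>) (\<lambda>n t. \<Sum>i<n. Y (Suc i) t - Y i t) y sequentially"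
    unfolding y_def[abs_def]
    by (rule Weierstrass_m_test[where M = "\<lambda>n. \<rho> * (1/2) ^ n"]) (auto intro!: step summable_mult summable_geometric simp del: mem_ball)
  moreover have "(\<Sum>i<n. Y (Suc i) t - Y i t) = Y n t" for n t
    using sum_lessThan_telescope[of "\<lambda>i. Y i t" n] by (simp add: Y0)
  ultimately have lim: "uniform_limit (ball 0 \<tau>) Y y sequentially" by simp
  have "y holomorphic_on ball 0 \<tau>"
  proof (rule holomorphic_uniform_sequence[OF open_ball Yhol])
    fix x :: complex assume "x \<in> ball 0 \<tau>"
    then obtain \<delta> where "\<delta> > 0" "cball x \<delta> \<subseteq> ball 0 \<tau>" using open_contains_cball open_ball by blast
    then show "\<exists>d>0. cball x d \<subseteq> ball 0 \<tau> \<and> uniform_limit (cball x d) Y y sequentially"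
      using uniform_limit_on_subset[OF lim] by blast
  qed
  moreover have "y 0 = 0"
  proof -
    have "Y n 0 = 0" for n by (induction n) (simp_all add: Y0 YS \<Psi>_def K0)
    then show ?thesis by (simp add: y_def)
  qed
  moreover have "y t \<in> ball 0 1 \<and> poly A (y t) + t * \<Theta> t (y t) = 0" if t: "t \<in> ball 0 \<tau>" for t
  proof -
    have lim_t: "(\<lambda>n. Y n t) \<longlonglongrightarrow> y t" using tendsto_uniform_limitI[OF lim t] .
    have yin: "y t \<in> cball 0 \<rho>"
      by (rule closed_sequentially[OF closed_cball _ lim_t]) (rule Yin[OF t])
    have "(\<lambda>n. \<Psi> t (Y n t)) \<longlonglongrightarrow> \<Psi> t (y t)"
    proof (rule metric_tendsto_imp_tendsto[OF lim_t])
      have "dist (\<Psi> t (Y n t)) (\<Psi> t (y t)) \<le> dist (Y n t) (y t)" for n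
        unfolding dist_norm by (rule order_trans[OF lip[OF t Yin[OF t] yin]]) simp
      then show "\<forall>\<^sub>F n in sequentially. dist (\<Psi> t (Y n t)) (\<Psi> t (y t)) \<le> dist (Y n t) (y t)"
        by simp
    qed
    moreover have "(\<lambda>n. \<Psi> t (Y n t)) \<longlonglongrightarrow> y t"
      using LIMSEQ_Suc[OF lim_t] by (simp add: YS)
    ultimately have "\<Psi> t (y t) = y t" using LIMSEQ_unique by blast
    then have "c * (poly A (y t) + t * \<Theta> t (y t)) = 0" using c by (simp add: \<Psi>_def K_def field_simps)
    then have "poly A (y t) + t * \<Theta> t (y t) = 0" using c by simp
    with yin \<rho>(2) show ?thesis by auto
  qed
  ultimately show thesis using that[of \<tau> y] \<tau> \<Theta>(2) by auto
qed

text \<open>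
  On \<open>z = t (p + y e)\<close> the function \<open>f\<close> equals \<open>t ^ d * (F (p + y e) + t * \<Theta> t y)\<close>.  A simple zero of \<open>F\<close> on the
  line through \<open>p\<close> in direction \<open>e\<close> therefore extends to an arc on \<open>{f = 0}\<close> with tangent direction \<open>p\<close>.
\<close>

lemma smooth_arc:
  fixes f :: "complex^'n::finite \<Rightarrow> complex"
  assumes f: "(\<lambda>z. f z - mpoly_eval F z) \<in> max_pow (Suc d)" and F: "homogeneous d F"
    and A: "\<And>t. poly A t = mpoly_eval F (p + t *s e)" "poly A 0 = 0" "poly (pderiv A) 0 \<noteq> 0"
  obtains y where "y analytic_on {0}" "y 0 = 0" "\<forall>\<^sub>F t in nhds 0. f (t *s (p + y t *s e)) = 0"
proof -
  obtain r \<Theta> where r: "r > 0" "bidisc_holo r \<Theta>"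
    "\<And>t y. t \<in> ball 0 r \<Longrightarrow> y \<in> ball 0 1 \<Longrightarrow>
      f (t *s (p + y *s e)) - mpoly_eval F (t *s (p + y *s e)) = t ^ Suc d * \<Theta> t y"
    using blowup_expansion[OF f, of p e] by blast
  obtain y \<tau> where y: "\<tau> > 0" "\<tau> \<le> r" "y holomorphic_on ball 0 \<tau>" "y 0 = 0"
    "\<And>t. t \<in> ball 0 \<tau> \<Longrightarrow> y t \<in> ball 0 1 \<and> poly A (y t) + t * \<Theta> t (y t) = 0"
    using implicit_zero_curve[OF A(2,3) r(2,1)] by metis
  have "f (t *s (p + y t *s e)) = 0" if t: "t \<in> ball 0 \<tau>" for t
  proof -
    have "t \<in> ball 0 r" using t y(2) by auto
    from r(3)[OF this, of "y t"] y(5)[OF t]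
    have "f (t *s (p + y t *s e)) = t ^ d * poly A (y t) + t ^ Suc d * \<Theta> t (y t)"
      by (simp add: homogeneous_scale[OF F] A(1) diff_eq_eq)
    also have "\<dots> = t ^ d * (poly A (y t) + t * \<Theta> t (y t))" by (simp add: algebra_simps)
    finally show ?thesis using y(5)[OF t] by simp
  qed
  moreover have "\<forall>\<^sub>F t in nhds 0. t \<in> ball 0 \<tau>" using y(1) by (intro eventually_nhds_in_open) auto
  ultimately have "\<forall>\<^sub>F t in nhds 0. f (t *s (p + y t *s e)) = 0" by (auto elim: eventually_mono)
  moreover have "y analytic_on {0}" using y(1,3) unfolding analytic_at by (intro exI[of _ "ball 0 \<tau>"]) auto
  ultimately show thesis using that y(4) by blast
qed

section \<open>The local ring of the hypersurface\<close>

lemma FactRing_facts: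
  assumes R: "ring R" and I: "ideal I R"
  shows "carrier (R Quot I) = (\<lambda>x. I +>\<^bsub>R\<^esub> x) ` carrier R"
    and "\<And>x y. x \<in> carrier R \<Longrightarrow> y \<in> carrier R \<Longrightarrow>
      I +>\<^bsub>R\<^esub> (x \<oplus>\<^bsub>R\<^esub> y) = (I +>\<^bsub>R\<^esub> x) \<oplus>\<^bsub>R Quot I\<^esub> (I +>\<^bsub>R\<^esub> y)"
    and "\<And>x y. x \<in> carrier R \<Longrightarrow> y \<in> carrier R \<Longrightarrow>
      I +>\<^bsub>R\<^esub> (x \<otimes>\<^bsub>R\<^esub> y) = (I +>\<^bsub>R\<^esub> x) \<otimes>\<^bsub>R Quot I\<^esub> (I +>\<^bsub>R\<^esub> y)"
    and "I +>\<^bsub>R\<^esub> \<one>\<^bsub>R\<^esub> = \<one>\<^bsub>R Quot I\<^esub>"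
    and "I +>\<^bsub>R\<^esub> \<zero>\<^bsub>R\<^esub> = \<zero>\<^bsub>R Quot I\<^esub>"
    and "\<And>x y. x \<in> carrier R \<Longrightarrow> y \<in> carrier R \<Longrightarrow>
      I +>\<^bsub>R\<^esub> x = I +>\<^bsub>R\<^esub> y \<longleftrightarrow> x \<ominus>\<^bsub>R\<^esub> y \<in> I"
proof -
  interpret ideal I R by (rule I)
  note hom = rcos_ring_hom
  show "carrier (R Quot I) = (\<lambda>x. I +>\<^bsub>R\<^esub> x) ` carrier R"
    unfolding FactRing_def A_RCOSETS_def' by auto
  show "I +>\<^bsub>R\<^esub> (x \<oplus>\<^bsub>R\<^esub> y) = (I +>\<^bsub>R\<^esub> x) \<oplus>\<^bsub>R Quot I\<^esub> (I +>\<^bsub>R\<^esub> y)"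
    if "x \<in> carrier R" "y \<in> carrier R" for x y using ring_hom_add[OF hom that] .
  show "I +>\<^bsub>R\<^esub> (x \<otimes>\<^bsub>R\<^esub> y) = (I +>\<^bsub>R\<^esub> x) \<otimes>\<^bsub>R Quot I\<^esub> (I +>\<^bsub>R\<^esub> y)"
    if "x \<in> carrier R" "y \<in> carrier R" for x y using ring_hom_mult[OF hom that] .
  show "I +>\<^bsub>R\<^esub> \<one>\<^bsub>R\<^esub> = \<one>\<^bsub>R Quot I\<^esub>" using ring_hom_one[OF hom] .
  show "I +>\<^bsub>R\<^esub> \<zero>\<^bsub>R\<^esub> = \<zero>\<^bsub>R Quot I\<^esub>"
    using ring_hom_zero[OF hom R quotient_is_ring] .
  show "I +>\<^bsub>R\<^esub> x = I +>\<^bsub>R\<^esub> y \<longleftrightarrow> x \<ominus>\<^bsub>R\<^esub> y \<in> I"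
    if x: "x \<in> carrier R" and y: "y \<in> carrier R" for x y
    using a_rcos_module_minus[OF R y x] a_rcos_self[OF x] a_repr_independence'[OF _ y, of x] by metis
qed

lemma ring_minus_eqI:
  assumes "ring R" "x \<in> carrier R" "y \<in> carrier R" "z \<in> carrier R" "z \<oplus>\<^bsub>R\<^esub> y = x"
  shows "x \<ominus>\<^bsub>R\<^esub> y = z"
proof -
  interpret ring R by fact
  show ?thesis using assms(2-) by (auto simp: a_minus_def a_assoc r_neg)
qed

lemma holo_fun_ring_simps:
  "carrier holo_fun_ring = {g. holo_at_0 g}"
  "g \<otimes>\<^bsub>holo_fun_ring\<^esub> h = (\<lambda>z. g z * h z)"
  "g \<oplus>\<^bsub>holo_fun_ring\<^esub> h = (\<lambda>z. g z + h z)"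
  "\<one>\<^bsub>holo_fun_ring\<^esub> = (\<lambda>z. 1)" "\<zero>\<^bsub>holo_fun_ring\<^esub> = (\<lambda>z. 0)"
  by (simp_all add: holo_fun_ring_def)

lemma cring_holo_fun_ring: "cring (holo_fun_ring :: (complex^'n::finite \<Rightarrow> complex) ring)"
proof (rule cringI)
  show "abelian_group (holo_fun_ring :: (complex^'n \<Rightarrow> complex) ring)"
  proof (rule abelian_groupI)
    fix g :: "complex^'n \<Rightarrow> complex"
    assume g: "g \<in> carrier holo_fun_ring"
    show "\<exists>h\<in>carrier holo_fun_ring. h \<oplus>\<^bsub>holo_fun_ring\<^esub> g = \<zero>\<^bsub>holo_fun_ring\<^esub>"
      using g holo_at_0_uminus[of g] by (intro bexI[of _ "\<lambda>z. - g z"]) (auto simp: holo_fun_ring_simps)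
  qed (auto simp: holo_fun_ring_simps holo_at_0_add algebra_simps)
  show "comm_monoid (holo_fun_ring :: (complex^'n \<Rightarrow> complex) ring)"
    by (rule comm_monoidI) (auto simp: holo_fun_ring_simps holo_at_0_mult algebra_simps)
qed (auto simp: holo_fun_ring_simps algebra_simps)

lemma holo_fun_ring_minus:
  "holo_at_0 g \<Longrightarrow> holo_at_0 h \<Longrightarrow> g \<ominus>\<^bsub>holo_fun_ring\<^esub> h = (\<lambda>z. g z - h z)"
  by (rule ring_minus_eqI[OF cring.axioms(1)[OF cring_holo_fun_ring]])
     (auto simp: holo_fun_ring_simps holo_at_0_diff)

lemma ideal_null_funs: "ideal null_funs (holo_fun_ring :: (complex^'n::finite \<Rightarrow> complex) ring)"
proof -
  let ?R = "holo_fun_ring :: (complex^'n \<Rightarrow> complex) ring"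
  interpret R: cring ?R by (rule cring_holo_fun_ring)
  have holo: "holo_at_0 g" if "g \<in> null_funs" for g :: "complex^'n \<Rightarrow> complex"
    using holo_at_0_cong[OF holo_at_0_const[of 0], of g] that by (simp add: null_funs_def)
  show ?thesis
  proof (rule idealI[OF R.ring_axioms])
    show "subgroup null_funs (add_monoid ?R)"
    proof
      show "null_funs \<subseteq> carrier (add_monoid ?R)" using holo by (auto simp: holo_fun_ring_simps)
      show "\<one>\<^bsub>add_monoid ?R\<^esub> \<in> null_funs" by (simp add: holo_fun_ring_simps null_funs_def)
      fix g :: "complex^'n \<Rightarrow> complex" assume g: "g \<in> null_funs"
      have "inv\<^bsub>add_monoid ?R\<^esub> g = (\<lambda>z. - g z)"
        unfolding a_inv_def[symmetric]
        by (rule R.minus_equality) (use holo[OF g] holo_at_0_uminus in \<open>auto simp: holo_fun_ring_simps\<close>)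
      then show "inv\<^bsub>add_monoid ?R\<^esub> g \<in> null_funs" using g by (simp add: null_funs_def)
      fix h :: "complex^'n \<Rightarrow> complex" assume h: "h \<in> null_funs"
      from g h have "\<forall>\<^sub>F z in nhds 0. g z + h z = 0"
        unfolding null_funs_def mem_Collect_eq by eventually_elim simp
      then show "g \<otimes>\<^bsub>add_monoid ?R\<^esub> h \<in> null_funs"
        by (simp add: holo_fun_ring_simps null_funs_def)
    qed
  qed (auto simp: holo_fun_ring_simps null_funs_def elim: eventually_mono)
qed

lemma cring_germ_ring: "cring germ_ring"
  unfolding germ_ring_def using ideal.quotient_is_cring[OF ideal_null_funs cring_holo_fun_ring] .

lemma germ_facts:
  "carrier germ_ring = germ ` {g. holo_at_0 g}"
  "\<And>g h. holo_at_0 g \<Longrightarrow> holo_at_0 h \<Longrightarrow> germ (\<lambda>z. g z + h z) = germ g \<oplus>\<^bsub>germ_ring\<^esub> germ h"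
  "\<And>g h. holo_at_0 g \<Longrightarrow> holo_at_0 h \<Longrightarrow> germ (\<lambda>z. g z * h z) = germ g \<otimes>\<^bsub>germ_ring\<^esub> germ h"
  "germ (\<lambda>z. 1) = \<one>\<^bsub>germ_ring\<^esub>" "germ (\<lambda>z. 0) = \<zero>\<^bsub>germ_ring\<^esub>"
  "\<And>g h. holo_at_0 g \<Longrightarrow> holo_at_0 h \<Longrightarrow> germ g = germ h \<longleftrightarrow> (\<forall>\<^sub>F z in nhds 0. g z - h z = 0)"
proof -
  note facts = FactRing_facts[OF cring.axioms(1)[OF cring_holo_fun_ring] ideal_null_funs,
      unfolded holo_fun_ring_simps mem_Collect_eq, folded germ_ring_def germ_def]
  show "carrier germ_ring = germ ` {g. holo_at_0 g}" using facts(1) by simp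
  show "germ (\<lambda>z. g z + h z) = germ g \<oplus>\<^bsub>germ_ring\<^esub> germ h" if "holo_at_0 g" "holo_at_0 h" for g h :: "complex^'b \<Rightarrow> complex"
    using facts(2)[OF that] .
  show "germ (\<lambda>z. g z * h z) = germ g \<otimes>\<^bsub>germ_ring\<^esub> germ h" if "holo_at_0 g" "holo_at_0 h" for g h :: "complex^'c \<Rightarrow> complex"
    using facts(3)[OF that] .
  show "germ (\<lambda>z. 1) = \<one>\<^bsub>germ_ring\<^esub>" "germ (\<lambda>z. 0) = \<zero>\<^bsub>germ_ring\<^esub>" using facts(4,5) by auto
  show "germ g = germ h \<longleftrightarrow> (\<forall>\<^sub>F z in nhds 0. g z - h z = 0)" if "holo_at_0 g" "holo_at_0 h" for g h :: "complex^'f \<Rightarrow> complex"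
    using facts(6)[OF that] holo_fun_ring_minus[OF that] by (simp add: null_funs_def)
qed

lemma germ_in_carrier: "holo_at_0 g \<Longrightarrow> germ g \<in> carrier germ_ring"
  unfolding germ_facts(1) by blast

lemma germ_minus: "holo_at_0 g \<Longrightarrow> holo_at_0 h \<Longrightarrow> germ g \<ominus>\<^bsub>germ_ring\<^esub> germ h = germ (\<lambda>z. g z - h z)"
  by (rule ring_minus_eqI[OF cring.axioms(1)[OF cring_germ_ring]])
     (auto intro!: germ_in_carrier holo_at_0_diff simp: germ_facts(2)[symmetric] holo_at_0_diff)

context
  fixes f :: "complex^'n::finite \<Rightarrow> complex"
  assumes f: "holo_at_0 f"
begin

lemma ideal_germ_principal: "ideal (PIdl\<^bsub>germ_ring\<^esub> (germ f)) germ_ring"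
  by (rule cring.cgenideal_ideal[OF cring_germ_ring germ_in_carrier[OF f]])

lemma cring_local_ring: "cring (local_ring f)"
  unfolding local_ring_def using ideal.quotient_is_cring[OF ideal_germ_principal cring_germ_ring] .

lemma local_ring_carrier: "carrier (local_ring f) = quot_class f ` {g. holo_at_0 g}"
  unfolding local_ring_def quot_class_def
  using FactRing_facts(1)[OF cring.axioms(1)[OF cring_germ_ring] ideal_germ_principal]
  by (simp add: germ_facts(1) image_image)

lemma quot_class_in_carrier: "holo_at_0 g \<Longrightarrow> quot_class f g \<in> carrier (local_ring f)"
  unfolding local_ring_carrier by blast

lemma quot_class_add:
  "holo_at_0 g \<Longrightarrow> holo_at_0 h \<Longrightarrow> quot_class f (\<lambda>z. g z + h z) = quot_class f g \<oplus>\<^bsub>local_ring f\<^esub> quot_class f h"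
  unfolding local_ring_def quot_class_def
  using FactRing_facts(2)[OF cring.axioms(1)[OF cring_germ_ring] ideal_germ_principal germ_in_carrier germ_in_carrier]
  by (simp add: germ_facts(2))

lemma quot_class_mult:
  "holo_at_0 g \<Longrightarrow> holo_at_0 h \<Longrightarrow> quot_class f (\<lambda>z. g z * h z) = quot_class f g \<otimes>\<^bsub>local_ring f\<^esub> quot_class f h"
  unfolding local_ring_def quot_class_def
  using FactRing_facts(3)[OF cring.axioms(1)[OF cring_germ_ring] ideal_germ_principal germ_in_carrier germ_in_carrier]
  by (simp add: germ_facts(3))

lemma quot_class_one: "quot_class f (\<lambda>z. 1) = \<one>\<^bsub>local_ring f\<^esub>"
  unfolding local_ring_def quot_class_def germ_facts(4)
  by (rule FactRing_facts(4)[OF cring.axioms(1)[OF cring_germ_ring] ideal_germ_principal])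

lemma quot_class_zero: "quot_class f (\<lambda>z. 0) = \<zero>\<^bsub>local_ring f\<^esub>"
  unfolding local_ring_def quot_class_def germ_facts(5)
  by (rule FactRing_facts(5)[OF cring.axioms(1)[OF cring_germ_ring] ideal_germ_principal])

lemma quot_class_eq_iff:
  assumes g: "holo_at_0 g" and h: "holo_at_0 h"
  shows "quot_class f g = quot_class f h \<longleftrightarrow> (\<exists>a. holo_at_0 a \<and> (\<forall>\<^sub>F z in nhds 0. g z - h z = a z * f z))"
proof -
  have "quot_class f g = quot_class f h \<longleftrightarrow> germ g \<ominus>\<^bsub>germ_ring\<^esub> germ h \<in> PIdl\<^bsub>germ_ring\<^esub> (germ f)"
    unfolding quot_class_def
    by (rule FactRing_facts(6)[OF cring.axioms(1)[OF cring_germ_ring] ideal_germ_principal germ_in_carrier[OF g] germ_in_carrier[OF h]])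
  also have "\<dots> \<longleftrightarrow> (\<exists>x\<in>carrier germ_ring. germ (\<lambda>z. g z - h z) = x \<otimes>\<^bsub>germ_ring\<^esub> germ f)"
    unfolding germ_minus[OF g h] cgenideal_def by auto
  also have "\<dots> \<longleftrightarrow> (\<exists>a. holo_at_0 a \<and> germ (\<lambda>z. g z - h z) = germ (\<lambda>z. a z * f z))"
    unfolding germ_facts(1) by (auto simp: germ_facts(3) f)
  also have "\<dots> \<longleftrightarrow> (\<exists>a. holo_at_0 a \<and> (\<forall>\<^sub>F z in nhds 0. g z - h z = a z * f z))"
    using germ_facts(6)[OF holo_at_0_diff[OF g h] holo_at_0_mult[OF _ f]] by auto
  finally show ?thesis .
qed

lemma quot_class_uminus: "holo_at_0 g \<Longrightarrow> \<ominus>\<^bsub>local_ring f\<^esub> quot_class f g = quot_class f (\<lambda>z. - g z)"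
proof -
  assume g: "holo_at_0 g"
  interpret cring "local_ring f" by (rule cring_local_ring)
  show ?thesis
    by (rule minus_equality)
       (use g in \<open>simp_all add: quot_class_in_carrier holo_at_0_uminus quot_class_add[symmetric] quot_class_zero\<close>)
qed

lemma quot_class_minus:
  "holo_at_0 g \<Longrightarrow> holo_at_0 h \<Longrightarrow> quot_class f g \<ominus>\<^bsub>local_ring f\<^esub> quot_class f h = quot_class f (\<lambda>z. g z - h z)"
  by (simp add: a_minus_def quot_class_uminus quot_class_add[symmetric] holo_at_0_uminus)

lemma ideal_quot_max_pow: "ideal (quot_class f ` max_pow i) (local_ring f)"
proof -
  interpret R: cring "local_ring f" by (rule cring_local_ring)
  have mult: "x \<otimes>\<^bsub>local_ring f\<^esub> a \<in> quot_class f ` max_pow i"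
    if "a \<in> quot_class f ` max_pow i" "x \<in> carrier (local_ring f)" for a x
  proof -
    obtain g where g: "g \<in> max_pow i" "a = quot_class f g" using \<open>a \<in> _\<close> by blast
    obtain h where h: "holo_at_0 h" "x = quot_class f h" using \<open>x \<in> _\<close> unfolding local_ring_carrier by blast
    have "x \<otimes>\<^bsub>local_ring f\<^esub> a = quot_class f (\<lambda>z. h z * g z)"
      unfolding g h by (rule quot_class_mult[OF h(1) max_pow_holo[OF g(1)], symmetric])
    then show ?thesis using max_pow_mult_holo[OF h(1) g(1)] by blast
  qed
  show ?thesis
  proof (rule idealI[OF R.ring_axioms _ mult])
    show "subgroup (quot_class f ` max_pow i) (add_monoid (local_ring f))"
    proof
      show "quot_class f ` max_pow i \<subseteq> carrier (add_monoid (local_ring f))"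
        using quot_class_in_carrier max_pow_holo by auto
      show "\<one>\<^bsub>add_monoid (local_ring f)\<^esub> \<in> quot_class f ` max_pow i"
        using imageI[OF max_pow_zero, of "quot_class f" i] by (simp add: quot_class_zero)
      fix x assume "x \<in> quot_class f ` max_pow i"
      then obtain g where g: "g \<in> max_pow i" "x = quot_class f g" by blast
      show "inv\<^bsub>add_monoid (local_ring f)\<^esub> x \<in> quot_class f ` max_pow i"
        using quot_class_uminus[OF max_pow_holo[OF g(1)]] max_pow_uminus[OF g(1)]
        unfolding a_inv_def[symmetric] g(2) by blast
      fix y assume "y \<in> quot_class f ` max_pow i"
      then obtain h where h: "h \<in> max_pow i" "y = quot_class f h" by blast
      show "x \<otimes>\<^bsub>add_monoid (local_ring f)\<^esub> y \<in> quot_class f ` max_pow i"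
        using imageI[OF max_pow_add[OF g(1) h(1)], of "quot_class f"]
        by (simp add: g(2) h(2) quot_class_add[OF max_pow_holo[OF g(1)] max_pow_holo[OF h(1)]])
    qed
    show "a \<otimes>\<^bsub>local_ring f\<^esub> x \<in> quot_class f ` max_pow i"
      if "a \<in> quot_class f ` max_pow i" "x \<in> carrier (local_ring f)" for a x
    proof -
      have "a \<in> carrier (local_ring f)" using that(1) quot_class_in_carrier max_pow_holo by auto
      then show ?thesis using mult[OF that] R.m_comm[OF _ that(2)] by simp
    qed
  qed
qed

text \<open>
  One inclusion is multiplicativity of the order, the other is the definition of \<open>max_pow\<close>.
\<close>

lemma quot_max_pow_mult:
  "quot_class f ` max_pow i \<cdot>\<^bsub>local_ring f\<^esub> quot_class f ` max_pow 1 = quot_class f ` max_pow (Suc i)"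
proof
  interpret R: cring "local_ring f" by (rule cring_local_ring)
  show "quot_class f ` max_pow i \<cdot>\<^bsub>local_ring f\<^esub> quot_class f ` max_pow 1 \<subseteq> quot_class f ` max_pow (Suc i)"
  proof
    fix x assume "x \<in> quot_class f ` max_pow i \<cdot>\<^bsub>local_ring f\<^esub> quot_class f ` max_pow 1"
    then show "x \<in> quot_class f ` max_pow (Suc i)"
    proof (induction rule: ideal_prod.induct)
      case (prod a b)
      obtain g where g: "g \<in> max_pow i" "a = quot_class f g" using prod(1) by blast
      obtain h where h: "h \<in> max_pow 1" "b = quot_class f h" using prod(2) by blast
      have "a \<otimes>\<^bsub>local_ring f\<^esub> b = quot_class f (\<lambda>z. g z * h z)"
        unfolding g h by (rule quot_class_mult[OF max_pow_holo[OF g(1)] max_pow_holo[OF h(1)], symmetric])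
      moreover have "(\<lambda>z. g z * h z) \<in> max_pow (Suc i)" using max_pow_mult[OF g(1) h(1)] by simp
      ultimately show ?case by blast
    next
      case (sum a b)
      show ?case
        by (rule additive_subgroup.a_closed[OF ideal.axioms(1)[OF ideal_quot_max_pow] sum.IH])
    qed
  qed
  show "quot_class f ` max_pow (Suc i) \<subseteq> quot_class f ` max_pow i \<cdot>\<^bsub>local_ring f\<^esub> quot_class f ` max_pow 1"
  proof
    fix x assume "x \<in> quot_class f ` max_pow (Suc i)"
    then obtain g where g: "g \<in> max_pow (Suc i)" "x = quot_class f g" by blast
    obtain h where h: "\<And>j. h j \<in> max_pow i" "\<forall>\<^sub>F z in nhds 0. g z = (\<Sum>j\<in>UNIV. z $ j * h j z)"
      using max_pow_SucE[OF g(1)] by blast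
    let ?P = "quot_class f ` max_pow i \<cdot>\<^bsub>local_ring f\<^esub> quot_class f ` max_pow 1"
    have P: "ideal ?P (local_ring f)"
      by (intro R.ideal_prod_is_ideal ideal_quot_max_pow)
    have summand: "quot_class f (\<lambda>z. h j z * z $ j) \<in> ?P" for j
    proof -
      have "(\<lambda>z. z $ j) \<in> max_pow 1" by (simp add: max_pow_1_iff del: max_pow.simps)
      then have "quot_class f (\<lambda>z. z $ j) \<in> quot_class f ` max_pow 1" by (rule imageI)
      from ideal_prod.prod[OF imageI[OF h(1)] this] show ?thesis
        unfolding quot_class_mult[OF max_pow_holo[OF h(1)] holo_at_0_coord] .
    qed
    have hol: "holo_at_0 (\<lambda>z. h j z * z $ j)" for j
      by (intro holo_at_0_mult max_pow_holo[OF h(1)] holo_at_0_coord)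
    have "quot_class f (\<lambda>z. \<Sum>j\<in>A. h j z * z $ j) \<in> ?P" if "finite A" for A
      using that
    proof (induction A rule: finite_induct)
      case empty
      then show ?case
        using additive_subgroup.zero_closed[OF ideal.axioms(1)[OF P]] by (simp add: quot_class_zero)
    next
      case (insert j A)
      have "quot_class f (\<lambda>z. \<Sum>j\<in>insert j A. h j z * z $ j) =
          quot_class f (\<lambda>z. h j z * z $ j) \<oplus>\<^bsub>local_ring f\<^esub> quot_class f (\<lambda>z. \<Sum>j\<in>A. h j z * z $ j)"
        using insert.hyps hol by (simp add: quot_class_add holo_at_0_sum)
      then show ?case
        using additive_subgroup.a_closed[OF ideal.axioms(1)[OF P] summand insert.IH] by simp
    qed
    then have "quot_class f (\<lambda>z. \<Sum>j\<in>UNIV. h j z * z $ j) \<in> ?P" by simp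
    moreover have "quot_class f g = quot_class f (\<lambda>z. \<Sum>j\<in>UNIV. h j z * z $ j)"
    proof -
      have ev: "\<forall>\<^sub>F z in nhds 0. g z - (\<Sum>j\<in>UNIV. h j z * z $ j) = 0 * f z"
        using h(2) by eventually_elim (simp add: mult.commute)
      have hs: "holo_at_0 (\<lambda>z. \<Sum>j\<in>UNIV. h j z * z $ j)" using hol by (intro holo_at_0_sum) auto
      show ?thesis
        unfolding quot_class_eq_iff[OF max_pow_holo[OF g(1)] hs]
        by (intro exI[of _ "\<lambda>z. 0"] conjI holo_at_0_const ev)
    qed
    ultimately show "x \<in> ?P" unfolding g(2) by simp
  qed
qed

lemma quot_max_pow_power:
  "quot_class f ` max_pow 1 [^]\<^bsub>ideals_set (local_ring f)\<^esub> (i::nat) = quot_class f ` max_pow i"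
proof (induction i)
  case 0
  then show ?case by (simp add: nat_pow_def ideals_set_def local_ring_carrier)
next
  case (Suc i)
  have "quot_class f ` max_pow 1 [^]\<^bsub>ideals_set (local_ring f)\<^esub> (Suc i) =
     (quot_class f ` max_pow 1 [^]\<^bsub>ideals_set (local_ring f)\<^esub> i) \<otimes>\<^bsub>ideals_set (local_ring f)\<^esub> quot_class f ` max_pow 1"
    by (simp add: nat_pow_def)
  also have "\<dots> = quot_class f ` max_pow i \<cdot>\<^bsub>local_ring f\<^esub> quot_class f ` max_pow 1"
    unfolding Suc by (simp add: ideals_set_def)
  finally show ?case unfolding quot_max_pow_mult .
qed

text \<open>
  A function that does not vanish at \<open>0\<close> is invertible, so every proper ideal consists of classes of
  functions vanishing at \<open>0\<close>.
\<close>

lemma max_ideal_eq: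
  assumes f0: "f 0 = 0"
  shows "max_ideal f = quot_class f ` max_pow 1"
proof -
  interpret R: cring "local_ring f" by (rule cring_local_ring)
  let ?M = "quot_class f ` max_pow 1"
  have one: "\<one>\<^bsub>local_ring f\<^esub> \<notin> ?M"
  proof
    assume "\<one>\<^bsub>local_ring f\<^esub> \<in> ?M"
    then obtain g where g: "g \<in> max_pow 1" "quot_class f (\<lambda>z. 1) = quot_class f g"
      unfolding quot_class_one by blast
    then have "holo_at_0 g" "g 0 = 0" by (simp_all add: max_pow_1_iff del: max_pow.simps)
    then obtain a where "\<forall>\<^sub>F z in nhds 0. 1 - g z = a z * f z"
      using g(2) quot_class_eq_iff[of "\<lambda>z. 1" g] by auto
    then have "1 - g 0 = a 0 * f 0" by (rule eventually_nhds_x_imp_x)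
    with f0 \<open>g 0 = 0\<close> show False by simp
  qed
  have sub: "J \<subseteq> ?M" if J: "ideal J (local_ring f)" and ne: "J \<noteq> carrier (local_ring f)" for J
  proof
    fix x assume x: "x \<in> J"
    then have "x \<in> carrier (local_ring f)" using ideal.Icarr[OF J] by blast
    then obtain g where g: "holo_at_0 g" "x = quot_class f g" unfolding local_ring_carrier by blast
    show "x \<in> ?M"
    proof (rule ccontr)
      assume "x \<notin> ?M"
      then have "g 0 \<noteq> 0" using g by (auto simp: max_pow_1_iff simp del: max_pow.simps)
      then have inv: "holo_at_0 (\<lambda>z. inverse (g z))" using g(1) by (intro holo_at_0_inverse)
      have "\<forall>\<^sub>F z in nhds 0. g z \<noteq> 0"
        using holo_at_0_isCont[OF g(1)] \<open>g 0 \<noteq> 0\<close>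
        by (simp add: continuous_within tendsto_imp_eventually_ne eventually_nhds_conv_at)
      then have "\<forall>\<^sub>F z in nhds 0. g z * inverse (g z) - 1 = 0 * f z" by eventually_elim simp
      then have "quot_class f (\<lambda>z. g z * inverse (g z)) = quot_class f (\<lambda>z. 1)"
        unfolding quot_class_eq_iff[OF holo_at_0_mult[OF g(1) inv] holo_at_0_const]
        by (intro exI[of _ "\<lambda>z. 0"] conjI holo_at_0_const)
      then have "x \<otimes>\<^bsub>local_ring f\<^esub> quot_class f (\<lambda>z. inverse (g z)) = \<one>\<^bsub>local_ring f\<^esub>"
        unfolding g(2) quot_class_one quot_class_mult[OF g(1) inv] .
      then have "\<one>\<^bsub>local_ring f\<^esub> \<in> J"
        using ideal.I_r_closed[OF J x quot_class_in_carrier[OF inv]] by simp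
      then show False using ideal.one_imp_carrier[OF J] ne by blast
    qed
  qed
  have "maximalideal ?M (local_ring f)"
  proof (rule maximalidealI[OF ideal_quot_max_pow])
    show "carrier (local_ring f) \<noteq> ?M" using one R.one_closed by blast
    show "J = ?M \<or> J = carrier (local_ring f)"
      if "ideal J (local_ring f)" "?M \<subseteq> J" "J \<subseteq> carrier (local_ring f)" for J
      using sub[OF that(1)] that(2) by blast
  qed
  moreover have "M = ?M" if "maximalideal M (local_ring f)" for M
  proof -
    interpret M: maximalideal M "local_ring f" by fact
    have "M \<subseteq> ?M" using sub[OF M.is_ideal] M.I_notcarr by blast
    moreover have "?M \<subseteq> carrier (local_ring f)" using ideal.Icarr[OF ideal_quot_max_pow] by blast
    ultimately have "?M = M \<or> ?M = carrier (local_ring f)"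
      by (intro M.I_maximal ideal_quot_max_pow)
    then show ?thesis using one R.one_closed by blast
  qed
  ultimately show ?thesis unfolding max_ideal_def by (rule the_equality)
qed

end

section \<open>The arc filtration is the filtration by powers of the maximal ideal\<close>

lemma hom_part_sum: "hom_part k (\<Sum>a\<in>A. p a) = (\<Sum>a\<in>A. hom_part k (p a))"
  by (rule poly_mapping_eqI) (auto simp: lookup_hom_part lookup_sum)

lemma hom_part_homogeneous: "homogeneous l p \<Longrightarrow> hom_part k p = (if k = l then p else 0)"
  by (rule poly_mapping_eqI) (auto simp: lookup_hom_part homogeneous_iff in_keys_iff)

text \<open>
  Of the cofactor only the component of degree \<open>k - d\<close> contributes.
\<close>

lemma homogeneous_quotient:
  assumes F: "homogeneous d F" and p: "homogeneous k p" and dvd: "F dvd p"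
  shows "p = 0 \<or> d \<le> k \<and> (\<exists>s. homogeneous (k - d) s \<and> p = F * s)"
proof -
  obtain s where s: "p = F * s" using dvd by blast
  define D where "D = Max (insert 0 (mdeg ` Poly_Mapping.keys s))"
  have "mdeg m \<le> D" if "m \<in> Poly_Mapping.keys s" for m
    unfolding D_def using that by (intro Max_ge) auto
  then have "s = (\<Sum>j\<le>D. hom_part j s)" by (rule sum_hom_parts)
  then have "p = (\<Sum>j\<le>D. F * hom_part j s)" unfolding s by (metis sum_distrib_left)
  then have "hom_part k p = (\<Sum>j\<le>D. hom_part k (F * hom_part j s))" by (simp add: hom_part_sum)
  also have "\<dots> = (\<Sum>j\<le>D. if k = d + j then F * hom_part j s else 0)"
    by (intro sum.cong refl hom_part_homogeneous homogeneous_mult F homogeneous_hom_part)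
  finally have eq: "p = (\<Sum>j\<le>D. if k = d + j then F * hom_part j s else 0)"
    using hom_part_homogeneous[OF p, of k] by simp
  show ?thesis
  proof (cases "d \<le> k")
    case True
    then have "p = (\<Sum>j\<le>D. if k - d = j then F * hom_part j s else 0)"
      by (subst eq) (intro sum.cong, auto)
    then have "p = (if k - d \<le> D then F * hom_part (k - d) s else 0)" by simp
    then show ?thesis using True homogeneous_hom_part[of "k - d" s] by (cases "k - d \<le> D") auto
  next
    case False
    then have "p = (\<Sum>j\<le>D. 0)" by (subst eq) (intro sum.cong, auto)
    then show ?thesis by simp
  qed
qed

lemma analytic_on_poly: "y analytic_on S \<Longrightarrow> (\<lambda>t. poly Q (y t)) analytic_on S"
  by (induction Q) (simp_all add: analytic_intros)

text \<open>
  If the leading form \<open>p\<close> of \<open>g\<close> is not divisible by \<open>F\<close>, an arc tangent to a smooth point of the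
  tangent cone off \<open>{p = 0}\<close> has the smallest order possible on \<open>g\<close>.  The conclusion is stated
  for functions that agree with \<open>g\<close> along the arc, since other representatives of the class of \<open>g\<close> will be inserted.
\<close>

lemma detecting_arc:
  fixes f :: "complex^'n::finite \<Rightarrow> complex"
  assumes f: "(\<lambda>z. f z - mpoly_eval F z) \<in> max_pow (Suc d)"
    and F: "homogeneous d F" "d \<ge> 1" "F \<noteq> 0" "no_multiple_factors F"
    and g: "(\<lambda>z. g z - mpoly_eval p z) \<in> max_pow (Suc k)" and p: "homogeneous k p" "\<not> F dvd p"
  obtains \<phi> where "\<phi> \<in> arcs f" "\<forall>h. (\<forall>\<^sub>F t in nhds 0. h t = g (\<phi> t)) \<longrightarrow> vanishing_order h = enat k"
proof -
  obtain x e A where A: "\<And>t. poly A t = mpoly_eval F (x + t *s e)" "poly A 0 = 0"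
    "poly (pderiv A) 0 \<noteq> 0" "mpoly_eval p x \<noteq> 0"
    using smooth_point_off_divisor[OF F p(2)] by metis
  obtain y where y: "y analytic_on {0}" "y 0 = 0" "\<forall>\<^sub>F t in nhds 0. f (t *s (x + y t *s e)) = 0"
    by (rule smooth_arc[OF f F(1) A(1-3)])
  define \<phi> where "\<phi> t = t *s (x + y t *s e)" for t
  have \<phi>: "(\<lambda>t. \<phi> t $ i) analytic_on {0}" for i
    unfolding \<phi>_def vector_smult_component vector_add_component by (intro analytic_intros y(1))
  have \<phi>0: "\<phi> 0 = 0" by (simp add: \<phi>_def)
  have "\<phi> \<in> arcs f" unfolding arcs_def using \<phi> \<phi>0 y(3) by (simp add: \<phi>_def)
  moreover have "vanishing_order h = enat k" if h: "\<forall>\<^sub>F t in nhds 0. h t = g (\<phi> t)" for h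
  proof -
    obtain u where u: "u analytic_on {0}" "\<forall>\<^sub>F t in nhds 0. g (\<phi> t) - mpoly_eval p (\<phi> t) = t ^ Suc k * u t"
      using max_pow_curve[of \<phi>, OF \<phi> \<phi>0 g] by blast
    obtain Q where Q: "\<And>t. mpoly_eval p (x + t *s e) = poly Q t" using mpoly_eval_on_line by blast
    define w where "w t = poly Q (y t) + t * u t" for t
    have "w analytic_on {0}" unfolding w_def by (intro analytic_intros analytic_on_poly y(1) u(1))
    moreover have "w 0 \<noteq> 0" using A(4) Q[of 0] by (simp add: w_def y(2))
    moreover have "\<forall>\<^sub>F t in nhds 0. h t = t ^ k * w t"
      using h u(2)
    proof eventually_elim
      case (elim t)
      have "mpoly_eval p (\<phi> t) = t ^ k * poly Q (y t)"
        by (simp add: \<phi>_def homogeneous_scale[OF p(1)] Q)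
      then show ?case using elim by (simp add: w_def algebra_simps)
    qed
    ultimately show ?thesis by (rule vanishing_order_exact)
  qed
  ultimately show thesis using that by blast
qed

text \<open>
  If \<open>p = F s\<close>, the representative \<open>g - s f\<close> of the same class has larger order.
\<close>

lemma reduce_order:
  fixes f :: "complex^'n::finite \<Rightarrow> complex"
  assumes f: "holo_at_0 f" "(\<lambda>z. f z - mpoly_eval F z) \<in> max_pow (Suc d)" and F: "homogeneous d F"
    and g: "g \<in> max_pow k" "(\<lambda>z. g z - mpoly_eval p z) \<in> max_pow (Suc k)" and p: "homogeneous k p" "F dvd p"
  shows "quot_class f g \<in> quot_class f ` max_pow (Suc k)"
  using homogeneous_quotient[OF F p]
proof (elim disjE conjE exE)
  assume "p = 0"
  then show ?thesis using g(2) by simp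
next
  fix s assume d: "d \<le> k" and s: "homogeneous (k - d) s" "p = F * s"
  have "(\<lambda>z. mpoly_eval s z * (f z - mpoly_eval F z)) \<in> max_pow (k - d + Suc d)"
    by (rule max_pow_mult[OF homogeneous_max_pow[OF s(1)] f(2)])
  then have "(\<lambda>z. mpoly_eval s z * (f z - mpoly_eval F z)) \<in> max_pow (Suc k)" using d by simp
  from max_pow_diff[OF g(2) this]
  have g': "(\<lambda>z. g z - mpoly_eval s z * f z) \<in> max_pow (Suc k)"
    by (simp add: s(2) algebra_simps del: max_pow.simps)
  have hs: "holo_at_0 (mpoly_eval s)" by (rule max_pow_holo[OF homogeneous_max_pow[OF s(1)]])
  have "quot_class f g = quot_class f (\<lambda>z. g z - mpoly_eval s z * f z)"
    unfolding quot_class_eq_iff[OF f(1) max_pow_holo[OF g(1)] max_pow_holo[OF g']]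
    by (intro exI[of _ "mpoly_eval s"] conjI hs) simp
  with g' show ?thesis by blast
qed

lemma arc_val_geI:
  assumes "g \<in> max_pow i"
  shows "enat i \<le> arc_val f g"
  unfolding arc_val_def
proof (rule INF_greatest)
  fix \<phi> assume "\<phi> \<in> arcs f"
  then have "\<And>i. (\<lambda>t. \<phi> t $ i) analytic_on {0}" "\<phi> 0 = 0" by (auto simp: arcs_def)
  from max_pow_curve[of \<phi>, OF this assms]
  obtain u where u: "u analytic_on {0}" "\<forall>\<^sub>F t in nhds 0. g (\<phi> t) = t ^ i * u t" by blast
  show "enat i \<le> vanishing_order (\<lambda>t. g (\<phi> t))" by (rule vanishing_order_ge[OF u])
qed

text \<open>
  Given \<open>g\<close> of arc order at least \<open>i\<close>, raise the order of a representative step by step up to \<open>i\<close>.  As long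
  as the order \<open>k\<close> is less than \<open>i\<close>, its leading form is divisible by \<open>F\<close>, for otherwise some arc detects
  the order \<open>k\<close>.
\<close>

lemma arc_filtration_eq_quot_max_pow:
  fixes f :: "complex^'n::finite \<Rightarrow> complex"
  assumes f: "holo_at_0 f" "(\<lambda>z. f z - mpoly_eval F z) \<in> max_pow (Suc d)"
    and F: "homogeneous d F" "d \<ge> 1" "F \<noteq> 0" "no_multiple_factors F"
  shows "arc_filtration f i = quot_class f ` max_pow i"
proof
  show "quot_class f ` max_pow i \<subseteq> arc_filtration f i"
  proof (rule image_subsetI)
    fix g :: "complex^'n \<Rightarrow> complex"
    assume "g \<in> max_pow i"
    then show "quot_class f g \<in> arc_filtration f i"
      unfolding arc_filtration_def mem_Collect_eq
      by (intro exI[of _ g] conjI refl max_pow_holo arc_val_geI)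
  qed
  show "arc_filtration f i \<subseteq> quot_class f ` max_pow i"
  proof
    fix x assume "x \<in> arc_filtration f i"
    then obtain g where g: "x = quot_class f g" "holo_at_0 g" "enat i \<le> arc_val f g"
      unfolding arc_filtration_def by blast
    have "k \<le> i \<Longrightarrow> quot_class f g \<in> quot_class f ` max_pow k" for k
    proof (induction k)
      case 0
      then show ?case using g(2) by simp
    next
      case (Suc k)
      then obtain g' where g': "g' \<in> max_pow k" "quot_class f g = quot_class f g'" by auto
      obtain p where p: "homogeneous k p" "(\<lambda>z. g' z - mpoly_eval p z) \<in> max_pow (Suc k)"
        using leading_form[OF g'(1)] by blast
      show ?case
      proof (cases "F dvd p")
        case True
        from reduce_order[OF f F(1) g'(1) p(2,1) this] show ?thesis unfolding g'(2) .
      next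
        case False
        obtain \<phi> where \<phi>: "\<phi> \<in> arcs f"
          "\<forall>h. (\<forall>\<^sub>F t in nhds 0. h t = g' (\<phi> t)) \<longrightarrow> vanishing_order h = enat k"
          by (rule detecting_arc[OF f(2) F p(2,1) False])
        obtain a where a: "\<forall>\<^sub>F z in nhds 0. g z - g' z = a z * f z"
          using g'(2) quot_class_eq_iff[OF f(1) g(2) max_pow_holo[OF g'(1)]] by blast
        have arc: "\<And>i. (\<lambda>t. \<phi> t $ i) analytic_on {0}" "\<phi> 0 = 0" "\<forall>\<^sub>F t in nhds 0. f (\<phi> t) = 0"
          using \<phi>(1) by (auto simp: arcs_def)
        have "\<forall>\<^sub>F t in nhds 0. g (\<phi> t) - g' (\<phi> t) = a (\<phi> t) * f (\<phi> t)"
          by (rule eventually_compose_filterlim[OF a tendsto_nhds_curve[OF arc(1,2)]])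
        with arc(3) have "\<forall>\<^sub>F t in nhds 0. g (\<phi> t) = g' (\<phi> t)" by eventually_elim simp
        from \<phi>(2)[rule_format, OF this]
        have "vanishing_order (\<lambda>t. g (\<phi> t)) = enat k" .
        moreover have "arc_val f g \<le> vanishing_order (\<lambda>t. g (\<phi> t))"
          unfolding arc_val_def using \<phi>(1) by (rule INF_lower)
        ultimately have "enat i \<le> enat k" using g(3) order_trans by metis
        with Suc.prems show ?thesis by simp
      qed
    qed
    then show "x \<in> quot_class f ` max_pow i" unfolding g(1) by simp
  qed
qed

section \<open>Forms modulo the multiples of a form\<close>

definition mscale :: "complex \<Rightarrow> 'n::finite mpoly \<Rightarrow> 'n mpoly" where
  "mscale c p = Poly_Mapping.single 0 c * p"

interpretation mpv: vector_space "mscale :: complex \<Rightarrow> 'n::finite mpoly \<Rightarrow> 'n mpoly"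
proof
  fix a b :: complex and x y :: "'n mpoly"
  show "mscale a (x + y) = mscale a x + mscale a y" by (simp add: mscale_def distrib_left)
  show "mscale (a + b) x = mscale a x + mscale b x" by (simp add: mscale_def distrib_right single_add)
  show "mscale a (mscale b x) = mscale (a * b) x" by (simp add: mscale_def mult_single mult.assoc[symmetric])
  show "mscale 1 x = x" by (simp add: mscale_def)
qed

lemma mpoly_eval_mscale [simp]: "mpoly_eval (mscale c p) z = c * mpoly_eval p z"
  by (simp add: mscale_def)

lemma lookup_mscale: "Poly_Mapping.lookup (mscale c p) m = c * Poly_Mapping.lookup p m"
proof -
  have "mscale c p = (\<Sum>m\<in>Poly_Mapping.keys p. Poly_Mapping.single m (c * Poly_Mapping.lookup p m))"
    unfolding mscale_def by (subst mpoly_sum_monomials[of p]) (simp add: sum_distrib_left mult_single)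
  then show ?thesis
    by (auto simp: lookup_sum lookup_single when_def in_keys_iff)
qed

definition hmonoms :: "nat \<Rightarrow> 'n::finite mpoly set" where
  "hmonoms i = (\<lambda>m. Poly_Mapping.single m 1) ` {m. mdeg m = i}"

text \<open>
  Exponent vectors of degree \<open>i\<close> are lists of length \<open>CARD('n)\<close> with sum \<open>i\<close>.
\<close>

lemma card_mdeg:
  "finite {m :: 'n::finite \<Rightarrow>\<^sub>0 nat. mdeg m = i}"
  "card {m :: 'n::finite \<Rightarrow>\<^sub>0 nat. mdeg m = i} = (i + CARD('n) - 1) choose i"
proof -
  define N where "N = CARD('n)"
  obtain \<iota> :: "nat \<Rightarrow> 'n" where \<iota>: "bij_betw \<iota> {..<N} UNIV"
    unfolding N_def using ex_bij_betw_nat_finite[OF finite_class.finite_UNIV] by (auto simp: atLeast0LessThan)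
  define \<kappa> where "\<kappa> = the_inv_into {..<N} \<iota>"
  have \<kappa>\<iota>: "\<kappa> (\<iota> k) = k" if "k < N" for k
    unfolding \<kappa>_def using \<iota> that by (simp add: the_inv_into_f_f bij_betw_def)
  have \<iota>\<kappa>: "\<iota> (\<kappa> x) = x" "\<kappa> x < N" for x
    using \<iota> unfolding \<kappa>_def bij_betw_def
    by (auto simp: f_the_inv_into_f intro: the_inv_into_into[of \<iota> "{..<N}" x "{..<N}", simplified])
  let ?L = "\<lambda>m. map (\<lambda>k. Poly_Mapping.lookup m (\<iota> k)) [0..<N]"
  have sum: "sum_list (?L m) = mdeg m" for m :: "'n \<Rightarrow>\<^sub>0 nat"
    unfolding mdeg_def using sum.reindex_bij_betw[OF \<iota>, of "Poly_Mapping.lookup m"]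
    by (simp add: interv_sum_list_conv_sum_set_nat atLeast0LessThan)
  have bij: "bij_betw ?L {m. mdeg m = i} {l. size l = N \<and> sum_list l = i}"
  proof (rule bij_betw_byWitness[where f' = "\<lambda>l. Abs_poly_mapping (\<lambda>x. l ! \<kappa> x)"])
    show "\<forall>m\<in>{m. mdeg m = i}. Abs_poly_mapping (\<lambda>x. ?L m ! \<kappa> x) = m"
      by (auto intro!: poly_mapping_eqI simp: \<iota>\<kappa>)
    show "\<forall>l\<in>{l. size l = N \<and> sum_list l = i}. ?L (Abs_poly_mapping (\<lambda>x. l ! \<kappa> x)) = l"
      by (auto intro!: nth_equalityI simp: \<kappa>\<iota>)
    show "?L ` {m. mdeg m = i} \<subseteq> {l. size l = N \<and> sum_list l = i}"
      using sum by auto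
    show "(\<lambda>l. Abs_poly_mapping (\<lambda>x. l ! \<kappa> x)) ` {l. size l = N \<and> sum_list l = i} \<subseteq> {m. mdeg m = i}"
    proof clarsimp
      fix l :: "nat list" assume l: "N = length l" "i = sum_list l"
      have "?L (Abs_poly_mapping (\<lambda>x. l ! \<kappa> x)) = l" using l(1) by (auto intro!: nth_equalityI simp: \<kappa>\<iota>)
      then show "mdeg (Abs_poly_mapping (\<lambda>x. l ! \<kappa> x)) = sum_list l" using sum by metis
    qed
  qed
  have "{l :: nat list. size l = N \<and> sum_list l = i} \<subseteq> {l. set l \<subseteq> {..i} \<and> length l = N}"
    using member_le_sum_list by fastforce
  then have "finite {l :: nat list. size l = N \<and> sum_list l = i}"
    by (rule finite_subset) (rule finite_lists_length_eq, simp)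
  then show "finite {m :: 'n \<Rightarrow>\<^sub>0 nat. mdeg m = i}" using bij_betw_finite[OF bij] by simp
  show "card {m :: 'n \<Rightarrow>\<^sub>0 nat. mdeg m = i} = (i + CARD('n) - 1) choose i"
    using bij_betw_same_card[OF bij] card_length_sum_list[of N i] by (simp add: N_def)
qed

lemma single_inj: "inj (\<lambda>m. Poly_Mapping.single m (1::complex))"
  by (rule injI) (metis keys_single singleton_inject zero_neq_one)

lemma hmonoms_facts:
  "finite (hmonoms i :: 'n::finite mpoly set)"
  "card (hmonoms i :: 'n::finite mpoly set) = (i + CARD('n) - 1) choose i"
  unfolding hmonoms_def
  by (auto simp: card_mdeg card_image[OF inj_on_subset[OF single_inj subset_UNIV]])

lemma subspace_homogeneous: "mpv.subspace {p. homogeneous i p}"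
  unfolding mpv.subspace_def
proof (intro conjI ballI allI)
  fix c :: complex and p :: "'a mpoly" assume "p \<in> {p. homogeneous i p}"
  then show "mscale c p \<in> {p. homogeneous i p}"
    by (auto simp: homogeneous_iff in_keys_iff lookup_mscale)
qed (auto intro: homogeneous_add)

lemma span_hmonoms: "mpv.span (hmonoms i) = {p. homogeneous i p}"
proof
  have "hmonoms i \<subseteq> {p :: 'a mpoly. homogeneous i p}"
    by (auto simp: hmonoms_def intro: homogeneous_single)
  then show "mpv.span (hmonoms i) \<subseteq> {p :: 'a mpoly. homogeneous i p}"
    using mpv.span_minimal subspace_homogeneous by blast
  show "{p :: 'a mpoly. homogeneous i p} \<subseteq> mpv.span (hmonoms i)"
  proof
    fix p :: "'a mpoly" assume "p \<in> {p. homogeneous i p}"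
    then have p: "homogeneous i p" by simp
    have "mscale (Poly_Mapping.lookup p m) (Poly_Mapping.single m 1) \<in> mpv.span (hmonoms i)"
      if "m \<in> Poly_Mapping.keys p" for m
      using p that by (intro mpv.span_scale mpv.span_base) (auto simp: hmonoms_def homogeneous_iff)
    then have "(\<Sum>m\<in>Poly_Mapping.keys p. mscale (Poly_Mapping.lookup p m) (Poly_Mapping.single m 1)) \<in> mpv.span (hmonoms i)"
      by (rule mpv.span_sum)
    moreover have "mscale c (Poly_Mapping.single m 1) = Poly_Mapping.single m c" for c :: complex and m :: "'a \<Rightarrow>\<^sub>0 nat"
      by (simp add: mscale_def mult_single)
    ultimately show "p \<in> mpv.span (hmonoms i)" using mpoly_sum_monomials[of p] by simp
  qed
qed

lemma independent_hmonoms: "mpv.independent (hmonoms i :: 'n::finite mpoly set)"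
  unfolding mpv.independent_explicit_finite_subsets
proof (intro allI impI ballI)
  fix S and u :: "'n mpoly \<Rightarrow> complex" and v
  assume S: "S \<subseteq> hmonoms i" "finite S" and 0: "(\<Sum>v\<in>S. mscale (u v) v) = 0" and v: "v \<in> S"
  obtain m where m: "v = Poly_Mapping.single m 1" using S v by (auto simp: hmonoms_def)
  have "0 = (\<Sum>w\<in>S. u w * Poly_Mapping.lookup w m)"
    using arg_cong[OF 0, of "\<lambda>p. Poly_Mapping.lookup p m"] by (simp add: lookup_sum lookup_mscale)
  also have "\<dots> = (\<Sum>w\<in>S. if w = v then u w else 0)"
  proof (rule sum.cong[OF refl])
    fix w assume "w \<in> S"
    then obtain m' where "w = Poly_Mapping.single m' 1" using S by (auto simp: hmonoms_def)
    then show "u w * Poly_Mapping.lookup w m = (if w = v then u w else 0)"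
      unfolding m using single_inj[THEN inj_eq, of m' m] by (auto simp: lookup_single when_def)
  qed
  also have "\<dots> = u v" using S(2) v by simp
  finally show "u v = 0" by simp
qed

lemma mpoly_mult_cancel:
  fixes F p q :: "'n::finite mpoly"
  assumes "F \<noteq> 0" "F * p = F * q" shows "p = q"
proof -
  have "of_mpoly F * of_mpoly p = of_mpoly F * of_mpoly q" using assms(2) by (simp add: of_mpoly_mult[symmetric])
  moreover have "of_mpoly F \<noteq> 0" using assms(1) of_mpoly_eq_iff[of F 0] by (simp add: of_mpoly_0)
  ultimately show ?thesis by simp
qed

lemma mult_linear: "Vector_Spaces.linear mscale mscale (\<lambda>p. F * p)"
  by unfold_locales (simp_all add: mscale_def distrib_left mult_ac)

lemma span_image_mult: "mpv.span ((\<lambda>p. F * p) ` S) = (\<lambda>p. F * p) ` mpv.span S"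
proof -
  interpret Vector_Spaces.linear mscale mscale "\<lambda>p. F * p" by (rule mult_linear)
  show ?thesis by (rule span_image)
qed

lemma independent_image_mult:
  assumes "F \<noteq> 0" "mpv.independent S"
  shows "mpv.independent ((\<lambda>p. F * p) ` S)"
proof -
  interpret vector_space_pair mscale mscale ..
  show ?thesis
    by (rule linear_independent_injective_image[OF mult_linear assms(2)])
       (auto intro!: inj_onI dest: mpoly_mult_cancel[OF assms(1)])
qed

definition form_multiples :: "nat \<Rightarrow> 'n::finite mpoly \<Rightarrow> nat \<Rightarrow> 'n mpoly set" where
  "form_multiples d F i = (if d \<le> i then (\<lambda>s. F * s) ` {s. homogeneous (i - d) s} else {0})"

text \<open>
  \<open>C\<close> is a basis of a complement of the multiples of \<open>F\<close> among the forms of degree \<open>i\<close>.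
\<close>

lemma homogeneous_complement:
  fixes F :: "'n::finite mpoly"
  assumes F: "homogeneous d F" "F \<noteq> 0"
  obtains C E where "finite C" "C \<subseteq> {p. homogeneous i p}" "C \<inter> E = {}" "mpv.independent (C \<union> E)"
    "mpv.span (C \<union> E) = {p. homogeneous i p}"
    "mpv.span E = form_multiples d F i"
    "card C + (if d \<le> i then (i - d + CARD('n) - 1) choose (i - d) else 0) = (i + CARD('n) - 1) choose i"
proof -
  define E where "E = (if d \<le> i then (\<lambda>s. F * s) ` hmonoms (i - d) else {})"
  have spanE: "mpv.span E = form_multiples d F i"
    by (simp add: E_def span_image_mult span_hmonoms form_multiples_def)
  have "inj_on (\<lambda>s. F * s) A" for A by (rule inj_onI) (rule mpoly_mult_cancel[OF F(2)])
  then have cardE: "card E = (if d \<le> i then (i - d + CARD('n) - 1) choose (i - d) else 0)"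
    by (simp add: E_def card_image hmonoms_facts)
  have finE: "finite E" by (simp add: E_def hmonoms_facts)
  have indE: "mpv.independent E"
    by (simp add: E_def independent_image_mult[OF F(2) independent_hmonoms] mpv.independent_empty)
  have E: "E \<subseteq> {p. homogeneous i p}"
  proof
    fix p assume "p \<in> E"
    then obtain s where s: "d \<le> i" "s \<in> hmonoms (i - d)" "p = F * s" by (auto simp: E_def split: if_splits)
    then have "homogeneous (i - d) s" by (auto simp: hmonoms_def intro: homogeneous_single)
    from homogeneous_mult[OF F(1) this] show "p \<in> {p. homogeneous i p}" using s by simp
  qed
  obtain B where B: "E \<subseteq> B" "B \<subseteq> {p. homogeneous i p}" "mpv.independent B" "{p. homogeneous i p} \<subseteq> mpv.span B"
    by (rule mpv.maximal_independent_subset_extend[OF E indE])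
  have "mpv.span B = {p. homogeneous i p}"
    using B mpv.span_minimal[OF B(2) subspace_homogeneous] by blast
  have "B \<subseteq> mpv.span (hmonoms i)" using B(2) by (simp add: span_hmonoms)
  then have finB: "finite B" using mpv.independent_span_bound[OF hmonoms_facts(1) B(3)] by blast
  have spanV: "mpv.span {p :: 'n mpoly. homogeneous i p} = {p. homogeneous i p}"
    by (rule mpv.span_eq_iff[THEN iffD2, OF subspace_homogeneous])
  have "mpv.dim {p :: 'n mpoly. homogeneous i p} = card B"
    by (rule mpv.dim_eq_card[OF _ B(3)]) (simp add: \<open>mpv.span B = _\<close> spanV)
  moreover have "mpv.dim {p :: 'n mpoly. homogeneous i p} = card (hmonoms i :: 'n mpoly set)"
    by (rule mpv.dim_eq_card[OF _ independent_hmonoms]) (simp add: span_hmonoms spanV)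
  ultimately have "card B = card (hmonoms i :: 'n mpoly set)" by simp
  then have "card (B - E) + card E = (i + CARD('n) - 1) choose i"
    using card_Diff_subset[OF finE B(1)] card_mono[OF finB B(1)] by (simp add: hmonoms_facts)
  moreover have "B - E \<union> E = B" using B(1) by blast
  ultimately show thesis
    using that[of "B - E" E] B finB spanE cardE \<open>mpv.span B = _\<close> by (simp add: Diff_disjoint inf_commute subset_iff)
qed

section \<open>Dimensions of the graded pieces\<close>

text \<open>
  The complex numbers as a ring with carrier; the scalars of the graded pieces are its image.
\<close>

definition complex_field :: "complex ring" where
  "complex_field = \<lparr> carrier = UNIV, mult = (*), one = 1, ring.zero = 0, add = (+) \<rparr>"

lemma field_complex_field: "field complex_field"
proof -
  have "cring complex_field"
  proof (rule cringI)
    show "abelian_group complex_field"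
    proof (rule abelian_groupI)
      show "\<exists>y\<in>carrier complex_field. y \<oplus>\<^bsub>complex_field\<^esub> x = \<zero>\<^bsub>complex_field\<^esub>" for x
        by (rule bexI[of _ "- x"]) (simp_all add: complex_field_def)
    qed (simp_all add: complex_field_def)
    show "comm_monoid complex_field" by (rule comm_monoidI) (simp_all add: complex_field_def)
  qed (simp add: complex_field_def distrib_right)
  then show ?thesis
  proof (rule cring.cring_fieldI)
    have "\<exists>y. y * x = 1 \<and> x * y = 1" if "x \<noteq> 0" for x :: complex
      using that by (intro exI[of _ "inverse x"]) simp
    then show "Units complex_field = carrier complex_field - {\<zero>\<^bsub>complex_field\<^esub>}"
      by (auto simp: Units_def complex_field_def)
  qed
qed

lemma max_pow_if_leading_form:
  assumes "(\<lambda>z. f z - mpoly_eval F z) \<in> max_pow (Suc d)" "homogeneous d F"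
  shows "f \<in> max_pow d"
  by (rule max_pow_cong[OF max_pow_add[OF max_pow_Suc_subset[OF assms(1)] homogeneous_max_pow[OF assms(2)]]]) simp

text \<open>
  The leading form of \<open>a * f\<close> is the product of the leading forms of \<open>a\<close> and \<open>f\<close>, because forms have no
  zero divisors.  So if \<open>a * f\<close> has leading form \<open>r\<close> of degree \<open>i\<close>, then \<open>a\<close> has order \<open>i - d\<close> at least.
\<close>

lemma leading_form_of_multiple:
  fixes f :: "complex^'n::finite \<Rightarrow> complex"
  assumes f: "(\<lambda>z. f z - mpoly_eval F z) \<in> max_pow (Suc d)" and F: "homogeneous d F" "F \<noteq> 0"
    and a: "holo_at_0 a" and r: "homogeneous i r" "(\<lambda>z. mpoly_eval r z - a z * f z) \<in> max_pow (Suc i)"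
  shows "r \<in> form_multiples d F i"
proof -
  have fd: "f \<in> max_pow d" by (rule max_pow_if_leading_form[OF f F(1)])
  have lead: "(\<lambda>z. a z * f z - mpoly_eval (F * s) z) \<in> max_pow (Suc (l + d))"
    if "a \<in> max_pow l" "homogeneous l s" "(\<lambda>z. a z - mpoly_eval s z) \<in> max_pow (Suc l)" for l s
  proof -
    have 1: "(\<lambda>z. (a z - mpoly_eval s z) * f z) \<in> max_pow (Suc l + d)"
      by (rule max_pow_mult[OF that(3) fd])
    have 2: "(\<lambda>z. mpoly_eval s z * (f z - mpoly_eval F z)) \<in> max_pow (l + Suc d)"
      by (rule max_pow_mult[OF homogeneous_max_pow[OF that(2)] f])
    have "(\<lambda>z. (a z - mpoly_eval s z) * f z + mpoly_eval s z * (f z - mpoly_eval F z)) \<in> max_pow (Suc (l + d))"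
      using max_pow_add[of _ "Suc (l + d)"] 1 2 by (simp del: max_pow.simps)
    then show ?thesis by (rule max_pow_cong) (simp add: algebra_simps)
  qed
  have order: "l + d \<le> i \<Longrightarrow> a \<in> max_pow l" for l
  proof (induction l)
    case 0
    then show ?case using a by simp
  next
    case (Suc l)
    then have al: "a \<in> max_pow l" by simp
    obtain s where s: "homogeneous l s" "(\<lambda>z. a z - mpoly_eval s z) \<in> max_pow (Suc l)"
      using leading_form[OF al] by blast
    have "(\<lambda>z. a z * f z) \<in> max_pow i"
      by (rule max_pow_cong[OF max_pow_diff[OF homogeneous_max_pow[OF r(1)] max_pow_Suc_subset[OF r(2)]]]) simp
    then have af: "(\<lambda>z. a z * f z) \<in> max_pow (Suc (l + d))"
      by (rule max_pow_mono[rotated]) (use Suc.prems in simp)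
    have "mpoly_eval (F * s) \<in> max_pow (Suc (l + d))"
      by (rule max_pow_cong[OF max_pow_diff[OF af lead[OF al s]]]) simp
    then have "F * s = 0"
      using homogeneous_max_pow_Suc_imp_0[OF homogeneous_mult[OF F(1) s(1)]] by (simp add: add.commute del: max_pow.simps)
    then have "s = 0" using mpoly_mult_cancel[OF F(2), of s 0] by simp
    with s(2) show ?case by simp
  qed
  show ?thesis
  proof (cases "d \<le> i")
    case True
    then have al: "a \<in> max_pow (i - d)" by (intro order) simp
    obtain s where s: "homogeneous (i - d) s" "(\<lambda>z. a z - mpoly_eval s z) \<in> max_pow (Suc (i - d))"
      using leading_form[OF al] by blast
    have Fs: "(\<lambda>z. a z * f z - mpoly_eval (F * s) z) \<in> max_pow (Suc i)" using lead[OF al s] True by simp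
    have "(\<lambda>z. a z * f z - mpoly_eval r z) \<in> max_pow (Suc i)"
      by (rule max_pow_cong[OF max_pow_uminus[OF r(2)]]) simp
    then have "r = F * s"
      using leading_form_unique[OF r(1) _ _ Fs] homogeneous_mult[OF F(1) s(1)] True by simp
    with True s(1) show ?thesis by (simp add: form_multiples_def)
  next
    case False
    then have "f \<in> max_pow (Suc i)" using max_pow_mono[OF _ fd, of "Suc i"] by simp
    from max_pow_add[OF r(2) max_pow_mult_holo[OF a this]]
    have "mpoly_eval r \<in> max_pow (Suc i)" by (rule max_pow_cong) simp
    then have "r = 0" by (rule homogeneous_max_pow_Suc_imp_0[OF r(1)])
    with False show ?thesis by (simp add: form_multiples_def)
  qed
qed

context
  fixes f :: "complex^'n::finite \<Rightarrow> complex" and F :: "'n mpoly" and d :: nat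
  assumes f: "holo_at_0 f" "(\<lambda>z. f z - mpoly_eval F z) \<in> max_pow (Suc d)"
    and F: "homogeneous d F" "d \<ge> 1" "F \<noteq> 0" "no_multiple_factors F"
begin

definition graded_class :: "nat \<Rightarrow> (complex^'n \<Rightarrow> complex) \<Rightarrow> (complex^'n \<Rightarrow> complex) set set set" where
  "graded_class i g = arc_filtration f (Suc i) +>\<^bsub>local_ring f\<^esub> quot_class f g"

lemma f_at_0: "f 0 = 0"
proof -
  have "f \<in> max_pow d" by (rule max_pow_if_leading_form[OF f(2) F(1)])
  then have "f \<in> max_pow (Suc 0)" using F(2) by (intro max_pow_mono[of "Suc 0" d]) auto
  then show ?thesis unfolding max_pow_1_iff by blast
qed

lemma arc_filtration_ideal: "ideal (arc_filtration f i) (local_ring f)"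
  unfolding arc_filtration_eq_quot_max_pow[OF f F] by (rule ideal_quot_max_pow[OF f(1)])

lemma ring_graded_ring: "ring (graded_ring f i)"
  unfolding graded_ring_def by (rule ideal.quotient_is_ring[OF arc_filtration_ideal])

lemmas graded_facts = FactRing_facts[OF cring.axioms(1)[OF cring_local_ring[OF f(1)]] arc_filtration_ideal[of "Suc i"],
    folded graded_ring_def] for i

lemma graded_class_in_carrier: "holo_at_0 g \<Longrightarrow> graded_class i g \<in> carrier (graded_ring f i)"
  unfolding graded_facts(1) graded_class_def using quot_class_in_carrier[OF f(1)] by blast

lemma graded_class_add:
  "holo_at_0 g \<Longrightarrow> holo_at_0 h \<Longrightarrow> graded_class i (\<lambda>z. g z + h z) = graded_class i g \<oplus>\<^bsub>graded_ring f i\<^esub> graded_class i h"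
  unfolding graded_class_def
  by (simp add: quot_class_add[OF f(1)] graded_facts(2) quot_class_in_carrier[OF f(1)])

lemma graded_class_mult:
  "holo_at_0 g \<Longrightarrow> holo_at_0 h \<Longrightarrow> graded_class i (\<lambda>z. g z * h z) = graded_class i g \<otimes>\<^bsub>graded_ring f i\<^esub> graded_class i h"
  unfolding graded_class_def
  by (simp add: quot_class_mult[OF f(1)] graded_facts(3) quot_class_in_carrier[OF f(1)])

lemma graded_class_one: "graded_class i (\<lambda>z. 1) = \<one>\<^bsub>graded_ring f i\<^esub>"
  unfolding graded_class_def quot_class_one[OF f(1)] by (rule graded_facts(4))

lemma graded_class_zero: "graded_class i (\<lambda>z. 0) = \<zero>\<^bsub>graded_ring f i\<^esub>"
  unfolding graded_class_def quot_class_zero[OF f(1)] by (rule graded_facts(5))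

lemma graded_class_eq_iff:
  assumes g: "holo_at_0 g" and h: "holo_at_0 h"
  shows "graded_class i g = graded_class i h \<longleftrightarrow>
    (\<exists>a. holo_at_0 a \<and> (\<lambda>z. g z - h z - a z * f z) \<in> max_pow (Suc i))"
proof -
  have gh: "holo_at_0 (\<lambda>z. g z - h z)" using g h by (rule holo_at_0_diff)
  have "graded_class i g = graded_class i h \<longleftrightarrow> quot_class f (\<lambda>z. g z - h z) \<in> quot_class f ` max_pow (Suc i)"
    unfolding graded_class_def
    using graded_facts(6)[OF quot_class_in_carrier[OF f(1) g] quot_class_in_carrier[OF f(1) h], of i]
    unfolding quot_class_minus[OF f(1) g h] arc_filtration_eq_quot_max_pow[OF f F] .
  also have "\<dots> \<longleftrightarrow> (\<exists>a. holo_at_0 a \<and> (\<lambda>z. g z - h z - a z * f z) \<in> max_pow (Suc i))"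
  proof
    assume "quot_class f (\<lambda>z. g z - h z) \<in> quot_class f ` max_pow (Suc i)"
    then obtain k where k: "k \<in> max_pow (Suc i)" "quot_class f (\<lambda>z. g z - h z) = quot_class f k" by blast
    then obtain a where a: "holo_at_0 a" "\<forall>\<^sub>F z in nhds 0. g z - h z - k z = a z * f z"
      using quot_class_eq_iff[OF f(1) gh max_pow_holo[OF k(1)]] by blast
    from a(2) have ev: "\<forall>\<^sub>F z in nhds 0. g z - h z - a z * f z = k z"
      by eventually_elim (simp add: algebra_simps)
    show "\<exists>a. holo_at_0 a \<and> (\<lambda>z. g z - h z - a z * f z) \<in> max_pow (Suc i)"
      by (intro exI[of _ a] conjI a(1) max_pow_cong[OF k(1) ev])
  next
    assume "\<exists>a. holo_at_0 a \<and> (\<lambda>z. g z - h z - a z * f z) \<in> max_pow (Suc i)"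
    then obtain a where a: "holo_at_0 a" "(\<lambda>z. g z - h z - a z * f z) \<in> max_pow (Suc i)" by blast
    have "quot_class f (\<lambda>z. g z - h z) = quot_class f (\<lambda>z. g z - h z - a z * f z)"
      unfolding quot_class_eq_iff[OF f(1) gh max_pow_holo[OF a(2)]]
      by (intro exI[of _ a] conjI a(1)) simp
    with a(2) show "quot_class f (\<lambda>z. g z - h z) \<in> quot_class f ` max_pow (Suc i)" by blast
  qed
  finally show ?thesis .
qed

lemma graded_scalars_eq: "graded_scalars f i = range (\<lambda>c. graded_class i (\<lambda>z. c))"
  unfolding graded_scalars_def graded_class_def ..

lemma graded_piece_eq: "graded_piece f i = graded_class i ` max_pow i"
  unfolding graded_piece_def graded_class_def arc_filtration_eq_quot_max_pow[OF f F, of i] by (simp add: image_image)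

lemma subfield_graded_scalars: "subfield (graded_scalars f i) (graded_ring f i)"
proof -
  have hom: "(\<lambda>c. graded_class i (\<lambda>z. c)) \<in> ring_hom complex_field (graded_ring f i)"
    by (rule ring_hom_memI)
       (auto simp: complex_field_def graded_class_in_carrier graded_class_one[symmetric]
          graded_class_add[symmetric] graded_class_mult[symmetric])
  interpret K: field complex_field by (rule field_complex_field)
  interpret ring_hom_ring complex_field "graded_ring f i" "\<lambda>c. graded_class i (\<lambda>z. c)"
    by (rule ring_hom_ringI2[OF K.ring_axioms ring_graded_ring hom])
  have "graded_class i (\<lambda>z. 1) \<noteq> graded_class i (\<lambda>z. 0)"
  proof
    assume "graded_class i (\<lambda>z. 1) = graded_class i (\<lambda>z. 0)"
    then obtain a where a: "(\<lambda>z. 1 - 0 - a z * f z) \<in> max_pow (Suc i)"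
      unfolding graded_class_eq_iff[OF holo_at_0_const holo_at_0_const] by blast
    then have "(\<lambda>z. 1 - 0 - a z * f z) \<in> max_pow (Suc 0)" by (rule max_pow_mono[rotated]) simp
    then show False by (simp add: max_pow_1_iff f_at_0 del: max_pow.simps)
  qed
  then have "\<one>\<^bsub>graded_ring f i\<^esub> \<noteq> \<zero>\<^bsub>graded_ring f i\<^esub>" by (simp add: graded_class_one graded_class_zero)
  from img_is_subfield(2)[OF K.carrier_is_subfield this] show ?thesis
    by (simp add: graded_scalars_eq complex_field_def)
qed

definition form_class :: "nat \<Rightarrow> 'n mpoly \<Rightarrow> (complex^'n \<Rightarrow> complex) set set set" where
  "form_class i p = graded_class i (mpoly_eval p)"

lemma holo_mpoly_eval: "holo_at_0 (mpoly_eval p)"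
proof -
  have "holo_at_0 (\<lambda>z. \<Sum>m\<in>Poly_Mapping.keys p. Poly_Mapping.lookup p m * monom_fun m z)"
    by (intro holo_at_0_sum holo_at_0_mult holo_at_0_const max_pow_holo[OF monom_fun_max_pow] finite_keys)
  then show ?thesis unfolding mpoly_eval_eq[abs_def] .
qed

lemma form_class_combine:
  "form_class i (mscale c p + q) =
     graded_class i (\<lambda>z. c) \<otimes>\<^bsub>graded_ring f i\<^esub> form_class i p \<oplus>\<^bsub>graded_ring f i\<^esub> form_class i q"
proof -
  have "mpoly_eval (mscale c p + q) = (\<lambda>z. c * mpoly_eval p z + mpoly_eval q z)"
    by (rule ext) simp
  then show ?thesis unfolding form_class_def
    by (simp add: graded_class_add graded_class_mult holo_at_0_mult holo_mpoly_eval)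
qed

text \<open>
  Sending a form to its class identifies the graded piece of degree \<open>i\<close> with the forms of degree \<open>i\<close>
  modulo the multiples of \<open>F\<close>.
\<close>

lemma form_class_eq_iff:
  assumes "homogeneous i p" "homogeneous i q"
  shows "form_class i p = form_class i q \<longleftrightarrow>
    p - q \<in> form_multiples d F i"
proof -
  have hom: "homogeneous i (p - q)"
    using mpv.subspace_diff[OF subspace_homogeneous, of p i q] assms by simp
  have iff: "form_class i p = form_class i q \<longleftrightarrow>
      (\<exists>a. holo_at_0 a \<and> (\<lambda>z. mpoly_eval (p - q) z - a z * f z) \<in> max_pow (Suc i))"
    unfolding form_class_def graded_class_eq_iff[OF holo_mpoly_eval holo_mpoly_eval] by simp
  show ?thesis
  proof
    assume "form_class i p = form_class i q"
    then obtain a where "holo_at_0 a" "(\<lambda>z. mpoly_eval (p - q) z - a z * f z) \<in> max_pow (Suc i)"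
      unfolding iff by blast
    then show "p - q \<in> form_multiples d F i"
      by (rule leading_form_of_multiple[OF f(2) F(1,3) _ hom])
  next
    assume *: "p - q \<in> form_multiples d F i"
    show "form_class i p = form_class i q"
    proof (cases "d \<le> i")
      case True
      then obtain s where s: "homogeneous (i - d) s" "p - q = F * s" using * by (auto simp: form_multiples_def)
      have "(\<lambda>z. mpoly_eval s z * (f z - mpoly_eval F z)) \<in> max_pow (i - d + Suc d)"
        by (rule max_pow_mult[OF homogeneous_max_pow[OF s(1)] f(2)])
      then have "(\<lambda>z. mpoly_eval s z * (f z - mpoly_eval F z)) \<in> max_pow (Suc i)" using True by simp
      from max_pow_uminus[OF this]
      have "(\<lambda>z. mpoly_eval (p - q) z - mpoly_eval s z * f z) \<in> max_pow (Suc i)"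
        by (rule max_pow_cong) (simp add: s(2) algebra_simps del: mpoly_eval_diff)
      then show ?thesis unfolding iff by (intro exI[of _ "mpoly_eval s"] conjI holo_mpoly_eval)
    next
      case False
      then show ?thesis using * by (simp add: form_multiples_def)
    qed
  qed
qed

lemma graded_dimension_formula:
  "\<exists>k. graded_dimension f i k \<and>
     k + (if d \<le> i then (i - d + CARD('n) - 1) choose (i - d) else 0) = (i + CARD('n) - 1) choose i"
proof -
  interpret G: ring "graded_ring f i" by (rule ring_graded_ring)
  obtain C E where C: "finite C" "C \<subseteq> {p. homogeneous i p}" "C \<inter> E = {}" "mpv.independent (C \<union> E)"
    "mpv.span (C \<union> E) = {p. homogeneous i p}"
    "mpv.span E = form_multiples d F i"
    "card C + (if d \<le> i then (i - d + CARD('n) - 1) choose (i - d) else 0) = (i + CARD('n) - 1) choose i"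
    by (rule homogeneous_complement[OF F(1,3), of i]) 
  have span_hom: "mpv.span A \<subseteq> {p. homogeneous i p}" if "A \<subseteq> C" for A
    using mpv.span_minimal[OF _ subspace_homogeneous] that C(2) by blast
  \<comment> \<open>each new form of \<open>C\<close> is independent of the previous ones modulo the span of \<open>E\<close>, the multiples of \<open>F\<close>\<close>
  have "G.dimension (card A) (graded_scalars f i) (form_class i ` mpv.span A)" if "finite A" "A \<subseteq> C" for A
    using that
  proof (induction A rule: finite_induct)
    case empty
    have "form_class i 0 = \<zero>\<^bsub>graded_ring f i\<^esub>"
      using graded_class_zero[of i] by (simp add: form_class_def mpoly_eval_0[abs_def])
    then show ?case by (simp add: mpv.span_empty)
  next
    case (insert c A)
    have cC: "c \<in> C" and AC: "A \<subseteq> C" using insert.prems by auto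
    have hc: "homogeneous i c" using C(2) cC by blast
    have notin: "form_class i c \<notin> form_class i ` mpv.span A"
    proof
      assume "form_class i c \<in> form_class i ` mpv.span A"
      then obtain q where q: "q \<in> mpv.span A" "form_class i c = form_class i q" by blast
      have "homogeneous i q" using span_hom[OF AC] q(1) by blast
      then have "c - q \<in> mpv.span E" using q(2) form_class_eq_iff[OF hc] C(6) by simp
      moreover have "mpv.span E \<subseteq> mpv.span (C \<union> E - {c})" "mpv.span A \<subseteq> mpv.span (C \<union> E - {c})"
        using C(3) cC AC insert.hyps by (auto intro!: mpv.span_mono)
      ultimately have "(c - q) + q \<in> mpv.span (C \<union> E - {c})"
        using q(1) by (intro mpv.span_add) auto
      then have "c \<in> mpv.span (C \<union> E - {c})" by simp
      then show False using C(4) cC unfolding mpv.dependent_def by blast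
    qed
    have "form_class i ` mpv.span (insert c A) =
        G.line_extension (graded_scalars f i) (form_class i c) (form_class i ` mpv.span A)"
    proof (intro equalityI subsetI)
      fix x assume "x \<in> form_class i ` mpv.span (insert c A)"
      then obtain p where p: "p \<in> mpv.span (insert c A)" "x = form_class i p" by blast
      then obtain k where k: "p - mscale k c \<in> mpv.span A" unfolding mpv.span_insert by blast
      have "x = form_class i (mscale k c + (p - mscale k c))" using p(2) by simp
      also have "\<dots> = graded_class i (\<lambda>z. k) \<otimes>\<^bsub>graded_ring f i\<^esub> form_class i c \<oplus>\<^bsub>graded_ring f i\<^esub> form_class i (p - mscale k c)"
        by (rule form_class_combine)
      finally show "x \<in> G.line_extension (graded_scalars f i) (form_class i c) (form_class i ` mpv.span A)"
        unfolding G.line_extension_mem_iff graded_scalars_eq using k by blast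
    next
      fix x assume "x \<in> G.line_extension (graded_scalars f i) (form_class i c) (form_class i ` mpv.span A)"
      then obtain k q where kq: "q \<in> mpv.span A"
        "x = graded_class i (\<lambda>z. k) \<otimes>\<^bsub>graded_ring f i\<^esub> form_class i c \<oplus>\<^bsub>graded_ring f i\<^esub> form_class i q"
        unfolding G.line_extension_mem_iff graded_scalars_eq by blast
      then have "x = form_class i (mscale k c + q)" by (simp add: form_class_combine)
      moreover have "mscale k c + q \<in> mpv.span (insert c A)"
        using kq(1) mpv.span_mono[of A "insert c A"]
        by (intro mpv.span_add mpv.span_scale) (auto intro: mpv.span_base)
      ultimately show "x \<in> form_class i ` mpv.span (insert c A)" by blast
    qed
    moreover have "form_class i c \<in> carrier (graded_ring f i)"
      unfolding form_class_def by (rule graded_class_in_carrier[OF holo_mpoly_eval])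
    ultimately show ?case
      using G.Suc_dim[OF _ notin insert.IH[OF AC]] insert.hyps by simp
  qed
  from this[OF C(1) subset_refl]
  have "G.dimension (card C) (graded_scalars f i) (form_class i ` mpv.span C)" .
  moreover have "form_class i ` mpv.span C = graded_piece f i"
  proof (intro equalityI subsetI)
    fix x assume "x \<in> form_class i ` mpv.span C"
    then obtain p where "homogeneous i p" "x = form_class i p" using span_hom[of C] by blast
    then show "x \<in> graded_piece f i"
      unfolding graded_piece_eq form_class_def using homogeneous_max_pow by blast
  next
    fix x assume "x \<in> graded_piece f i"
    then obtain g where g: "g \<in> max_pow i" "x = graded_class i g" unfolding graded_piece_eq by blast
    obtain p where p: "homogeneous i p" "(\<lambda>z. g z - mpoly_eval p z) \<in> max_pow (Suc i)"
      using leading_form[OF g(1)] by blast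
    have "(\<lambda>z. g z - mpoly_eval p z - 0 * f z) \<in> max_pow (Suc i)" by (rule max_pow_cong[OF p(2)]) simp
    then have "graded_class i g = form_class i p"
      unfolding form_class_def graded_class_eq_iff[OF max_pow_holo[OF g(1)] holo_mpoly_eval]
      by (intro exI[of _ "\<lambda>z. 0"] conjI holo_at_0_const)
    obtain c w where cw: "p = c + w" "c \<in> mpv.span C" "w \<in> mpv.span E"
      using p(1) C(5) unfolding mpv.span_Un by blast
    have "homogeneous i c" using span_hom[of C] cw(2) by blast
    then have "form_class i p = form_class i c"
      using form_class_eq_iff[OF p(1), of c] cw C(6) by simp
    with \<open>graded_class i g = form_class i p\<close> g(2) cw(2) show "x \<in> form_class i ` mpv.span C" by simp
  qed
  ultimately have "graded_dimension f i (card C)" unfolding graded_dimension_def by simp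
  with C(7) show ?thesis by blast
qed

lemma graded_dimension_unique: "graded_dimension f i k \<Longrightarrow> graded_dimension f i l \<Longrightarrow> k = l"
  unfolding graded_dimension_def
  by (rule ring.dimension_is_inj[OF ring_graded_ring subfield_graded_scalars])

lemma poincare_series_eq:
  "poincare_series f = (1 - fps_X ^ d) / (1 - fps_X) ^ CARD('n)"
proof -
  define N where "N = CARD('n)"
  have N: "N > 0" by (simp add: N_def)
  have inv: "inverse ((1 - fps_X) ^ N) = Abs_fps (\<lambda>k. of_nat ((k + N - 1) choose k) :: rat)"
    using one_minus_const_fps_X_neg_power'[OF N, of "1::rat"] by (simp add: add.commute)
  have coeff: "(of_nat (THE k. graded_dimension f i k) :: rat) =
      of_nat ((i + N - 1) choose i) - (if i < d then 0 else of_nat ((i - d + N - 1) choose (i - d)))" for i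
  proof -
    obtain k where k: "graded_dimension f i k"
      "k + (if d \<le> i then (i - d + N - 1) choose (i - d) else 0) = (i + N - 1) choose i"
      using graded_dimension_formula[of i] unfolding N_def by blast
    have "(THE k. graded_dimension f i k) = k"
      using k(1) graded_dimension_unique by (intro the_equality) auto
    moreover have "(of_nat ((i + N - 1) choose i) :: rat) =
        of_nat k + of_nat (if d \<le> i then (i - d + N - 1) choose (i - d) else 0)"
      unfolding k(2)[symmetric] by simp
    ultimately show ?thesis by auto
  qed
  have "(1 - fps_X ^ d) / (1 - fps_X) ^ N = (1 - fps_X ^ d) * (inverse ((1 - fps_X) ^ N) :: rat fps)"
    by (rule fps_divide_unit) (simp add: fps_power_zeroth)
  also have "\<dots> = poincare_series f"
    unfolding poincare_series_def coeff inv
    by (rule fps_ext) (simp add: left_diff_distrib fps_X_power_mult_nth)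
  finally show ?thesis by (simp add: N_def)
qed

end

section \<open>The arc filtration of a hypersurface with reduced tangent cone\<close>

theorem theorem2:
  fixes f :: "complex^'n::finite \<Rightarrow> complex"
    and P :: "nat \<Rightarrow> 'n mpoly"
    and n d :: nat
  assumes "CARD('n) = n + 1" and "n \<ge> 1"
    and "holo_at_0 f"
    and "homogeneous_parts f P"
    and "d \<ge> 1"
    and "\<forall>j<d. P j = 0" and "P d \<noteq> 0"
    and "no_multiple_factors (P d)"
  shows "(\<forall>i::nat. arc_filtration f i = max_ideal f [^]\<^bsub>ideals_set (local_ring f)\<^esub> i) \<and>
         (\<forall>i. \<exists>k. graded_dimension f i k) \<and>
         poincare_series f = (1 - fps_X ^ d) / (1 - fps_X) ^ (n + 1)"
proof -
  have "f \<in> max_pow d"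
    using homogeneous_parts_max_pow[OF assms(3,4)] assms(6) by blast
  then have lead: "(\<lambda>z. f z - mpoly_eval (P d) z) \<in> max_pow (Suc d)"
    using homogeneous_parts_leading_form[OF _ assms(4)] assms(6) by blast
  have hom: "homogeneous d (P d)" using assms(4) unfolding homogeneous_parts_def by blast
  note hyps = assms(3) lead hom assms(5,7,8)
  have "arc_filtration f i = max_ideal f [^]\<^bsub>ideals_set (local_ring f)\<^esub> i" for i :: nat
    unfolding max_ideal_eq[OF assms(3) f_at_0[OF hyps]] quot_max_pow_power[OF assms(3)]
    by (rule arc_filtration_eq_quot_max_pow[OF hyps])
  moreover have "\<exists>k. graded_dimension f i k" for i
    using graded_dimension_formula[OF hyps, of i] by blast
  ultimately show ?thesis
    using poincare_series_eq[OF hyps] assms(1) by simp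
qed

end
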